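(* Let $H:[0,\infty)\to[\mu,\nu]\subset(0,1)$ be $\beta$-Hölder continuous with $\sup_{s\ge0}H(s)<\beta$, and let $B=(B(t),\,t\ge0)$ be a multifractional Brownian motion with Hurst function $H$ (in either the moving average or the harmonizable representation). Fix $t_0\ge0$ and denote by $\ell(t,x)$ the local time of the fractional Brownian motion with Hurst parameter $H(t_0)$. Then, for every $f\in L^1(\mathbb{R})$ which is locally Riemann integrable, with compact support and such that $\int_{\mathbb{R}}f(x)\,dx\neq0$, and every $t\ge0$, the following convergence in law holds: $$\lim_{\lambda\to\infty}\ \lim_{\rho\to0^+}\ \frac{1}{\lambda^{1-H(t_0)}}\int_0^{\lambda t}f\left(\frac{B(\rho s+t_0)-B(t_0)}{\rho^{H(t_0)}}\right)ds=\int_{\mathbb{R}}f(x)\,dx\cdot\ell(t,0).$$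
   Context: Multifractional Brownian motion with Hurst function $H$ is given by either of the following representations. Moving average representation: $B(t)=\frac{1}{\Gamma(H(t)+1/2)}\Big(\int_{-\infty}^{0}[(t-u)^{H(t)-1/2}-(-u)^{H(t)-1/2}]\,W(du)+\int_0^t(t-u)^{H(t)-1/2}\,W(du)\Big)$, $t\ge 0$, with $W$ a standard Brownian motion on $(-\infty,\infty)$. Harmonizable representation: $B(t)=\int_{\mathbb{R}}\frac{e^{it\xi}-1}{|\xi|^{H(t)+1/2}}\,\widehat W(d\xi)$, where $\widehat W$ is the Fourier transform of real white noise $W$, i.e. $\int f\,d\widehat W=\int\widehat f\,dW$ for $f\in L^2(\mathbb{R})$, with $\widehat f$ the unitary Fourier transform; this process is real-valued. The fractional Brownian motion with Hurst parameter $H(t_0)$ is the process $B^{H(t_0)}$ obtained from the same representation with constant Hurst function equal to $H(t_0)$. Its local time is $\ell(t,x)=\ell([0,t],x)$, where $\ell(A,\cdot)$ is the density with respect to Lebesgue measure $\lambda_{\mathrm{Leb}}$ of the occupation measure $D\mapsto\lambda_{\mathrm{Leb}}\{s\in A:B^{H(t_0)}(s)\in D\}$; the version jointly continuous in $(t,x)$ (known to exist) is used. The iterated limit is in law: for each $\lambda>0$ the random variable converges in law as $\rho\to0^+$, and the resulting limits converge in law, as $\lambda\to\infty$, to the right-hand side. *)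

theory Defs
  imports "HOL-Probability.Probability"
begin

definition holder_continuous_on :: "real \<Rightarrow> real set \<Rightarrow> (real \<Rightarrow> real) \<Rightarrow> bool" where
  "holder_continuous_on \<beta> S h \<longleftrightarrow>
     (\<exists>C\<ge>0. \<forall>s\<in>S. \<forall>u\<in>S. \<bar>h s - h u\<bar> \<le> C * \<bar>s - u\<bar> powr \<beta>)"

(* Riemann's definition by tagged partitions of small mesh: the constant-gauge case of
   the gauge integral of the library. *)
definition riemann_integrable_on :: "(real \<Rightarrow> real) \<Rightarrow> real set \<Rightarrow> bool" where
  "riemann_integrable_on f S \<longleftrightarrow>
     (\<exists>I. \<forall>e>0. \<exists>d>0. \<forall>p. p tagged_division_of S \<and> (\<forall>(x, K)\<in>p. diameter K < d) \<longrightarrow>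
        \<bar>(\<Sum>(x, K)\<in>p. measure lborel K * f x) - I\<bar> < e)"

definition locally_riemann_integrable :: "(real \<Rightarrow> real) \<Rightarrow> bool" where
  "locally_riemann_integrable f \<longleftrightarrow> (\<forall>a b. a \<le> b \<longrightarrow> riemann_integrable_on f {a..b})"

definition compactly_supported :: "(real \<Rightarrow> real) \<Rightarrow> bool" where
  "compactly_supported f \<longleftrightarrow> compact (closure {x. f x \<noteq> 0})"

(* The library's weak_conv_m is restricted to sequences; this is the same condition along an
   arbitrary filter. Measures that are not distributions on the line are excluded, since cdf
   carries no information about them. *)
definition converges_in_law ::
    "('i \<Rightarrow> real measure) \<Rightarrow> real measure \<Rightarrow> 'i filter \<Rightarrow> bool" where
  "converges_in_law P Q F \<longleftrightarrow>
     real_distribution Q \<and> (\<forall>\<^sub>F i in F. real_distribution (P i)) \<and>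
     (\<forall>x. isCont (cdf Q) x \<longrightarrow> ((\<lambda>i. cdf (P i) x) \<longlongrightarrow> cdf Q x) F)"

(* The squared norm is integrated in the extended nonnegative reals, so that non-integrable
   differences have infinite distance rather than distance 0. *)
definition tendsto_L2 ::
    "'a measure \<Rightarrow> ('i \<Rightarrow> 'a \<Rightarrow> 'b::real_normed_vector) \<Rightarrow> ('a \<Rightarrow> 'b) \<Rightarrow> 'i filter \<Rightarrow> bool" where
  "tendsto_L2 M f g F \<longleftrightarrow>
     ((\<lambda>i. \<integral>\<^sup>+x. ennreal ((norm (f i x - g x))\<^sup>2) \<partial>M) \<longlongrightarrow> 0) F"

definition square_integrable ::
    "'a measure \<Rightarrow> ('a \<Rightarrow> 'b::real_normed_vector) \<Rightarrow> bool" where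
  "square_integrable M f \<longleftrightarrow>
     f \<in> borel_measurable M \<and> integrable M (\<lambda>x. (norm (f x))\<^sup>2)"

definition two_sided_brownian_motion :: "'a measure \<Rightarrow> (real \<Rightarrow> 'a \<Rightarrow> real) \<Rightarrow> bool" where
  "two_sided_brownian_motion M W \<longleftrightarrow>
     prob_space M \<and>
     (\<forall>t. W t \<in> borel_measurable M) \<and>
     (AE \<omega> in M. W 0 \<omega> = 0) \<and>
     (\<forall>s t. s < t \<longrightarrow>
        distributed M lborel (\<lambda>\<omega>. W t \<omega> - W s \<omega>) (normal_density 0 (sqrt (t - s)))) \<and>
     (\<forall>\<tau>::nat \<Rightarrow> real. strict_mono \<tau> \<longrightarrow>
        prob_space.indep_vars M (\<lambda>_. borel) (\<lambda>i \<omega>. W (\<tau> (Suc i)) \<omega> - W (\<tau> i) \<omega>) UNIV) \<and>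
     (AE \<omega> in M. continuous_on UNIV (\<lambda>t. W t \<omega>))"

(* A step function is a list of triples (a, b, c), each standing for c on the interval
   from a (exclusive) to b (inclusive). The coefficients may be real or complex. *)
type_synonym 'b step = "(real \<times> real \<times> 'b) list"

definition step_valid :: "'b step \<Rightarrow> bool" where
  "step_valid S \<longleftrightarrow> (\<forall>(a, b, c)\<in>set S. a \<le> b)"

definition step_fun :: "'b::real_normed_vector step \<Rightarrow> real \<Rightarrow> 'b" where
  "step_fun S u = (\<Sum>(a, b, c)\<leftarrow>S. indicator {a<..b} u *\<^sub>R c)"

definition step_integral ::
    "(real \<Rightarrow> 'a \<Rightarrow> real) \<Rightarrow> 'b::real_normed_vector step \<Rightarrow> 'a \<Rightarrow> 'b" where
  "step_integral W S \<omega> = (\<Sum>(a, b, c)\<leftarrow>S. (W b \<omega> - W a \<omega>) *\<^sub>R c)"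

(* X is a version of the Wiener integral of g against W over the real line; being an
   L2 limit, X is determined up to almost sure equality. *)
definition has_wiener_integral ::
    "'a measure \<Rightarrow> (real \<Rightarrow> 'a \<Rightarrow> real) \<Rightarrow> (real \<Rightarrow> 'b::real_normed_vector) \<Rightarrow> ('a \<Rightarrow> 'b) \<Rightarrow> bool"
  where
  "has_wiener_integral M W g X \<longleftrightarrow>
     square_integrable lborel g \<and> X \<in> borel_measurable M \<and>
     (\<exists>S :: nat \<Rightarrow> 'b step. (\<forall>n. step_valid (S n)) \<and>
        tendsto_L2 lborel (\<lambda>n. step_fun (S n)) g sequentially \<and>
        tendsto_L2 M (\<lambda>n. step_integral W (S n)) X sequentially)"

definition has_wiener_integral_on ::
    "'a measure \<Rightarrow> (real \<Rightarrow> 'a \<Rightarrow> real) \<Rightarrow> real set \<Rightarrow> (real \<Rightarrow> real) \<Rightarrow> ('a \<Rightarrow> real) \<Rightarrow> bool"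
  where
  "has_wiener_integral_on M W A g X \<longleftrightarrow>
     has_wiener_integral M W (\<lambda>u. indicator A u * g u) X"

(* Unitary (Plancherel) Fourier transform on L2, as the L2 limit of the transforms of the
   truncations of g. *)
definition has_L2_fourier_transform :: "(real \<Rightarrow> complex) \<Rightarrow> (real \<Rightarrow> complex) \<Rightarrow> bool" where
  "has_L2_fourier_transform g G \<longleftrightarrow>
     square_integrable lborel g \<and> square_integrable lborel G \<and>
     tendsto_L2 lborel
       (\<lambda>R \<xi>. (1 / complex_of_real (sqrt (2 * pi))) *
              (LINT x:{-R..R}|lborel. cis (- (\<xi> * x)) * g x)) G (at_top :: real filter)"

(* Integral against the Fourier transform of the white noise of W. *)
definition has_fourier_wiener_integral ::
    "'a measure \<Rightarrow> (real \<Rightarrow> 'a \<Rightarrow> real) \<Rightarrow> (real \<Rightarrow> complex) \<Rightarrow> ('a \<Rightarrow> complex) \<Rightarrow> bool" where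
  "has_fourier_wiener_integral M W g X \<longleftrightarrow>
     (\<exists>G. has_L2_fourier_transform g G \<and> has_wiener_integral M W G X)"

datatype mbm_representation = Moving_Average | Harmonizable

definition moving_average_value ::
    "'a measure \<Rightarrow> (real \<Rightarrow> 'a \<Rightarrow> real) \<Rightarrow> real \<Rightarrow> real \<Rightarrow> ('a \<Rightarrow> real) \<Rightarrow> bool" where
  "moving_average_value M W h t X \<longleftrightarrow>
     (\<exists>I J.
        has_wiener_integral_on M W {..0} (\<lambda>u. (t - u) powr (h - 1/2) - (- u) powr (h - 1/2)) I \<and>
        has_wiener_integral_on M W {0..t} (\<lambda>u. (t - u) powr (h - 1/2)) J \<and>
        (AE \<omega> in M. X \<omega> = 1 / Gamma (h + 1/2) * (I \<omega> + J \<omega>)))"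

definition harmonizable_value ::
    "'a measure \<Rightarrow> (real \<Rightarrow> 'a \<Rightarrow> real) \<Rightarrow> real \<Rightarrow> real \<Rightarrow> ('a \<Rightarrow> real) \<Rightarrow> bool" where
  "harmonizable_value M W h t X \<longleftrightarrow>
     has_fourier_wiener_integral M W
       (\<lambda>\<xi>. (cis (t * \<xi>) - 1) / complex_of_real (\<bar>\<xi>\<bar> powr (h + 1/2)))
       (\<lambda>\<omega>. complex_of_real (X \<omega>))"

(* The stochastic integrals determine B(t) only almost surely for each t. Joint measurability
   is what makes integrals of B over time meaningful; it holds in particular for the version
   with continuous paths. *)
definition multifractional_brownian_motion ::
    "mbm_representation \<Rightarrow> 'a measure \<Rightarrow> (real \<Rightarrow> 'a \<Rightarrow> real) \<Rightarrow> (real \<Rightarrow> real) \<Rightarrow>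
       (real \<Rightarrow> 'a \<Rightarrow> real) \<Rightarrow> bool" where
  "multifractional_brownian_motion R M W H B \<longleftrightarrow>
     two_sided_brownian_motion M W \<and>
     (\<lambda>(t, \<omega>). B t \<omega>) \<in> borel_measurable (restrict_space borel {0..} \<Otimes>\<^sub>M M) \<and>
     (\<forall>t\<ge>0. case R of
        Moving_Average \<Rightarrow> moving_average_value M W (H t) t (B t)
      | Harmonizable \<Rightarrow> harmonizable_value M W (H t) t (B t))"

definition fractional_brownian_motion ::
    "mbm_representation \<Rightarrow> 'a measure \<Rightarrow> (real \<Rightarrow> 'a \<Rightarrow> real) \<Rightarrow> real \<Rightarrow>
       (real \<Rightarrow> 'a \<Rightarrow> real) \<Rightarrow> bool" where
  "fractional_brownian_motion R M W h X \<longleftrightarrow>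
     multifractional_brownian_motion R M W (\<lambda>_. h) X"

definition occupation_measure ::
    "(real \<Rightarrow> 'a \<Rightarrow> real) \<Rightarrow> real set \<Rightarrow> 'a \<Rightarrow> real measure" where
  "occupation_measure X A \<omega> = distr (restrict_space lborel A) borel (\<lambda>s. X s \<omega>)"

definition jointly_continuous_local_time ::
    "'a measure \<Rightarrow> (real \<Rightarrow> 'a \<Rightarrow> real) \<Rightarrow> (real \<Rightarrow> real \<Rightarrow> 'a \<Rightarrow> real) \<Rightarrow> bool" where
  "jointly_continuous_local_time M X l \<longleftrightarrow>
     (AE \<omega> in M.
        continuous_on ({0..} \<times> UNIV) (\<lambda>(t, x). l t x \<omega>) \<and>
        (\<forall>t\<ge>0. (\<forall>x. 0 \<le> l t x \<omega>) \<and>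
           occupation_measure X {0..t} \<omega> = density lborel (\<lambda>x. ennreal (l t x \<omega>))))"

end

theory Submission
  imports Defs
begin

text \<open>Write \<open>h = H t0\<close>. In either representation \<open>B t\<close> and \<open>X t\<close> are Wiener integrals of real kernels
  \<open>\<kappa> t\<close> and \<open>k t\<close>. The kernels of \<open>X\<close> satisfy
  \<open>k (r * s + t) - k t = r powr (h - 1/2) * k s ((\<cdot> - t) / r)\<close>, which has the \<open>L\<^sup>2\<close> norm of
  \<open>r powr h * k s\<close>, while \<open>\<kappa> t - k t\<close> has norm \<open>O(\<bar>H t - h\<bar>) = O(\<bar>t - t0\<bar> powr \<beta>)\<close> with \<open>\<beta> > h\<close>. Hence the
  covariances of the rescaled increments \<open>Y r s = (B (r * s + t0) - B t0) / r powr h\<close> converge to those of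
  \<open>X\<close> as \<open>r \<rightarrow> 0\<close>. For the harmonizable representation only Bessel's inequality and the behaviour of the
  transform under dilation and modulation are used, not Plancherel's identity.

  If \<open>u\<close> is the Fourier transform of an integrable function, the moments of \<open>\<integral> u (Y r s) ds\<close> are integrals of
  Gaussian characteristic functions and therefore converge; these variables are uniformly bounded, so their
  laws converge. The variance of \<open>Y r s\<close> is at least a constant times \<open>s powr (2 * h)\<close> for small \<open>r\<close>, so
  \<open>E \<integral> \<bar>g (Y r s)\<bar> ds\<close> is at most a constant times the \<open>L\<^sup>1\<close> norm of \<open>g\<close>, and the convergence passes from
  such \<open>u\<close> to every integrable \<open>f\<close>; \<open>X\<close> is not degenerate because it has a local time. Finally the
  inner limit is the law of \<open>\<Lambda> powr h * \<integral> f (\<Lambda> powr h * X s) ds = \<integral> f y * l t (y / \<Lambda> powr h) dy\<close>, which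
  tends to \<open>l t 0 * \<integral> f\<close> almost surely by continuity of the local time.\<close>

text \<open>\<open>B\<close> and the limiting \<open>X\<close> may live on different probability
  spaces and \<open>f\<close> need not be continuous, so neither a pathwise comparison nor the
  continuous mapping theorem is at hand. All comparisons are made between characteristic functions,
  and the discontinuity of \<open>f\<close> is paid for by the occupation bound, which sees only an
  L1 norm. That bound rests on a relative estimate: the variance of the error is at most a constant
  times \<open>s powr (2 * h) * (r * s) powr (2 * (\<beta> - h))\<close>, hence small against the
  main variance \<open>s powr (2 * h) * v\<close> even as \<open>s\<close> tends to 0. Time is
  rescaled before the inner limit is taken, so every inner limit is a functional of \<open>X\<close>
  on the one interval \<open>{0..t}\<close>, and the outer limit can be taken path by path. Finally,
  \<open>f\<close> is only Lebesgue measurable and the local time is given path by path; this is why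
  the laws are taken on completed spaces and why measurable versions are exchanged for the
  originals.\<close>

section \<open>Step functions\<close>

text \<open>Independence of increments is given along strictly increasing sequences indexed by all
  naturals, so a finite set of endpoints has to be continued to such a sequence.\<close>

lemma finite_subset_strict_mono_image:
  fixes P :: "real set"
  assumes "finite P"
  shows "\<exists>\<tau> m. strict_mono (\<tau>::nat \<Rightarrow> real) \<and> P \<subseteq> \<tau> ` {..<m}"
proof -
  obtain c where c: "\<And>x. x \<in> P \<Longrightarrow> x \<le> c"
    using assms by (meson bdd_above.E bdd_above_finite)
  define xs where "xs = sorted_list_of_set P"
  have set_xs: "set xs = P" and sorted: "sorted_wrt (<) xs"
    using assms by (auto simp: xs_def)
  \<comment> \<open>After the sorted points the sequence goes on in unit steps beyond the bound
    \<open>c\<close>.\<close>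
  define \<tau> where "\<tau> i = (if i < length xs then xs ! i else c + 1 + real i)" for i
  have "strict_mono \<tau>"
  proof (rule strict_monoI)
    fix i j :: nat assume "i < j"
    have "xs ! i < c + 1 + real j" if "i < length xs"
      using c[of "xs ! i"] set_xs that by (auto simp: nth_mem)
    with \<open>i < j\<close> sorted show "\<tau> i < \<tau> j"
      by (auto simp: \<tau>_def sorted_wrt_iff_nth_less)
  qed
  moreover have "P \<subseteq> \<tau> ` {..<length xs}"
    using set_xs by (force simp: \<tau>_def in_set_conv_nth image_iff)
  ultimately show ?thesis by blast
qed

lemma indicator_telescope:
  fixes \<tau> :: "nat \<Rightarrow> real"
  assumes "mono \<tau>" "i \<le> j"
  shows "(indicator {\<tau> i<..\<tau> j} u :: real) = (\<Sum>l\<in>{i..<j}. indicator {\<tau> l<..\<tau> (Suc l)} u)"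
  using assms(2)
proof (induction rule: dec_induct)
  case (step n)
  have "\<tau> i \<le> \<tau> n" "\<tau> n \<le> \<tau> (Suc n)" using assms(1) step(1) by (auto intro: monoD)
  then have "(indicator {\<tau> i<..\<tau> (Suc n)} u :: real)
      = indicator {\<tau> i<..\<tau> n} u + indicator {\<tau> n<..\<tau> (Suc n)} u"
    by (auto simp: indicator_def)
  with step show ?case by simp
qed auto

text \<open>The intervals of a step list may overlap. On a common grid they split into disjoint
  cells, and the same coefficients \<open>d\<close> serve the function and the integral, so that the
  L2 norm and the independent increments are read off one representation.\<close>

lemma step_common_refinement:
  fixes \<tau> :: "nat \<Rightarrow> real" and S :: "'b::real_normed_vector step"
  assumes "strict_mono \<tau>" "step_valid S" "\<And>a b c. (a, b, c) \<in> set S \<Longrightarrow> {a, b} \<subseteq> \<tau> ` {..<m}"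
  shows "\<exists>d. (\<forall>u. step_fun S u = (\<Sum>l<m. indicator {\<tau> l<..\<tau> (Suc l)} u *\<^sub>R d l)) \<and>
    (\<forall>W \<omega>. step_integral W S (\<omega>::'a) = (\<Sum>l<m. (W (\<tau> (Suc l)) \<omega> - W (\<tau> l) \<omega>) *\<^sub>R d l))"
  using assms(2,3)
proof (induction S)
  case Nil
  show ?case by (rule exI[of _ "\<lambda>_. 0"]) (simp add: step_fun_def step_integral_def)
next
  case (Cons p S)
  obtain a b c where p: "p = (a, b, c)" by (cases p)
  have "step_valid S" "a \<le> b" using Cons.prems(1) by (auto simp: step_valid_def p)
  from Cons.IH[OF this(1)] Cons.prems(2) obtain d where
    d: "\<And>u. step_fun S u = (\<Sum>l<m. indicator {\<tau> l<..\<tau> (Suc l)} u *\<^sub>R d l)"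
       "\<And>W \<omega>::'a. step_integral W S \<omega> = (\<Sum>l<m. (W (\<tau> (Suc l)) \<omega> - W (\<tau> l) \<omega>) *\<^sub>R d l)"
    by (meson list.set_intros(2))
  obtain i j where ij: "a = \<tau> i" "b = \<tau> j" "i < m" "j < m"
    using Cons.prems(2)[of a b c] by (auto simp: p)
  then have "i \<le> j" using \<open>a \<le> b\<close> assms(1) by (simp add: strict_mono_less_eq)
  \<comment> \<open>The triple \<open>(a, b, c)\<close> contributes \<open>c\<close> on the grid
    cells from \<open>i\<close> to \<open>j - 1\<close>, which together make up the interval from
    \<open>a\<close> to \<open>b\<close>.\<close>
  define e where "e l = (if l \<in> {i..<j} then c else 0)" for l
  have e: "(\<Sum>l<m. g l *\<^sub>R e l) = (\<Sum>l\<in>{i..<j}. g l) *\<^sub>R c" for g :: "nat \<Rightarrow> real"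
  proof -
    have "(\<Sum>l<m. g l *\<^sub>R e l) = (\<Sum>l\<in>{i..<j}. g l *\<^sub>R e l)"
      using ij by (intro sum.mono_neutral_right) (auto simp: e_def)
    then show ?thesis by (simp add: e_def scaleR_sum_left)
  qed
  have "step_fun (p # S) u = (\<Sum>l<m. indicator {\<tau> l<..\<tau> (Suc l)} u *\<^sub>R (e l + d l))" for u
    using indicator_telescope[OF strict_mono_mono[OF assms(1)] \<open>i \<le> j\<close>, of u] d(1)[of u]
    by (simp add: step_fun_def p ij scaleR_add_right sum.distrib e)
  moreover have "step_integral W (p # S) \<omega>
      = (\<Sum>l<m. (W (\<tau> (Suc l)) \<omega> - W (\<tau> l) \<omega>) *\<^sub>R (e l + d l))" for W and \<omega> :: 'a
    using d(2)[of W \<omega>] sum_Suc_diff'[OF \<open>i \<le> j\<close>, of "\<lambda>l. W (\<tau> l) \<omega>"]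
    by (simp add: step_integral_def p ij scaleR_add_right sum.distrib e)
  ultimately show ?case by (intro exI[of _ "\<lambda>l. e l + d l"]) simp
qed

section \<open>Characteristic functions of step integrals\<close>

lemma (in prob_space) normal_iexp:
  assumes D: "distributed M lborel D (normal_density 0 \<sigma>)" and "\<sigma> > 0"
  shows "(CLINT \<omega>|M. iexp (t * D \<omega>)) = of_real (exp (- (\<sigma> * t)\<^sup>2 / 2))"
proof -
  have "distributed M lborel (\<lambda>\<omega>. (D \<omega> - 0) / \<sigma>) std_normal_density"
    using normal_standard_normal_convert[OF \<open>\<sigma> > 0\<close>] D by blast
  then have S: "distr M lborel (\<lambda>\<omega>. D \<omega> / \<sigma>) = std_normal_distribution"
    and meas: "(\<lambda>\<omega>. D \<omega> / \<sigma>) \<in> borel_measurable M"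
    by (auto simp: distributed_def)
  have "(CLINT \<omega>|M. iexp (t * D \<omega>)) = (CLINT \<omega>|M. iexp ((\<sigma> * t) * (D \<omega> / \<sigma>)))"
    using \<open>\<sigma> > 0\<close> by (intro Bochner_Integration.integral_cong) (auto simp: field_simps)
  also have "\<dots> = char (distr M lborel (\<lambda>\<omega>. D \<omega> / \<sigma>)) (\<sigma> * t)"
    unfolding char_def using meas by (subst integral_distr) auto
  also have "\<dots> = of_real (exp (- (\<sigma> * t)\<^sup>2 / 2))"
    unfolding S by (simp add: char_std_normal_distribution)
  finally show ?thesis .
qed

lemma two_sided_brownian_motionD:
  assumes "two_sided_brownian_motion M W"
  shows "prob_space M" "W t \<in> borel_measurable M"
    "s < t \<Longrightarrow> distributed M lborel (\<lambda>\<omega>. W t \<omega> - W s \<omega>) (normal_density 0 (sqrt (t - s)))"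
    "strict_mono (\<tau>::nat \<Rightarrow> real) \<Longrightarrow>
       prob_space.indep_vars M (\<lambda>_. borel) (\<lambda>i \<omega>. W (\<tau> (Suc i)) \<omega> - W (\<tau> i) \<omega>) UNIV"
  using assms by (auto simp: two_sided_brownian_motion_def)

lemma step_fun_measurable [measurable]:
  fixes S :: "'b::{real_normed_vector, second_countable_topology} step"
  shows "step_fun S \<in> borel_measurable borel"
  by (induction S) (auto simp: step_fun_def[abs_def])

lemma step_integral_measurable:
  fixes S :: "'b::{real_normed_vector, second_countable_topology} step"
  assumes "two_sided_brownian_motion M W"
  shows "step_integral W S \<in> borel_measurable M"
  using two_sided_brownian_motionD(2)[OF assms]
  by (induction S) (auto simp: step_integral_def[abs_def])

text \<open>On the grid the integral is a sum of independent centred normal variables, so its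
  characteristic function is a product. The exponents add up to the squared L2 norm because the
  cells are disjoint and the cross terms vanish.\<close>

lemma step_integral_iexp:
  fixes S :: "real step"
  assumes W: "two_sided_brownian_motion M W" and "step_valid S"
  shows "(CLINT \<omega>|M. iexp (step_integral W S \<omega>)) = of_real (exp (- (LINT u|lborel. (step_fun S u)\<^sup>2) / 2))"
    and "integrable lborel (\<lambda>u. (step_fun S u)\<^sup>2)"
proof -
  interpret prob_space M by (rule two_sided_brownian_motionD(1)[OF W])
  obtain \<tau> m where \<tau>: "strict_mono (\<tau>::nat \<Rightarrow> real)" "(\<Union>(a, b, c)\<in>set S. {a, b}) \<subseteq> \<tau> ` {..<m}"
    using finite_subset_strict_mono_image[of "\<Union>(a, b, c)\<in>set S. {a, b}"] by (auto simp: split_beta)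
  obtain d where
    d: "\<And>u. step_fun S u = (\<Sum>l<m. indicator {\<tau> l<..\<tau> (Suc l)} u *\<^sub>R d l)"
       "\<And>W \<omega>::'a. step_integral W S \<omega> = (\<Sum>l<m. (W (\<tau> (Suc l)) \<omega> - W (\<tau> l) \<omega>) *\<^sub>R d l)"
    using step_common_refinement[OF \<tau>(1) assms(2), of m] \<tau>(2) by fastforce
  let ?I = "\<lambda>l. {\<tau> l<..\<tau> (Suc l)}"
  have less: "\<tau> l < \<tau> (Suc l)" for l using \<tau>(1) by (simp add: strict_mono_less)
  have disj: "?I k \<inter> ?I l = {}" if "k \<noteq> l" for k l
    using that strict_mono_less_eq[OF \<tau>(1), of "Suc k" l] strict_mono_less_eq[OF \<tau>(1), of "Suc l" k]
    by (cases "k < l") auto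
  have "(step_fun S u)\<^sup>2 = (\<Sum>l<m. (d l)\<^sup>2 * indicator (?I l) u)" for u
  proof -
    have "(step_fun S u)\<^sup>2 = (\<Sum>k<m. \<Sum>l<m. (indicator (?I k) u * d k) * (indicator (?I l) u * d l))"
      by (simp only: d(1) power2_eq_square sum_product real_scaleR_def)
    also have "\<dots> = (\<Sum>k<m. \<Sum>l<m. if k = l then (d l)\<^sup>2 * indicator (?I l) u else 0)"
    proof (intro sum.cong refl)
      fix k l
      show "indicator (?I k) u * d k * (indicator (?I l) u * d l)
          = (if k = l then (d l)\<^sup>2 * indicator (?I l) u else 0)"
        using disj[of k l] by (cases "u \<in> ?I k"; cases "u \<in> ?I l") (auto simp: power2_eq_square)
    qed
    finally show ?thesis by (simp add: sum.delta)
  qed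
  then have sq: "(\<lambda>u. (step_fun S u)\<^sup>2) = (\<lambda>u. \<Sum>l<m. (d l)\<^sup>2 * indicator (?I l) u)" by auto
  have int: "integrable lborel (\<lambda>u. (d l)\<^sup>2 * indicator (?I l) u)" for l
    using less[of l] by (intro integrable_mult_right integrable_real_indicator) auto
  then show "integrable lborel (\<lambda>u. (step_fun S u)\<^sup>2)" unfolding sq by (intro Bochner_Integration.integrable_sum int)
  have var: "(LINT u|lborel. (step_fun S u)\<^sup>2) = (\<Sum>l<m. (d l)\<^sup>2 * (\<tau> (Suc l) - \<tau> l))"
    unfolding sq using less by (subst Bochner_Integration.integral_sum[OF int]) (simp add: less_imp_le)
  let ?X = "\<lambda>l \<omega>. (W (\<tau> (Suc l)) \<omega> - W (\<tau> l) \<omega>) * d l"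
  have ind: "indep_vars (\<lambda>_. borel) ?X {..<m}"
    by (rule indep_vars_compose2[where Y="\<lambda>l x. x * d l" and M'="\<lambda>_. borel", OF indep_vars_subset[OF two_sided_brownian_motionD(4)[OF W \<tau>(1)]]]) auto
  have [measurable]: "W t \<in> borel_measurable M" for t by (rule two_sided_brownian_motionD(2)[OF W])
  have one: "char (distr M borel (?X l)) 1 = of_real (exp (- ((d l)\<^sup>2 * (\<tau> (Suc l) - \<tau> l)) / 2))" for l
  proof -
    have "char (distr M borel (?X l)) 1 = (CLINT \<omega>|M. iexp (d l * (W (\<tau> (Suc l)) \<omega> - W (\<tau> l) \<omega>)))"
      unfolding char_def by (subst integral_distr) (auto simp: mult_ac)
    also have "\<dots> = of_real (exp (- (sqrt (\<tau> (Suc l) - \<tau> l) * d l)\<^sup>2 / 2))"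
      using less[of l] by (intro normal_iexp two_sided_brownian_motionD(3)[OF W]) auto
    finally show ?thesis using less[of l] by (simp add: power_mult_distrib mult.commute)
  qed
  have "(CLINT \<omega>|M. iexp (step_integral W S \<omega>)) = char (distr M borel (\<lambda>\<omega>. \<Sum>l<m. ?X l \<omega>)) 1"
    unfolding char_def d(2) by (subst integral_distr) auto
  also have "\<dots> = (\<Prod>l<m. of_real (exp (- ((d l)\<^sup>2 * (\<tau> (Suc l) - \<tau> l)) / 2)))"
    by (subst char_distr_sum[OF ind]) (simp only: one)
  also have "\<dots> = of_real (exp (- (LINT u|lborel. (step_fun S u)\<^sup>2) / 2))"
    unfolding var by (simp add: exp_sum[symmetric] sum_negf sum_divide_distrib flip: of_real_prod)
  finally show "(CLINT \<omega>|M. iexp (step_integral W S \<omega>)) = of_real (exp (- (LINT u|lborel. (step_fun S u)\<^sup>2) / 2))" .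
qed

section \<open>Mean-square convergence\<close>

lemma ennreal_tendsto_0_le:
  fixes f g :: "'i \<Rightarrow> ennreal"
  assumes "(f \<longlongrightarrow> 0) F" "\<And>i. g i \<le> f i"
  shows "(g \<longlongrightarrow> 0) F"
  by (rule tendsto_sandwich[OF _ _ tendsto_const assms(1)]) (auto simp: assms(2))

text \<open>Serves in place of the triangle inequality of L2; the factor 2 is the price for working
  with squared norms only.\<close>

lemma norm_add_sq_le: "(norm (x + y))\<^sup>2 \<le> 2 * (norm x)\<^sup>2 + 2 * (norm (y::'b::real_normed_vector))\<^sup>2"
proof -
  have "(norm (x + y))\<^sup>2 \<le> (norm x + norm y)\<^sup>2"
    by (intro power_mono norm_triangle_ineq) auto
  also have "\<dots> \<le> 2 * (norm x)\<^sup>2 + 2 * (norm y)\<^sup>2"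
    using zero_le_power2[of "norm x - norm y"] by (simp add: power2_eq_square algebra_simps)
  finally show ?thesis .
qed

lemma square_integrable_add:
  fixes f g :: "'a \<Rightarrow> 'b::{real_normed_vector, second_countable_topology}"
  assumes "square_integrable M f" "square_integrable M g"
  shows "square_integrable M (\<lambda>x. f x + g x)"
proof -
  have [measurable]: "f \<in> borel_measurable M" "g \<in> borel_measurable M"
    using assms by (auto simp: square_integrable_def)
  have "integrable M (\<lambda>x. (norm (f x + g x))\<^sup>2)"
    by (rule Bochner_Integration.integrable_bound[where f="\<lambda>x. 2 * (norm (f x))\<^sup>2 + 2 * (norm (g x))\<^sup>2"])
      (use assms in \<open>auto simp: square_integrable_def intro!: norm_add_sq_le\<close>)
  then show ?thesis by (auto simp: square_integrable_def)
qed

lemma square_integrable_bounded_linear: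
  fixes f :: "'a \<Rightarrow> 'b::{real_normed_vector, second_countable_topology}"
    and T :: "'b \<Rightarrow> 'c::{real_normed_vector, second_countable_topology}"
  assumes "square_integrable M f" "bounded_linear T"
  shows "square_integrable M (\<lambda>x. T (f x))"
proof -
  have [measurable]: "f \<in> borel_measurable M" using assms by (auto simp: square_integrable_def)
  have "T \<in> borel_measurable borel"
    by (rule borel_measurable_continuous_onI[OF linear_continuous_on[OF assms(2)]])
  then have meas: "(\<lambda>x. T (f x)) \<in> borel_measurable M" by (rule measurable_compose[rotated]) measurable
  obtain K where K: "\<And>x. norm (T x) \<le> norm x * K" using bounded_linear.bounded[OF assms(2)] by blast
  have sq: "(norm (T x))\<^sup>2 \<le> K\<^sup>2 * (norm x)\<^sup>2" for x
    using power_mono[OF K[of x], of 2] by (simp add: power_mult_distrib mult.commute)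
  have "integrable M (\<lambda>x. (norm (T (f x)))\<^sup>2)"
  proof (rule Bochner_Integration.integrable_bound)
    show "integrable M (\<lambda>x. K\<^sup>2 * (norm (f x))\<^sup>2)"
      using assms(1) by (simp add: square_integrable_def)
    show "AE x in M. norm ((norm (T (f x)))\<^sup>2) \<le> norm (K\<^sup>2 * (norm (f x))\<^sup>2)"
      by (intro AE_I2) (simp add: sq)
  qed (use meas in measurable)
  with meas show ?thesis by (simp add: square_integrable_def)
qed

lemma square_integrable_diff:
  fixes f g :: "'a \<Rightarrow> 'b::{real_normed_vector, second_countable_topology}"
  assumes "square_integrable M f" "square_integrable M g"
  shows "square_integrable M (\<lambda>x. f x - g x)"
  using square_integrable_add[OF assms(1) square_integrable_bounded_linear[OF assms(2), of uminus]]
  by (simp add: bounded_linear_minus bounded_linear_ident)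

lemma tendsto_L2_add:
  fixes f :: "'i \<Rightarrow> 'a \<Rightarrow> 'b::{real_normed_vector, second_countable_topology}"
  assumes "tendsto_L2 M f g F" "tendsto_L2 M f' g' F"
    and [measurable]: "\<And>i. f i \<in> borel_measurable M" "g \<in> borel_measurable M"
      "\<And>i. f' i \<in> borel_measurable M" "g' \<in> borel_measurable M"
  shows "tendsto_L2 M (\<lambda>i x. f i x + f' i x) (\<lambda>x. g x + g' x) F"
proof -
  let ?n = "\<lambda>h h' i. \<integral>\<^sup>+x. ennreal ((norm (h i x - h' x))\<^sup>2) \<partial>M"
  have bound: "?n (\<lambda>i x. f i x + f' i x) (\<lambda>x. g x + g' x) i \<le> 2 * ?n f g i + 2 * ?n f' g' i" for i
  proof -
    have "?n (\<lambda>i x. f i x + f' i x) (\<lambda>x. g x + g' x) i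
        \<le> (\<integral>\<^sup>+x. 2 * ennreal ((norm (f i x - g x))\<^sup>2) + 2 * ennreal ((norm (f' i x - g' x))\<^sup>2) \<partial>M)"
    proof (intro nn_integral_mono)
      fix x
      have "ennreal ((norm (f i x + f' i x - (g x + g' x)))\<^sup>2)
          \<le> ennreal (2 * (norm (f i x - g x))\<^sup>2 + 2 * (norm (f' i x - g' x))\<^sup>2)"
        using norm_add_sq_le[of "f i x - g x" "f' i x - g' x"]
        by (intro ennreal_leI) (simp add: algebra_simps)
      then show "ennreal ((norm (f i x + f' i x - (g x + g' x)))\<^sup>2)
          \<le> 2 * ennreal ((norm (f i x - g x))\<^sup>2) + 2 * ennreal ((norm (f' i x - g' x))\<^sup>2)"
        by (simp add: ennreal_mult'' ennreal_plus)
    qed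
    also have "\<dots> = 2 * ?n f g i + 2 * ?n f' g' i"
      by (subst nn_integral_add) (auto simp: nn_integral_cmult)
    finally show ?thesis .
  qed
  have "((\<lambda>i. 2 * ?n f g i + 2 * ?n f' g' i) \<longlongrightarrow> 2 * 0 + 2 * 0) F"
    using assms(1,2) unfolding tendsto_L2_def
    by (intro tendsto_add ennreal_tendsto_cmult) auto
  then have "((\<lambda>i. 2 * ?n f g i + 2 * ?n f' g' i) \<longlongrightarrow> 0) F" by simp
  then show ?thesis
    unfolding tendsto_L2_def by (rule ennreal_tendsto_0_le[OF _ bound])
qed

text \<open>Covers negation, scalar multiples and real parts at once.\<close>

lemma tendsto_L2_bounded_linear:
  fixes f :: "'i \<Rightarrow> 'a \<Rightarrow> 'b::{real_normed_vector, second_countable_topology}"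
    and T :: "'b \<Rightarrow> 'c::real_normed_vector"
  assumes "tendsto_L2 M f g F" "bounded_linear T"
    and [measurable]: "\<And>i. f i \<in> borel_measurable M" "g \<in> borel_measurable M"
  shows "tendsto_L2 M (\<lambda>i x. T (f i x)) (\<lambda>x. T (g x)) F"
proof -
  obtain K where K: "\<And>x. norm (T x) \<le> norm x * K" using bounded_linear.bounded[OF assms(2)] by blast
  have sq: "(norm (T x))\<^sup>2 \<le> K\<^sup>2 * (norm x)\<^sup>2" for x
    using power_mono[OF K[of x], of 2] by (simp add: power_mult_distrib mult.commute)
  have bound: "(\<integral>\<^sup>+x. ennreal ((norm (T (f i x) - T (g x)))\<^sup>2) \<partial>M)
      \<le> ennreal (K\<^sup>2) * (\<integral>\<^sup>+x. ennreal ((norm (f i x - g x))\<^sup>2) \<partial>M)" for i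
  proof -
    have "ennreal ((norm (T (f i x) - T (g x)))\<^sup>2) \<le> ennreal (K\<^sup>2) * ennreal ((norm (f i x - g x))\<^sup>2)" for x
      unfolding linear_diff[OF bounded_linear.linear[OF assms(2)], symmetric]
      by (subst ennreal_mult[symmetric]) (simp_all only: zero_le_power2 ennreal_leI sq)
    then show ?thesis by (subst nn_integral_cmult[symmetric]) (simp_all add: nn_integral_mono)
  qed
  have "((\<lambda>i. ennreal (K\<^sup>2) * (\<integral>\<^sup>+x. ennreal ((norm (f i x - g x))\<^sup>2) \<partial>M)) \<longlongrightarrow> ennreal (K\<^sup>2) * 0) F"
    using assms(1) unfolding tendsto_L2_def by (intro ennreal_tendsto_cmult) auto
  then have "((\<lambda>i. ennreal (K\<^sup>2) * (\<integral>\<^sup>+x. ennreal ((norm (f i x - g x))\<^sup>2) \<partial>M)) \<longlongrightarrow> 0) F" by simp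
  then show ?thesis
    unfolding tendsto_L2_def by (rule ennreal_tendsto_0_le[OF _ bound])
qed

lemma tendsto_L2_diff:
  fixes f :: "'i \<Rightarrow> 'a \<Rightarrow> 'b::{real_normed_vector, second_countable_topology}"
  assumes "tendsto_L2 M f g F" "tendsto_L2 M f' g' F"
    and [measurable]: "\<And>i. f i \<in> borel_measurable M" "g \<in> borel_measurable M"
      "\<And>i. f' i \<in> borel_measurable M" "g' \<in> borel_measurable M"
  shows "tendsto_L2 M (\<lambda>i x. f i x - f' i x) (\<lambda>x. g x - g' x) F"
  using tendsto_L2_add[OF assms(1) tendsto_L2_bounded_linear[OF assms(2), of uminus]]
  by (simp add: bounded_linear_minus bounded_linear_ident)

lemma tendsto_L2_unique:
  fixes f :: "'i \<Rightarrow> 'a \<Rightarrow> 'b::{real_normed_vector, second_countable_topology}"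
  assumes "tendsto_L2 M f g F" "tendsto_L2 M f g' F" "F \<noteq> bot"
    and [measurable]: "\<And>i. f i \<in> borel_measurable M" "g \<in> borel_measurable M" "g' \<in> borel_measurable M"
  shows "AE x in M. g x = g' x"
proof -
  have "((\<lambda>i. \<integral>\<^sup>+x. ennreal ((norm (g x - g' x))\<^sup>2) \<partial>M) \<longlongrightarrow> 0) F"
    using tendsto_L2_diff[OF assms(1,2) assms(4,5,4,6)] unfolding tendsto_L2_def by (simp add: norm_minus_commute)
  then have "(\<integral>\<^sup>+x. ennreal ((norm (g x - g' x))\<^sup>2) \<partial>M) = 0"
    using \<open>F \<noteq> bot\<close> by (simp add: tendsto_const_iff)
  then show ?thesis by (subst (asm) nn_integral_0_iff_AE) (auto elim: eventually_mono)
qed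

lemma tendsto_L2_AE_cong:
  assumes "AE x in M. g x = g' x" "tendsto_L2 M f g F"
  shows "tendsto_L2 M f g' F"
proof -
  have "(\<integral>\<^sup>+x. ennreal ((norm (f i x - g x))\<^sup>2) \<partial>M) = (\<integral>\<^sup>+x. ennreal ((norm (f i x - g' x))\<^sup>2) \<partial>M)" for i
    using assms(1) by (intro nn_integral_cong_AE) auto
  with assms(2) show ?thesis by (simp add: tendsto_L2_def)
qed

lemma square_integrable_AE_cong:
  assumes "AE x in M. g x = g' x" "square_integrable M g" "g' \<in> borel_measurable M"
  shows "square_integrable M (g' :: 'a \<Rightarrow> 'b::{real_normed_vector, second_countable_topology})"
proof -
  have "integrable M (\<lambda>x. (norm (g x))\<^sup>2) = integrable M (\<lambda>x. (norm (g' x))\<^sup>2)"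
    using assms by (intro Bochner_Integration.integrable_cong_AE) (auto simp: square_integrable_def)
  with assms show ?thesis by (simp add: square_integrable_def)
qed

text \<open>A quantitative form of the continuity of the squared norm on \<open>L\<^sup>2\<close> that needs neither the
  Cauchy--Schwarz nor the Minkowski inequality.\<close>

lemma integral_square_perturb:
  fixes y e :: "'a \<Rightarrow> real"
  assumes "square_integrable M y" "square_integrable M e" "c > 0"
  shows "\<bar>(LINT x|M. (y x + e x)\<^sup>2) - (LINT x|M. (y x)\<^sup>2)\<bar>
    \<le> c * (LINT x|M. (y x)\<^sup>2) + (1 + 1 / c) * (LINT x|M. (e x)\<^sup>2)"
proof -
  have int: "integrable M (\<lambda>x. (y x)\<^sup>2)" "integrable M (\<lambda>x. (e x)\<^sup>2)" "integrable M (\<lambda>x. (y x + e x)\<^sup>2)"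
    using assms square_integrable_add[OF assms(1,2)] by (auto simp: square_integrable_def)
  \<comment> \<open>Young's inequality with parameter \<open>c\<close>: the squares of
    \<open>c * a - b\<close> and \<open>c * a + b\<close> bound the cross term from both
    sides.\<close>
  have pt: "\<bar>(a + b)\<^sup>2 - a\<^sup>2\<bar> \<le> c * a\<^sup>2 + (1 + 1 / c) * b\<^sup>2" for a b :: real
  proof -
    have "c * (a\<^sup>2 * c + b\<^sup>2 / c - 2 * a * b) = (c * a - b)\<^sup>2" "c * (a\<^sup>2 * c + b\<^sup>2 / c + 2 * a * b) = (c * a + b)\<^sup>2"
      using \<open>c > 0\<close> by (auto simp: power2_eq_square field_simps)
    then have "0 \<le> c * (a\<^sup>2 * c + b\<^sup>2 / c - 2 * a * b)" "0 \<le> c * (a\<^sup>2 * c + b\<^sup>2 / c + 2 * a * b)"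
      by (simp_all only: zero_le_power2)
    then have "0 \<le> a\<^sup>2 * c + b\<^sup>2 / c - 2 * a * b" "0 \<le> a\<^sup>2 * c + b\<^sup>2 / c + 2 * a * b"
      using \<open>c > 0\<close> by (meson zero_le_mult_iff not_less)+
    then have "\<bar>2 * a * b\<bar> \<le> a\<^sup>2 * c + b\<^sup>2 / c" by (intro abs_leI) linarith+
    moreover have "(a + b)\<^sup>2 - a\<^sup>2 = 2 * a * b + b\<^sup>2" by (simp add: power2_eq_square algebra_simps)
    ultimately have "\<bar>(a + b)\<^sup>2 - a\<^sup>2\<bar> \<le> a\<^sup>2 * c + b\<^sup>2 / c + b\<^sup>2"
      using abs_triangle_ineq[of "2 * a * b" "b\<^sup>2"] by simp
    then show ?thesis by (simp add: algebra_simps)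
  qed
  have "\<bar>(LINT x|M. (y x + e x)\<^sup>2) - (LINT x|M. (y x)\<^sup>2)\<bar> = \<bar>LINT x|M. (y x + e x)\<^sup>2 - (y x)\<^sup>2\<bar>"
    using int by simp
  also have "\<dots> \<le> (LINT x|M. \<bar>(y x + e x)\<^sup>2 - (y x)\<^sup>2\<bar>)" by (rule integral_abs_bound)
  also have "\<dots> \<le> (LINT x|M. c * (y x)\<^sup>2 + (1 + 1 / c) * (e x)\<^sup>2)"
    using int pt by (intro integral_mono) auto
  also have "\<dots> = c * (LINT x|M. (y x)\<^sup>2) + (1 + 1 / c) * (LINT x|M. (e x)\<^sup>2)" using int by simp
  finally show ?thesis .
qed

text \<open>The functions \<open>y' i\<close> need not converge; it is enough that their norm is
  constant. This fits the main terms of the rescaled increments, which are squeezed towards one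
  point while their norm stays the same.\<close>

lemma integral_square_tendsto:
  fixes y :: "'a \<Rightarrow> real" and e :: "'i \<Rightarrow> 'a \<Rightarrow> real"
  assumes "\<And>i. square_integrable M (y' i)" "\<And>i. square_integrable M (e i)"
    and "\<And>i. (LINT x|M. (y' i x)\<^sup>2) = v" "((\<lambda>i. LINT x|M. (e i x)\<^sup>2) \<longlongrightarrow> 0) F"
  shows "((\<lambda>i. LINT x|M. (y' i x + e i x)\<^sup>2) \<longlongrightarrow> v) F"
proof (rule tendstoI)
  fix \<epsilon> :: real assume "\<epsilon> > 0"
  \<comment> \<open>The 1 keeps the divisor positive; \<open>c\<close> is then chosen so that
    \<open>c * v\<close> takes up at most half of \<open>\<epsilon>\<close>.\<close>
  define A where "A = \<bar>v\<bar> + 1"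
  define c where "c = \<epsilon> / (2 * A)"
  have "A > 0" "v \<le> A" by (auto simp: A_def)
  with \<open>\<epsilon> > 0\<close> have "c > 0" by (auto simp: c_def)
  have "c * v \<le> c * A" using \<open>c > 0\<close> \<open>v \<le> A\<close> by (intro mult_left_mono) auto
  also have "c * A = \<epsilon> / 2" using \<open>A > 0\<close> by (simp add: c_def)
  finally have "c * v \<le> \<epsilon> / 2" .
  have "((\<lambda>i. (1 + 1 / c) * (LINT x|M. (e i x)\<^sup>2)) \<longlongrightarrow> 0) F"
    using tendsto_mult_left[OF assms(4), of "1 + 1 / c"] by simp
  then have "eventually (\<lambda>i. (1 + 1 / c) * (LINT x|M. (e i x)\<^sup>2) < \<epsilon> / 2) F"
    using \<open>\<epsilon> > 0\<close> by (intro order_tendstoD) auto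
  then show "eventually (\<lambda>i. dist (LINT x|M. (y' i x + e i x)\<^sup>2) v < \<epsilon>) F"
  proof eventually_elim
    case (elim i)
    with integral_square_perturb[OF assms(1,2) \<open>c > 0\<close>, of i i] \<open>c * v \<le> \<epsilon> / 2\<close>
    show ?case unfolding assms(3) dist_real_def by linarith
  qed
qed

lemma tendsto_L2_imp_integral_tendsto_0:
  assumes "tendsto_L2 M f g F"
  shows "((\<lambda>i. LINT x|M. (norm (f i x - g x))\<^sup>2) \<longlongrightarrow> 0) F"
proof (rule tendsto_0_le)
  have "((\<lambda>i. enn2real (\<integral>\<^sup>+x. ennreal ((norm (f i x - g x))\<^sup>2) \<partial>M)) \<longlongrightarrow> enn2real 0) F"
    using assms unfolding tendsto_L2_def by (intro tendsto_enn2real) auto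
  then show "((\<lambda>i. enn2real (\<integral>\<^sup>+x. ennreal ((norm (f i x - g x))\<^sup>2) \<partial>M)) \<longlongrightarrow> 0) F" by simp
  \<comment> \<open>Where the square is not integrable the left side is 0 by convention; otherwise
    the two sides agree.\<close>
  have "norm (LINT x|M. (norm (f i x - g x))\<^sup>2)
      \<le> norm (enn2real (\<integral>\<^sup>+x. ennreal ((norm (f i x - g x))\<^sup>2) \<partial>M)) * 1" for i
  proof (cases "integrable M (\<lambda>x. (norm (f i x - g x))\<^sup>2)")
    case True
    then show ?thesis by (subst integral_eq_nn_integral) auto
  qed (simp add: not_integrable_integral_eq)
  then show "eventually (\<lambda>i. norm (LINT x|M. (norm (f i x - g x))\<^sup>2)
      \<le> norm (enn2real (\<integral>\<^sup>+x. ennreal ((norm (f i x - g x))\<^sup>2) \<partial>M)) * 1) F" by simp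
qed

section \<open>Wiener integrals\<close>

lemma step_fun_append: "step_fun (S @ S') u = step_fun S u + step_fun S' u"
  by (simp add: step_fun_def)

lemma step_integral_append: "step_integral W (S @ S') \<omega> = step_integral W S \<omega> + step_integral W S' \<omega>"
  by (simp add: step_integral_def)

lemma step_map_linear:
  assumes "linear T"
  shows "step_fun (map (\<lambda>(a, b, c). (a, b, T c)) S) u = T (step_fun S u)"
    "step_integral W (map (\<lambda>(a, b, c). (a, b, T c)) S) \<omega> = T (step_integral W S \<omega>)"
    "step_valid (map (\<lambda>(a, b, c). (a, b, T c)) S) = step_valid S"
  by (induction S) (auto simp: step_fun_def step_integral_def step_valid_def
      linear_0[OF assms] linear_add[OF assms] linear_scale[OF assms])

text \<open>Since step lists may overlap, concatenating the two approximating lists already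
  represents the sum.\<close>

lemma has_wiener_integral_add:
  fixes g :: "real \<Rightarrow> 'b::{real_normed_vector, second_countable_topology}"
  assumes W: "two_sided_brownian_motion M W"
    and "has_wiener_integral M W g X" "has_wiener_integral M W g' X'"
  shows "has_wiener_integral M W (\<lambda>u. g u + g' u) (\<lambda>\<omega>. X \<omega> + X' \<omega>)"
proof -
  obtain S S' where S: "\<And>n. step_valid (S n)" "tendsto_L2 lborel (\<lambda>n. step_fun (S n)) g sequentially"
      "tendsto_L2 M (\<lambda>n. step_integral W (S n)) X sequentially"
    and S': "\<And>n. step_valid (S' n)" "tendsto_L2 lborel (\<lambda>n. step_fun (S' n)) g' sequentially"
      "tendsto_L2 M (\<lambda>n. step_integral W (S' n)) X' sequentially"
    using assms(2,3) unfolding has_wiener_integral_def by blast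
  note [measurable] = step_integral_measurable[OF W]
  have [measurable]: "g \<in> borel_measurable borel" "g' \<in> borel_measurable borel"
    "X \<in> borel_measurable M" "X' \<in> borel_measurable M"
    using assms(2,3) by (auto simp: has_wiener_integral_def square_integrable_def)
  have "step_valid (S n @ S' n)" for n
    using S(1)[of n] S'(1)[of n] by (auto simp: step_valid_def)
  moreover have "tendsto_L2 lborel (\<lambda>n. step_fun (S n @ S' n)) (\<lambda>u. g u + g' u) sequentially"
    using tendsto_L2_add[OF S(2) S'(2)] by (simp add: step_fun_append[abs_def])
  moreover have "tendsto_L2 M (\<lambda>n. step_integral W (S n @ S' n)) (\<lambda>\<omega>. X \<omega> + X' \<omega>) sequentially"
    using tendsto_L2_add[OF S(3) S'(3)] by (simp add: step_integral_append[abs_def])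
  ultimately show ?thesis
    using assms(2,3) square_integrable_add unfolding has_wiener_integral_def
    by (intro conjI exI[of _ "\<lambda>n. S n @ S' n"]) auto
qed

lemma has_wiener_integral_bounded_linear:
  fixes g :: "real \<Rightarrow> 'b::{real_normed_vector, second_countable_topology}"
    and T :: "'b \<Rightarrow> 'c::{real_normed_vector, second_countable_topology}"
  assumes W: "two_sided_brownian_motion M W"
    and "has_wiener_integral M W g X" and T: "bounded_linear T"
  shows "has_wiener_integral M W (\<lambda>u. T (g u)) (\<lambda>\<omega>. T (X \<omega>))"
proof -
  let ?T = "map (\<lambda>(a :: real, b :: real, c). (a, b, T c))"
  obtain S where S: "\<And>n. step_valid (S n)" "tendsto_L2 lborel (\<lambda>n. step_fun (S n)) g sequentially"
      "tendsto_L2 M (\<lambda>n. step_integral W (S n)) X sequentially"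
    using assms(2) unfolding has_wiener_integral_def by blast
  note [measurable] = step_integral_measurable[OF W]
  have [measurable]: "g \<in> borel_measurable borel" "X \<in> borel_measurable M"
    using assms(2) by (auto simp: has_wiener_integral_def square_integrable_def)
  note lin = step_map_linear[OF bounded_linear.linear[OF T]]
  have "T \<in> borel_measurable borel"
    by (rule borel_measurable_continuous_onI[OF linear_continuous_on[OF T]])
  then have "(\<lambda>\<omega>. T (X \<omega>)) \<in> borel_measurable M" by (rule measurable_compose[rotated]) measurable
  moreover have "tendsto_L2 lborel (\<lambda>n. step_fun (?T (S n))) (\<lambda>u. T (g u)) sequentially"
    using tendsto_L2_bounded_linear[OF S(2) T] by (simp add: lin[abs_def])
  moreover have "tendsto_L2 M (\<lambda>n. step_integral W (?T (S n))) (\<lambda>\<omega>. T (X \<omega>)) sequentially"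
    using tendsto_L2_bounded_linear[OF S(3) T] by (simp add: lin[abs_def])
  moreover have "square_integrable lborel (\<lambda>u. T (g u))"
    using assms(2) square_integrable_bounded_linear[OF _ T] by (auto simp: has_wiener_integral_def)
  ultimately show ?thesis
    using S(1) unfolding has_wiener_integral_def
    by (intro conjI exI[of _ "\<lambda>n. ?T (S n)"]) (auto simp: lin)
qed

lemma has_wiener_integral_AE_cong:
  fixes g :: "real \<Rightarrow> 'b::{real_normed_vector, second_countable_topology}"
  assumes "has_wiener_integral M W g X" "AE u in lborel. g u = g' u" "AE \<omega> in M. X \<omega> = X' \<omega>"
    "g' \<in> borel_measurable borel" "X' \<in> borel_measurable M"
  shows "has_wiener_integral M W g' X'"
  using assms square_integrable_AE_cong[OF assms(2)]
    tendsto_L2_AE_cong[OF assms(2)] tendsto_L2_AE_cong[OF assms(3)]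
  unfolding has_wiener_integral_def by (auto, blast)

lemma has_wiener_integral_zero:
  assumes "two_sided_brownian_motion M W"
  shows "has_wiener_integral M W (\<lambda>_. 0) (\<lambda>_. 0)"
  unfolding has_wiener_integral_def
  by (auto intro!: exI[of _ "\<lambda>_. []"] simp: square_integrable_def step_valid_def tendsto_L2_def
      step_fun_def step_integral_def)

lemma has_wiener_integral_sum:
  fixes g :: "'i \<Rightarrow> real \<Rightarrow> real"
  assumes W: "two_sided_brownian_motion M W"
    and "finite I" "\<And>i. i \<in> I \<Longrightarrow> has_wiener_integral M W (g i) (X i)"
  shows "has_wiener_integral M W (\<lambda>u. \<Sum>i\<in>I. \<theta> i * g i u) (\<lambda>\<omega>. \<Sum>i\<in>I. \<theta> i * X i \<omega>)"
  using assms(2,3)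
proof (induction I rule: finite_induct)
  case empty
  then show ?case using has_wiener_integral_zero[OF W] by simp
next
  case (insert i I)
  have "has_wiener_integral M W (\<lambda>u. \<theta> i * g i u) (\<lambda>\<omega>. \<theta> i * X i \<omega>)"
    by (rule has_wiener_integral_bounded_linear[OF W insert.prems bounded_linear_mult_right]) simp
  from has_wiener_integral_add[OF W this insert.IH[OF insert.prems]] show ?case
    by (simp add: insert.hyps)
qed

section \<open>Gaussian laws of Wiener integrals\<close>

lemma norm_iexp_diff_le: "norm (iexp x - iexp y) \<le> \<bar>x - y\<bar>"
proof -
  have "iexp x - iexp y = iexp y * (iexp (x - y) - 1)"
    by (simp add: exp_add[symmetric] algebra_simps)
  then have "norm (iexp x - iexp y) = norm (iexp (x - y) - 1)" by (simp add: norm_mult)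
  also have "\<dots> \<le> \<bar>x - y\<bar>" using iexp_approx1[of "x - y" 0] by simp
  finally show ?thesis .
qed

text \<open>The exponential is 1-Lipschitz, and \<open>d \<le> c + d\<^sup>2 / c\<close> for
  \<open>d \<ge> 0\<close> passes from the mean square to the mean.\<close>

lemma (in prob_space) tendsto_L2_imp_iexp_tendsto:
  fixes X :: "'a \<Rightarrow> real"
  assumes conv: "tendsto_L2 M Y X F"
    and [measurable]: "\<And>n. Y n \<in> borel_measurable M" "X \<in> borel_measurable M"
  shows "((\<lambda>n. CLINT \<omega>|M. iexp (Y n \<omega>)) \<longlongrightarrow> (CLINT \<omega>|M. iexp (X \<omega>))) F"
proof (rule tendstoI)
  fix e :: real assume "e > 0"
  \<comment> \<open>The constant term contributes \<open>e / 2\<close>; the threshold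
    \<open>c * e / 2\<close> below leaves less than \<open>e / 2\<close> after division by
    \<open>c\<close>.\<close>
  define c where "c = e / 2"
  have "c > 0" using \<open>e > 0\<close> by (simp add: c_def)
  have "eventually (\<lambda>n. (\<integral>\<^sup>+\<omega>. ennreal ((norm (Y n \<omega> - X \<omega>))\<^sup>2) \<partial>M) < ennreal (c * e / 2)) F"
    using conv \<open>c > 0\<close> \<open>e > 0\<close> unfolding tendsto_L2_def by (intro order_tendstoD) (auto simp: ennreal_zero_less_mult_iff)
  then show "eventually (\<lambda>n. dist (CLINT \<omega>|M. iexp (Y n \<omega>)) (CLINT \<omega>|M. iexp (X \<omega>)) < e) F"
  proof eventually_elim
    case (elim n)
    have int: "integrable M (\<lambda>\<omega>. (Y n \<omega> - X \<omega>)\<^sup>2)"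
    proof (rule integrableI_bounded)
      show "(\<integral>\<^sup>+\<omega>. ennreal (norm ((Y n \<omega> - X \<omega>)\<^sup>2)) \<partial>M) < \<infinity>"
        using order.strict_trans[OF elim ennreal_less_top] by simp
    qed simp
    have small: "(LINT \<omega>|M. (Y n \<omega> - X \<omega>)\<^sup>2) < c * e / 2"
      using elim int \<open>c > 0\<close> \<open>e > 0\<close> by (simp add: nn_integral_eq_integral ennreal_less_iff)
    have i1: "integrable M (\<lambda>\<omega>. iexp (Y n \<omega>))" "integrable M (\<lambda>\<omega>. iexp (X \<omega>))"
      by (auto intro!: integrable_const_bound[where B=1])
    have "dist (CLINT \<omega>|M. iexp (Y n \<omega>)) (CLINT \<omega>|M. iexp (X \<omega>))
        = norm (CLINT \<omega>|M. iexp (Y n \<omega>) - iexp (X \<omega>))"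
      unfolding dist_norm using i1 by simp
    also have "\<dots> \<le> (LINT \<omega>|M. norm (iexp (Y n \<omega>) - iexp (X \<omega>)))" by (rule integral_norm_bound)
    also have "\<dots> \<le> (LINT \<omega>|M. c + (Y n \<omega> - X \<omega>)\<^sup>2 / c)"
    proof (intro integral_mono)
      fix \<omega>
      let ?d = "\<bar>Y n \<omega> - X \<omega>\<bar>"
      have "?d \<le> c + ?d\<^sup>2 / c"
      proof (cases "?d \<le> c")
        case False
        then have "c * ?d \<le> ?d * ?d" using \<open>c > 0\<close> by (intro mult_right_mono) auto
        then have "?d \<le> ?d\<^sup>2 / c" using \<open>c > 0\<close> by (simp add: pos_le_divide_eq power2_eq_square mult.commute)
        then show ?thesis using \<open>c > 0\<close> by linarith
      qed (use \<open>c > 0\<close> in \<open>simp add: add_increasing2\<close>)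
      then show "norm (iexp (Y n \<omega>) - iexp (X \<omega>)) \<le> c + (Y n \<omega> - X \<omega>)\<^sup>2 / c"
        using norm_iexp_diff_le[of "Y n \<omega>" "X \<omega>"] by simp
    qed (use i1 int in auto)
    also have "\<dots> = c + (LINT \<omega>|M. (Y n \<omega> - X \<omega>)\<^sup>2) / c"
      using int by (simp add: prob_space)
    also have "\<dots> < c + e / 2" using small \<open>c > 0\<close> by (simp add: pos_divide_less_eq mult_ac)
    finally show ?case by (simp add: c_def)
  qed
qed

text \<open>Passes to the limit in the step approximants, once on the line for the variance and once
  on \<open>M\<close> for the characteristic function. Applied to linear combinations of kernels it
  carries all joint laws of the processes.\<close>

theorem wiener_integral_iexp:
  fixes g :: "real \<Rightarrow> real"
  assumes W: "two_sided_brownian_motion M W" and g: "has_wiener_integral M W g X"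
  shows "(CLINT \<omega>|M. iexp (X \<omega>)) = of_real (exp (- (LINT u|lborel. (g u)\<^sup>2) / 2))"
proof -
  interpret prob_space M by (rule two_sided_brownian_motionD(1)[OF W])
  obtain S where S: "\<And>n. step_valid (S n)" "tendsto_L2 lborel (\<lambda>n. step_fun (S n)) g sequentially"
      "tendsto_L2 M (\<lambda>n. step_integral W (S n)) X sequentially"
    using g unfolding has_wiener_integral_def by blast
  have [measurable]: "X \<in> borel_measurable M" and sq: "square_integrable lborel g"
    using g by (auto simp: has_wiener_integral_def)
  have sqS: "square_integrable lborel (step_fun (S n))" for n
    using step_integral_iexp(2)[OF W S(1)] by (simp add: square_integrable_def)
  have "(\<lambda>n. LINT u|lborel. (g u + (step_fun (S n) u - g u))\<^sup>2) \<longlonglongrightarrow> (LINT u|lborel. (g u)\<^sup>2)"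
    using tendsto_L2_imp_integral_tendsto_0[OF S(2)] sq square_integrable_diff[OF sqS sq]
    by (intro integral_square_tendsto[where y'="\<lambda>_. g"]) auto
  then have "(\<lambda>n. LINT u|lborel. (step_fun (S n) u)\<^sup>2) \<longlonglongrightarrow> (LINT u|lborel. (g u)\<^sup>2)" by simp
  then have "(\<lambda>n. complex_of_real (exp (- (LINT u|lborel. (step_fun (S n) u)\<^sup>2) / 2)))
      \<longlonglongrightarrow> of_real (exp (- (LINT u|lborel. (g u)\<^sup>2) / 2))"
    by (intro tendsto_intros) auto
  moreover have "(\<lambda>n. CLINT \<omega>|M. iexp (step_integral W (S n) \<omega>)) \<longlonglongrightarrow> (CLINT \<omega>|M. iexp (X \<omega>))"
    by (intro tendsto_L2_imp_iexp_tendsto[OF S(3)] step_integral_measurable[OF W]) auto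
  ultimately show ?thesis
    using step_integral_iexp(1)[OF W S(1)] LIMSEQ_unique by simp
qed

lemma wiener_integral_char:
  fixes g :: "real \<Rightarrow> real"
  assumes W: "two_sided_brownian_motion M W" and g: "has_wiener_integral M W g X"
  shows "char (distr M borel X) t = of_real (exp (- (t\<^sup>2 * (LINT u|lborel. (g u)\<^sup>2)) / 2))"
proof -
  have [measurable]: "X \<in> borel_measurable M" using g by (auto simp: has_wiener_integral_def)
  have "has_wiener_integral M W (\<lambda>u. t * g u) (\<lambda>\<omega>. t * X \<omega>)"
    by (intro has_wiener_integral_bounded_linear[OF W g] bounded_linear_mult_right)
  from wiener_integral_iexp[OF W this] show ?thesis
    by (simp add: char_def integral_distr power_mult_distrib)
qed

lemma wiener_integral_zero_AE:
  fixes g :: "real \<Rightarrow> real"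
  assumes W: "two_sided_brownian_motion M W" and g: "has_wiener_integral M W g X"
    and "(LINT u|lborel. (g u)\<^sup>2) = 0"
  shows "AE \<omega> in M. X \<omega> = 0"
proof -
  interpret prob_space M by (rule two_sided_brownian_motionD(1)[OF W])
  have [measurable]: "X \<in> borel_measurable M" using g by (auto simp: has_wiener_integral_def)
  have "char (distr M borel X) = char (return borel 0)"
    by (intro ext) (simp add: wiener_integral_char[OF W g] assms(3), simp add: char_def integral_return)
  then have "distr M borel X = return borel 0"
    by (intro Levy_uniqueness real_distribution_distr)
      (auto simp: real_distribution_def real_distribution_axioms_def intro!: prob_space_return)
  then have "AE x in distr M borel X. x = 0" by (simp only:) (simp add: AE_return)
  then show ?thesis by (simp add: AE_distr_iff)
qed

lemma wiener_integral_distributed: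
  fixes g :: "real \<Rightarrow> real"
  assumes W: "two_sided_brownian_motion M W" and g: "has_wiener_integral M W g X"
    and pos: "(LINT u|lborel. (g u)\<^sup>2) > 0"
  shows "distr M borel X = density lborel (normal_density 0 (sqrt (LINT u|lborel. (g u)\<^sup>2)))"
proof -
  define \<sigma> where "\<sigma> = sqrt (LINT u|lborel. (g u)\<^sup>2)"
  have "\<sigma> > 0" using pos by (simp add: \<sigma>_def)
  interpret prob_space M by (rule two_sided_brownian_motionD(1)[OF W])
  have [measurable]: "X \<in> borel_measurable M" using g by (auto simp: has_wiener_integral_def)
  let ?N = "density lborel (normal_density 0 \<sigma>)"
  interpret N: prob_space ?N by (rule prob_space_normal_density[OF \<open>\<sigma> > 0\<close>])
  have "distributed ?N lborel (\<lambda>x. x) (normal_density 0 \<sigma>)"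
    unfolding distributed_def by (auto simp: distr_id2)
  from N.normal_iexp[OF this \<open>\<sigma> > 0\<close>]
  have "char ?N t = of_real (exp (- (\<sigma> * t)\<^sup>2 / 2))" for t by (simp add: char_def)
  moreover have "\<sigma>\<^sup>2 = (LINT u|lborel. (g u)\<^sup>2)" using pos by (simp add: \<sigma>_def)
  ultimately have "char (distr M borel X) = char ?N"
    by (intro ext) (simp add: wiener_integral_char[OF W g] power_mult_distrib mult.commute)
  then show ?thesis unfolding \<sigma>_def[symmetric]
    by (intro Levy_uniqueness real_distribution_distr)
      (auto simp: real_distribution_def real_distribution_axioms_def N.prob_space_axioms)
qed

text \<open>A lower bound for the standard deviation dominates the law by a multiple of Lebesgue
  measure. This is what makes composing the process with a function known only in L1
  harmless.\<close>

lemma wiener_integral_nn_integral_le: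
  fixes g :: "real \<Rightarrow> real"
  assumes W: "two_sided_brownian_motion M W" and g: "has_wiener_integral M W g X"
    and pos: "(LINT u|lborel. (g u)\<^sup>2) \<ge> s\<^sup>2" "s > 0" and [measurable]: "h \<in> borel_measurable borel"
  shows "(\<integral>\<^sup>+\<omega>. h (X \<omega>) \<partial>M) \<le> ennreal (1 / s) * (\<integral>\<^sup>+x. h x \<partial>lborel)"
proof -
  define \<sigma> where "\<sigma> = sqrt (LINT u|lborel. (g u)\<^sup>2)"
  have "s \<le> \<sigma>" unfolding \<sigma>_def using pos by (intro real_le_rsqrt) auto
  have gt: "(LINT u|lborel. (g u)\<^sup>2) > 0" using pos by (meson less_le_trans zero_less_power)
  have [measurable]: "X \<in> borel_measurable M" using g by (auto simp: has_wiener_integral_def)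
  have dens: "normal_density 0 \<sigma> x \<le> 1 / s" for x
  proof -
    have "1 \<le> sqrt (2 * pi)" using pi_gt3 by (intro real_le_rsqrt) auto
    then have "1 * s \<le> sqrt (2 * pi) * \<sigma>" using \<open>s \<le> \<sigma>\<close> \<open>s > 0\<close> by (intro mult_mono) auto
    then have "s \<le> sqrt (2 * pi * \<sigma>\<^sup>2)" using \<open>s > 0\<close> \<open>s \<le> \<sigma>\<close> by (simp add: real_sqrt_mult)
    then have "1 / sqrt (2 * pi * \<sigma>\<^sup>2) * exp (- (x - 0)\<^sup>2 / (2 * \<sigma>\<^sup>2)) \<le> 1 / s * 1"
      using \<open>s > 0\<close> by (intro mult_mono divide_left_mono) (auto intro!: mult_pos_pos)
    then show ?thesis by (simp add: normal_density_def)
  qed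
  have "(\<integral>\<^sup>+\<omega>. h (X \<omega>) \<partial>M) = (\<integral>\<^sup>+x. h x \<partial>distr M borel X)" by (simp add: nn_integral_distr)
  also have "\<dots> = (\<integral>\<^sup>+x. ennreal (normal_density 0 \<sigma> x) * h x \<partial>lborel)"
    unfolding wiener_integral_distributed[OF W g gt, folded \<sigma>_def] by (subst nn_integral_density) auto
  also have "\<dots> \<le> (\<integral>\<^sup>+x. ennreal (1 / s) * h x \<partial>lborel)"
    using dens by (intro nn_integral_mono mult_right_mono ennreal_leI) auto
  finally show ?thesis by (simp add: nn_integral_cmult)
qed

section \<open>Gaussian smoothing\<close>

text \<open>The weight is, up to a constant, the density of the normal law with standard deviation
  \<open>1 / \<sigma>\<close>, so its transform is the known characteristic function of that
  law.\<close>

lemma gaussian_fourier: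
  assumes "\<sigma> > 0"
  shows "(CLINT \<theta>|lborel. iexp (\<theta> * z) * of_real (exp (- (\<sigma> * \<theta>)\<^sup>2 / 2)))
      = of_real (2 * pi * normal_density 0 \<sigma> z)"
    and "integrable lborel (\<lambda>\<theta>. exp (- (\<sigma> * \<theta>)\<^sup>2 / 2))"
proof -
  have s: "1 / \<sigma> > 0" using assms by simp
  let ?N = "density lborel (normal_density 0 (1 / \<sigma>))"
  interpret N: prob_space ?N by (rule prob_space_normal_density[OF s])
  have dens: "normal_density 0 (1 / \<sigma>) \<theta> = \<sigma> / sqrt (2 * pi) * exp (- (\<sigma> * \<theta>)\<^sup>2 / 2)" for \<theta>
    using assms by (simp add: normal_density_def power_mult_distrib power_divide real_sqrt_divide real_sqrt_mult field_simps)
  have "integrable lborel (\<lambda>\<theta>. sqrt (2 * pi) / \<sigma> * normal_density 0 (1 / \<sigma>) \<theta>)"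
    using integrable_normal_density[OF s] by (intro integrable_mult_right) auto
  then show "integrable lborel (\<lambda>\<theta>. exp (- (\<sigma> * \<theta>)\<^sup>2 / 2))"
    using assms by (simp add: dens)
  have "distributed ?N lborel (\<lambda>x. x) (normal_density 0 (1 / \<sigma>))"
    unfolding distributed_def by (auto simp: distr_id2)
  from N.normal_iexp[OF this s, of z]
  have "(CLINT \<theta>|?N. iexp (z * \<theta>)) = of_real (exp (- (z / \<sigma>)\<^sup>2 / 2))" by simp
  also have "(CLINT \<theta>|?N. iexp (z * \<theta>)) = (CLINT \<theta>|lborel. normal_density 0 (1 / \<sigma>) \<theta> *\<^sub>R iexp (z * \<theta>))"
    by (subst integral_density) auto
  also have "\<dots> = (CLINT \<theta>|lborel. of_real (\<sigma> / sqrt (2 * pi)) * (iexp (\<theta> * z) * of_real (exp (- (\<sigma> * \<theta>)\<^sup>2 / 2))))"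
    by (intro Bochner_Integration.integral_cong refl) (simp add: dens scaleR_conv_of_real mult_ac)
  also have "\<dots> = of_real (\<sigma> / sqrt (2 * pi)) * (CLINT \<theta>|lborel. iexp (\<theta> * z) * of_real (exp (- (\<sigma> * \<theta>)\<^sup>2 / 2)))"
    by (rule integral_mult_right_zero)
  finally have "(CLINT \<theta>|lborel. iexp (\<theta> * z) * of_real (exp (- (\<sigma> * \<theta>)\<^sup>2 / 2)))
      = of_real (sqrt (2 * pi) / \<sigma> * exp (- (z / \<sigma>)\<^sup>2 / 2))"
    using assms by (simp add: field_simps)
  also have "sqrt (2 * pi) / \<sigma> * exp (- (z / \<sigma>)\<^sup>2 / 2) = 2 * pi * normal_density 0 \<sigma> z"
    using assms by (simp add: normal_density_def real_sqrt_mult power_divide field_simps)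
  finally show "(CLINT \<theta>|lborel. iexp (\<theta> * z) * of_real (exp (- (\<sigma> * \<theta>)\<^sup>2 / 2)))
      = of_real (2 * pi * normal_density 0 \<sigma> z)" .
qed

text \<open>Inverse Fourier transforms, up to normalisation, of integrable functions. For such
  \<open>u\<close> the value \<open>u (Y s)\<close> is a mixture of exponentials of
  \<open>Y s\<close>, whose expectations are characteristic functions. The density \<open>m\<close>
  is complex although \<open>u\<close> is real.\<close>

definition fourier_mixture :: "(real \<Rightarrow> complex) \<Rightarrow> (real \<Rightarrow> real) \<Rightarrow> bool" where
  "fourier_mixture m u \<longleftrightarrow> integrable lborel m \<and>
     (\<forall>x. complex_of_real (u x) = (CLINT \<theta>|lborel. m \<theta> * iexp (\<theta> * x)))"

text \<open>The transform of \<open>\<phi>\<close> is bounded but may fail to be integrable;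
  convolution with a normal density multiplies it by the Gaussian weight \<open>w\<close>, which
  makes it so.\<close>

lemma fourier_mixture_gaussian_smoothing:
  assumes "integrable lborel \<phi>" "\<sigma> > 0"
  shows "\<exists>m. fourier_mixture m (\<lambda>x. LINT y|lborel. \<phi> y * normal_density 0 \<sigma> (x - y))"
proof -
  define w where "w \<theta> = complex_of_real (exp (- (\<sigma> * \<theta>)\<^sup>2 / 2) / (2 * pi))" for \<theta>
  have [measurable]: "\<phi> \<in> borel_measurable borel" using assms by auto
  have [measurable]: "w \<in> borel_measurable borel" unfolding w_def by measurable
  have w: "integrable lborel w" unfolding w_def
    using gaussian_fourier(2)[OF assms(2)] by (intro integrable_of_real integrable_divide) auto
  define m where "m \<theta> = (CLINT y|lborel. of_real (\<phi> y) * iexp (- (\<theta> * y))) * w \<theta>" for \<theta>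
  have [measurable]: "m \<in> borel_measurable borel" unfolding m_def by measurable
  have bound: "norm (m \<theta>) \<le> (LINT y|lborel. \<bar>\<phi> y\<bar>) * norm (w \<theta>)" for \<theta>
  proof -
    have "norm (CLINT y|lborel. of_real (\<phi> y) * iexp (- (\<theta> * y)))
        \<le> (LINT y|lborel. norm (of_real (\<phi> y) * iexp (- (\<theta> * y))))" by (rule integral_norm_bound)
    then show ?thesis unfolding m_def norm_mult by (intro mult_right_mono) (auto simp: norm_mult)
  qed
  have "integrable lborel m"
    using bound
    by (intro Bochner_Integration.integrable_bound[OF integrable_mult_right[OF integrable_norm[OF w],
          of "LINT y|lborel. \<bar>\<phi> y\<bar>"]]) (auto intro: order_trans[OF _ abs_ge_self])
  moreover have "complex_of_real (LINT y|lborel. \<phi> y * normal_density 0 \<sigma> (x - y))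
      = (CLINT \<theta>|lborel. m \<theta> * iexp (\<theta> * x))" for x
  proof -
    let ?h = "\<lambda>\<theta> y. (w \<theta> * iexp (\<theta> * x)) * (of_real (\<phi> y) * iexp (- (\<theta> * y)))"
    have "integrable (lborel \<Otimes>\<^sub>M lborel) (\<lambda>(\<theta>, y). w \<theta> * complex_of_real (\<phi> y))"
      by (intro lborel_pair.Fubini_integrable)
         (auto simp: norm_mult w assms intro!: integrable_mult_left integrable_mult_right integrable_norm)
    then have int: "integrable (lborel \<Otimes>\<^sub>M lborel) (\<lambda>(\<theta>, y). ?h \<theta> y)"
      by (rule Bochner_Integration.integrable_bound) (auto simp: norm_mult)
    have "(CLINT \<theta>|lborel. m \<theta> * iexp (\<theta> * x)) = (CLINT \<theta>|lborel. CLINT y|lborel. ?h \<theta> y)"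
      unfolding m_def integral_mult_right_zero
      by (intro Bochner_Integration.integral_cong refl) (simp only: mult_ac)
    also have "\<dots> = (CLINT y|lborel. CLINT \<theta>|lborel. ?h \<theta> y)"
      by (rule lborel_pair.Fubini_integral[OF int, symmetric])
    also have "\<dots> = (CLINT y|lborel. of_real (\<phi> y * normal_density 0 \<sigma> (x - y)))"
    proof (intro Bochner_Integration.integral_cong refl)
      fix y
      have "(CLINT \<theta>|lborel. ?h \<theta> y)
          = (CLINT \<theta>|lborel. of_real (\<phi> y / (2 * pi)) * (iexp (\<theta> * (x - y)) * of_real (exp (- (\<sigma> * \<theta>)\<^sup>2 / 2))))"
        by (intro Bochner_Integration.integral_cong refl)
           (simp add: w_def field_simps exp_diff exp_minus)
      also have "\<dots> = of_real (\<phi> y * normal_density 0 \<sigma> (x - y))"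
        unfolding integral_mult_right_zero gaussian_fourier(1)[OF assms(2)] by simp
      finally show "(CLINT \<theta>|lborel. ?h \<theta> y) = of_real (\<phi> y * normal_density 0 \<sigma> (x - y))" .
    qed
    finally show ?thesis by (simp only: integral_complex_of_real)
  qed
  ultimately show ?thesis unfolding fourier_mixture_def by blast
qed

text \<open>Convolution with a narrow normal density. Uniform continuity handles shifts below
  \<open>d\<close>; larger shifts are handled as in Chebyshev's inequality, by comparing with
  \<open>z\<^sup>2 / d\<^sup>2\<close> and the second moment.\<close>

lemma uniform_fourier_mixture_approx:
  fixes \<phi> :: "real \<Rightarrow> real"
  assumes cont: "continuous_on UNIV \<phi>" and supp: "\<And>x. \<bar>x\<bar> > R \<Longrightarrow> \<phi> x = 0" and "e > 0"
  shows "\<exists>m u. fourier_mixture m u \<and> (\<forall>x. \<bar>\<phi> x - u x\<bar> \<le> e)"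
proof -
  define R' where "R' = \<bar>R\<bar>"
  have supp': "\<phi> x = 0" if "\<bar>x\<bar> > R'" for x using supp[of x] that by (auto simp: R'_def)
  have "R' \<ge> 0" by (simp add: R'_def)
  have "bounded (\<phi> ` {-R'..R'})"
    by (intro compact_imp_bounded compact_continuous_image continuous_on_subset[OF cont]) auto
  then obtain B0 where "\<forall>y\<in>\<phi> ` {-R'..R'}. norm y \<le> B0" unfolding bounded_iff by blast
  then have B0: "\<bar>\<phi> x\<bar> \<le> B0" if "\<bar>x\<bar> \<le> R'" for x using that by (auto simp: abs_le_iff)
  define B where "B = max B0 1"
  have "B > 0" by (simp add: B_def)
  have B: "\<bar>\<phi> x\<bar> \<le> B" for x
    using B0[of x] supp'[of x] by (cases "\<bar>x\<bar> \<le> R'") (auto simp: B_def le_max_iff_disj)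
  have [measurable]: "\<phi> \<in> borel_measurable borel" by (rule borel_measurable_continuous_onI[OF cont])
  have int: "integrable lborel \<phi>"
  proof (rule Bochner_Integration.integrable_bound)
    show "integrable lborel (\<lambda>x. B * indicator {-R'..R'} x)" by (intro integrable_mult_right integrable_real_indicator) (simp_all add: emeasure_lborel_Icc_eq)
    show "AE x in lborel. norm (\<phi> x) \<le> norm (B * indicator {-R'..R'} x)"
      using B supp' \<open>B > 0\<close> by (intro AE_I2) (force simp: indicator_def)
  qed simp
  \<comment> \<open>The margin 1 ensures that two points closer than \<open>d \<le> 1\<close> either
    both lie in the widened interval or both lie where \<open>\<phi>\<close> vanishes.\<close>
  have "uniformly_continuous_on {-R'-1..R'+1} \<phi>"
    by (intro compact_uniformly_continuous continuous_on_subset[OF cont]) auto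
  then obtain d0 where d0: "d0 > 0"
    "\<And>x y. x \<in> {-R'-1..R'+1} \<Longrightarrow> y \<in> {-R'-1..R'+1} \<Longrightarrow> dist y x < d0 \<Longrightarrow> dist (\<phi> y) (\<phi> x) < e / 2"
    using \<open>e > 0\<close> unfolding uniformly_continuous_on_def by (metis half_gt_zero)
  define d where "d = min d0 1"
  have "d > 0" using d0 by (simp add: d_def)
  have near: "\<bar>\<phi> x - \<phi> y\<bar> \<le> e / 2" if "\<bar>x - y\<bar> < d" for x y
  proof (cases "\<bar>x\<bar> \<le> R' + 1 \<and> \<bar>y\<bar> \<le> R' + 1")
    case True
    then show ?thesis using d0(2)[of y x] that by (auto simp: dist_real_def d_def abs_le_iff)
  next
    case False
    then have "\<bar>x\<bar> > R'" "\<bar>y\<bar> > R'" using that by (auto simp: d_def)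
    then show ?thesis using supp'[of x] supp'[of y] \<open>e > 0\<close> by simp
  qed
  \<comment> \<open>Makes the contribution \<open>2 * B / d\<^sup>2 * \<sigma>\<^sup>2\<close> of
    the large shifts equal to \<open>e / 2\<close>.\<close>
  define \<sigma> where "\<sigma> = sqrt (e * d\<^sup>2 / (4 * B))"
  have "\<sigma> > 0" using \<open>e > 0\<close> \<open>d > 0\<close> \<open>B > 0\<close> by (simp add: \<sigma>_def)
  have \<sigma>2: "\<sigma>\<^sup>2 = e * d\<^sup>2 / (4 * B)" using \<open>e > 0\<close> \<open>d > 0\<close> \<open>B > 0\<close> by (simp add: \<sigma>_def)
  let ?u = "\<lambda>x. LINT y|lborel. \<phi> y * normal_density 0 \<sigma> (x - y)"
  have "\<bar>\<phi> x - ?u x\<bar> \<le> e" for x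
  proof -
    let ?n = "normal_density 0 \<sigma>"
    have n2: "integrable lborel (\<lambda>z. ?n z * z\<^sup>2)" "(LINT z|lborel. ?n z * z\<^sup>2) = \<sigma>\<^sup>2"
      using integrable_normal_moment[OF \<open>\<sigma> > 0\<close>, of 0 2] integral_normal_moment_even[OF \<open>\<sigma> > 0\<close>, of 0 1]
      by (simp_all add: eval_nat_numeral)
    have n1: "integrable lborel ?n" "(LINT z|lborel. ?n z) = 1" using \<open>\<sigma> > 0\<close> by auto
    have i3: "integrable lborel (\<lambda>z. \<phi> (x - z) * ?n z)"
      using B by (intro Bochner_Integration.integrable_bound[OF integrable_mult_right[OF n1(1), of B]])
         (auto simp: abs_mult intro!: mult_right_mono order_trans[OF B])
    have "?u x = (LINT z|lborel. \<phi> (x - z) * ?n z)"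
      using lborel_integral_real_affine[of "-1" "\<lambda>y. \<phi> y * ?n (x - y)" x] by simp
    then have "\<phi> x - ?u x = (LINT z|lborel. (\<phi> x - \<phi> (x - z)) * ?n z)"
      using n1 i3 by (simp add: left_diff_distrib)
    also have "\<bar>\<dots>\<bar> \<le> (LINT z|lborel. \<bar>(\<phi> x - \<phi> (x - z)) * ?n z\<bar>)" by (rule integral_abs_bound)
    also have "\<dots> \<le> (LINT z|lborel. e / 2 * ?n z + 2 * B / d\<^sup>2 * (?n z * z\<^sup>2))"
    proof (intro integral_mono)
      fix z
      have "\<bar>\<phi> x - \<phi> (x - z)\<bar> \<le> e / 2 + 2 * B / d\<^sup>2 * z\<^sup>2"
      proof (cases "\<bar>z\<bar> < d")
        case True
        then have "\<bar>\<phi> x - \<phi> (x - z)\<bar> \<le> e / 2" by (intro near) auto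
        moreover have "0 \<le> 2 * B / d\<^sup>2 * z\<^sup>2" using \<open>B > 0\<close> by simp
        ultimately show ?thesis by linarith
      next
        case False
        then have "d\<^sup>2 \<le> z\<^sup>2" using \<open>d > 0\<close> by (metis abs_le_square_iff abs_of_pos not_less)
        then have "2 * B \<le> 2 * B / d\<^sup>2 * z\<^sup>2" using \<open>B > 0\<close> \<open>d > 0\<close> by (simp add: pos_le_divide_eq)
        moreover have "\<bar>\<phi> x - \<phi> (x - z)\<bar> \<le> 2 * B" using B[of x] B[of "x - z"] by linarith
        ultimately show ?thesis using \<open>e > 0\<close> by linarith
      qed
      then have "\<bar>\<phi> x - \<phi> (x - z)\<bar> * ?n z \<le> (e / 2 + 2 * B / d\<^sup>2 * z\<^sup>2) * ?n z"
        by (intro mult_right_mono) auto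
      moreover have "\<bar>(\<phi> x - \<phi> (x - z)) * ?n z\<bar> = \<bar>\<phi> x - \<phi> (x - z)\<bar> * ?n z" by (simp add: abs_mult)
      moreover have "(e / 2 + 2 * B / d\<^sup>2 * z\<^sup>2) * ?n z = e / 2 * ?n z + 2 * B / d\<^sup>2 * (?n z * z\<^sup>2)"
        by (simp add: algebra_simps)
      ultimately show "\<bar>(\<phi> x - \<phi> (x - z)) * ?n z\<bar> \<le> e / 2 * ?n z + 2 * B / d\<^sup>2 * (?n z * z\<^sup>2)"
        by simp
    qed (use n1 n2 i3 in \<open>auto simp: left_diff_distrib\<close>)
    also have "\<dots> = e / 2 + 2 * B / d\<^sup>2 * \<sigma>\<^sup>2" using n1 n2 by simp
    also have "\<dots> = e" using \<open>B > 0\<close> \<open>d > 0\<close> by (simp add: \<sigma>2)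
    finally show ?thesis .
  qed
  with fourier_mixture_gaussian_smoothing[OF int \<open>\<sigma> > 0\<close>] show ?thesis by blast
qed

text \<open>Two dominated convergence arguments: first \<open>f\<close> is clamped to
  \<open>{-C..C}\<close> in value and cut off continuously in space, then the clamped function is
  approximated by continuous ones under the same clamp and cutoff.\<close>

lemma L1_continuous_approx:
  fixes f :: "real \<Rightarrow> real"
  assumes f: "integrable lborel f" and "e > 0"
  shows "\<exists>\<phi> R. continuous_on UNIV \<phi> \<and> (\<forall>x. \<bar>x\<bar> > R \<longrightarrow> \<phi> x = 0) \<and> integrable lborel \<phi> \<and>
    (LINT x|lborel. \<bar>f x - \<phi> x\<bar>) < e"
proof -
  define k where "k C x = max 0 (min 1 (C + 1 - \<bar>x\<bar>))" for C x :: real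
  define cl where "cl C y = max (- C) (min C y)" for C y :: real
  have k: "0 \<le> k C x" "k C x \<le> 1" "\<bar>x\<bar> > C + 1 \<Longrightarrow> k C x = 0" "\<bar>x\<bar> \<le> C \<Longrightarrow> k C x = 1" for C x
    by (auto simp: k_def)
  have cl: "C \<ge> 0 \<Longrightarrow> \<bar>cl C y\<bar> \<le> C" "C \<ge> 0 \<Longrightarrow> \<bar>cl C y\<bar> \<le> \<bar>y\<bar>" "\<bar>y\<bar> \<le> C \<Longrightarrow> cl C y = y" for C y
    by (auto simp: cl_def)
  have contk: "continuous_on UNIV (\<lambda>x. k C x)" and contcl: "continuous_on UNIV (cl C)" for C
    unfolding k_def cl_def by (intro continuous_intros)+
  have [measurable]: "k C \<in> borel_measurable borel" "cl C \<in> borel_measurable borel" for C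
    using contk contcl by (auto intro: borel_measurable_continuous_onI)
  have [measurable]: "f \<in> borel_measurable borel" using f by auto
  have "(\<lambda>n. LINT x|lborel. \<bar>f x - cl (real n) (f x) * k (real n) x\<bar>) \<longlonglongrightarrow> (LINT x|(lborel :: real measure). 0)"
  proof (rule integral_dominated_convergence[where w="\<lambda>x. 2 * \<bar>f x\<bar>"])
    show "integrable lborel (\<lambda>x. 2 * \<bar>f x\<bar>)" using f by auto
    show "AE x in lborel. (\<lambda>n. \<bar>f x - cl (real n) (f x) * k (real n) x\<bar>) \<longlonglongrightarrow> 0"
    proof (intro AE_I2 tendsto_eventually)
      fix x
      have "eventually (\<lambda>n. real n \<ge> \<bar>f x\<bar> \<and> real n \<ge> \<bar>x\<bar>) sequentially"
        using filterlim_real_sequentially by (auto simp: filterlim_at_top eventually_conj_iff)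
      then show "eventually (\<lambda>n. \<bar>f x - cl (real n) (f x) * k (real n) x\<bar> = 0) sequentially"
        by eventually_elim (simp add: cl k)
    qed
    show "AE x in lborel. norm \<bar>f x - cl (real n) (f x) * k (real n) x\<bar> \<le> 2 * \<bar>f x\<bar>" for n
    proof (intro AE_I2)
      fix x
      have "\<bar>cl (real n) (f x) * k (real n) x\<bar> \<le> \<bar>f x\<bar> * 1"
        unfolding abs_mult using cl(2)[of "real n" "f x"] k(1,2)[of "real n" x] by (intro mult_mono) auto
      then show "norm \<bar>f x - cl (real n) (f x) * k (real n) x\<bar> \<le> 2 * \<bar>f x\<bar>" by simp
    qed
  qed measurable
  then have "(\<lambda>n. LINT x|lborel. \<bar>f x - cl (real n) (f x) * k (real n) x\<bar>) \<longlonglongrightarrow> 0" by simp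
  from order_tendstoD(2)[OF this, of "e / 2"] \<open>e > 0\<close>
  obtain n where n: "(LINT x|lborel. \<bar>f x - cl (real n) (f x) * k (real n) x\<bar>) < e / 2"
    by (auto simp: eventually_sequentially)
  define C where "C = real n"
  let ?f = "\<lambda>x. cl C (f x) * k C x"
  have "C \<ge> 0" by (simp add: C_def)
  have dom: "\<bar>cl C y * k C x\<bar> \<le> C * indicator {- (C + 1)..C + 1} x" for x y
  proof (cases "\<bar>x\<bar> > C + 1")
    case False
    then show ?thesis
      using mult_mono[OF cl(1)[OF \<open>C \<ge> 0\<close>, of y] k(2)[of C x]] k(1)[of C x] \<open>C \<ge> 0\<close>
      by (auto simp: abs_mult indicator_def)
  qed (use \<open>C \<ge> 0\<close> in \<open>auto simp: k\<close>)
  have intdom: "integrable lborel (\<lambda>x. C * indicator {- (C + 1)..C + 1} x :: real)"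
    by (intro integrable_mult_right integrable_real_indicator) (simp_all add: emeasure_lborel_Icc_eq)
  have int: "integrable lborel (\<lambda>x. cl C (g x) * k C x)" if [measurable]: "g \<in> borel_measurable borel" for g
    using dom by (intro Bochner_Integration.integrable_bound[OF intdom]) (auto intro: order_trans[OF _ abs_ge_self])
  \<comment> \<open>Yields continuous functions converging to \<open>f\<close> off a null set. They
    carry no bound; \<open>cl C\<close> and \<open>k C\<close> supply the domination.\<close>
  have "f measurable_on UNIV"
    using lebesgue_measurable_imp_measurable_on_real[of f UNIV] by (simp add: measurable_completion)
  then obtain Z g where Z: "negligible Z" and g: "\<And>n. continuous_on UNIV (g n)"
    "\<And>x. x \<notin> Z \<Longrightarrow> (\<lambda>n. g n x) \<longlonglongrightarrow> f x"
    unfolding measurable_on_def by auto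
  have [measurable]: "g j \<in> borel_measurable borel" for j using g(1) by (auto intro: borel_measurable_continuous_onI)
  have "AE x in lebesgue. x \<notin> Z" using Z by (simp add: negligible_iff_null_sets AE_not_in)
  then have AEZ: "AE x in lborel. x \<notin> Z" by (simp add: AE_completion_iff)
  have "(\<lambda>j. LINT x|lborel. \<bar>?f x - cl C (g j x) * k C x\<bar>) \<longlonglongrightarrow> (LINT x|(lborel :: real measure). 0)"
  proof (rule integral_dominated_convergence[where w="\<lambda>x. 2 * (C * indicator {- (C + 1)..C + 1} x)"])
    show "integrable lborel (\<lambda>x. 2 * (C * indicator {- (C + 1)..C + 1} x))" using intdom by (rule integrable_mult_right)
    show "AE x in lborel. (\<lambda>j. \<bar>?f x - cl C (g j x) * k C x\<bar>) \<longlonglongrightarrow> 0"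
      using AEZ
    proof eventually_elim
      case (elim x)
      have "isCont (cl C) (f x)" using contcl by (simp add: continuous_on_eq_continuous_at)
      from isCont_tendsto_compose[OF this g(2)[OF elim]]
      have "(\<lambda>j. \<bar>?f x - cl C (g j x) * k C x\<bar>) \<longlonglongrightarrow> \<bar>?f x - cl C (f x) * k C x\<bar>"
        by (intro tendsto_intros)
      then show ?case by simp
    qed
    show "AE x in lborel. norm \<bar>?f x - cl C (g j x) * k C x\<bar> \<le> 2 * (C * indicator {- (C + 1)..C + 1} x)" for j
    proof (intro AE_I2)
      fix x
      show "norm \<bar>?f x - cl C (g j x) * k C x\<bar> \<le> 2 * (C * indicator {- (C + 1)..C + 1} x)"
        using dom[of "f x" x] dom[of "g j x" x] by (simp only: real_norm_def abs_abs)
    qed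
  qed measurable
  then have "(\<lambda>j. LINT x|lborel. \<bar>?f x - cl C (g j x) * k C x\<bar>) \<longlonglongrightarrow> 0" by simp
  from order_tendstoD(2)[OF this, of "e / 2"] \<open>e > 0\<close>
  obtain j where j: "(LINT x|lborel. \<bar>?f x - cl C (g j x) * k C x\<bar>) < e / 2"
    by (auto simp: eventually_sequentially)
  let ?\<phi> = "\<lambda>x. cl C (g j x) * k C x"
  have i: "integrable lborel (\<lambda>x. \<bar>f x - ?f x\<bar>)" "integrable lborel (\<lambda>x. \<bar>?f x - ?\<phi> x\<bar>)"
    "integrable lborel (\<lambda>x. \<bar>f x - ?\<phi> x\<bar>)"
    using f int[of f] int[of "g j"] by auto
  have "(LINT x|lborel. \<bar>f x - ?\<phi> x\<bar>) \<le> (LINT x|lborel. \<bar>f x - ?f x\<bar> + \<bar>?f x - ?\<phi> x\<bar>)"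
    using i by (intro integral_mono) auto
  also have "\<dots> < e" using i n j by (simp add: C_def)
  finally have "(LINT x|lborel. \<bar>f x - ?\<phi> x\<bar>) < e" .
  moreover have "continuous_on UNIV ?\<phi>"
    by (intro continuous_on_mult continuous_on_compose2[OF contcl g(1)] contk) simp
  ultimately show ?thesis
    using int[of "g j"] k(3) by (intro exI[of _ ?\<phi>] exI[of _ "C + 1"]) auto
qed

section \<open>Moments\<close>

text \<open>The exponential series converges uniformly on the common range of the variables.\<close>

lemma moments_tendsto_imp_iexp_tendsto:
  fixes F :: "nat \<Rightarrow> 'a \<Rightarrow> real" and G :: "'b \<Rightarrow> real"
  assumes "prob_space M" "prob_space N"
    and [measurable]: "\<And>n. F n \<in> borel_measurable M" "G \<in> borel_measurable N"
    and bound: "\<And>n \<omega>. \<bar>F n \<omega>\<bar> \<le> C" "\<And>\<omega>. \<bar>G \<omega>\<bar> \<le> C"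
    and mom: "\<And>k. (\<lambda>n. LINT \<omega>|M. F n \<omega> ^ k) \<longlonglongrightarrow> (LINT \<omega>|N. G \<omega> ^ k)"
  shows "(\<lambda>n. CLINT \<omega>|M. iexp (F n \<omega>)) \<longlonglongrightarrow> (CLINT \<omega>|N. iexp (G \<omega>))"
proof (rule tendstoI)
  interpret M: prob_space M by fact
  interpret N: prob_space N by fact
  fix e :: real assume "e > 0"
  have "C \<ge> 0" using bound(2)[of undefined] by linarith
  have "(\<lambda>K. C ^ K / fact K) \<longlonglongrightarrow> 0"
    using summable_LIMSEQ_zero[OF summable_exp[of C]] by (simp add: field_simps)
  then have "(\<lambda>K. C ^ Suc K / fact (Suc K)) \<longlonglongrightarrow> 0" by (rule LIMSEQ_Suc)
  from order_tendstoD(2)[OF this, of "e / 3"] \<open>e > 0\<close>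
  obtain K where K: "C ^ Suc K / fact (Suc K) < e / 3" by (auto simp: eventually_sequentially)
  define p where "p x = (\<Sum>k\<le>K. (\<i> * complex_of_real x) ^ k / fact k)" for x
  have approx: "norm ((CLINT \<omega>|P. iexp (X \<omega>)) - (\<Sum>k\<le>K. \<i> ^ k / fact k * of_real (LINT \<omega>|P. X \<omega> ^ k))) < e / 3"
    if P: "prob_space P" and [measurable]: "X \<in> borel_measurable P" and X: "\<And>\<omega>. \<bar>X \<omega>\<bar> \<le> C"
    for P and X :: "'c \<Rightarrow> real"
  proof -
    interpret P: prob_space P by fact
    have int: "integrable P (\<lambda>\<omega>. X \<omega> ^ k)" for k
      by (rule P.integrable_const_bound[where B="C ^ k"]) (auto simp: power_abs intro!: power_mono X)
    have int': "integrable P (\<lambda>\<omega>. \<i> ^ k / fact k * complex_of_real (X \<omega> ^ k))" for k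
      using int[of k] by (intro integrable_mult_right integrable_of_real) auto
    have p: "p (X \<omega>) = (\<Sum>k\<le>K. \<i> ^ k / fact k * complex_of_real (X \<omega> ^ k))" for \<omega>
      unfolding p_def by (intro sum.cong) (auto simp: power_mult_distrib)
    have intp: "integrable P (\<lambda>\<omega>. p (X \<omega>))"
      unfolding p by (intro Bochner_Integration.integrable_sum int')
    have "(\<Sum>k\<le>K. \<i> ^ k / fact k * of_real (LINT \<omega>|P. X \<omega> ^ k)) = (CLINT \<omega>|P. p (X \<omega>))"
      unfolding p by (subst Bochner_Integration.integral_sum[OF int'])
        (auto simp: integral_complex_of_real simp del: of_real_power)
    moreover have inti: "integrable P (\<lambda>\<omega>. iexp (X \<omega>))"
      by (rule P.integrable_const_bound[where B=1]) auto
    ultimately have "norm ((CLINT \<omega>|P. iexp (X \<omega>)) - (\<Sum>k\<le>K. \<i> ^ k / fact k * of_real (LINT \<omega>|P. X \<omega> ^ k)))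
        = norm (CLINT \<omega>|P. iexp (X \<omega>) - p (X \<omega>))" using intp by simp
    also have "\<dots> \<le> (LINT \<omega>|P. norm (iexp (X \<omega>) - p (X \<omega>)))" by (rule integral_norm_bound)
    also have "\<dots> \<le> (LINT \<omega>|P. C ^ Suc K / fact (Suc K))"
    proof (intro integral_mono)
      fix \<omega>
      have "norm (iexp (X \<omega>) - p (X \<omega>)) \<le> \<bar>X \<omega>\<bar> ^ Suc K / fact (Suc K)"
        unfolding p_def by (rule iexp_approx1)
      also have "\<dots> \<le> C ^ Suc K / fact (Suc K)" using X by (intro divide_right_mono power_mono) auto
      finally show "norm (iexp (X \<omega>) - p (X \<omega>)) \<le> C ^ Suc K / fact (Suc K)" .
    qed (use inti intp in auto)
    also have "\<dots> < e / 3" using K by (simp add: P.prob_space)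
    finally show ?thesis .
  qed
  have "(\<lambda>n. \<Sum>k\<le>K. \<i> ^ k / fact k * complex_of_real (LINT \<omega>|M. F n \<omega> ^ k))
      \<longlonglongrightarrow> (\<Sum>k\<le>K. \<i> ^ k / fact k * of_real (LINT \<omega>|N. G \<omega> ^ k))"
    by (intro tendsto_intros mom)
  from tendstoD[OF this, of "e / 3"] \<open>e > 0\<close>
  have "eventually (\<lambda>n. dist (\<Sum>k\<le>K. \<i> ^ k / fact k * complex_of_real (LINT \<omega>|M. F n \<omega> ^ k))
      (\<Sum>k\<le>K. \<i> ^ k / fact k * of_real (LINT \<omega>|N. G \<omega> ^ k)) < e / 3) sequentially" by simp
  then show "eventually (\<lambda>n. dist (CLINT \<omega>|M. iexp (F n \<omega>)) (CLINT \<omega>|N. iexp (G \<omega>)) < e) sequentially"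
  proof eventually_elim
    case (elim n)
    have tri: "norm (a - b) < e" if "norm (a - a') < e / 3" "norm (b - b') < e / 3" "norm (a' - b') < e / 3"
      for a a' b b' :: complex
    proof -
      have "a - b = (a - a') + (a' - b') - (b - b')" by simp
      then have "norm (a - b) \<le> norm (a - a') + norm (a' - b') + norm (b - b')"
        by (metis norm_triangle_ineq norm_triangle_ineq4 add_right_mono order_trans)
      with that show ?thesis by linarith
    qed
    show ?case unfolding dist_norm
      by (rule tri[OF approx[OF assms(1,3) bound(1)] approx[OF assms(2,4) bound(2)] elim[unfolded dist_norm]])
  qed
qed

text \<open>A power of an integral is an integral over a finite product, and a product of
  exponentials is the exponential of a sum. Fubini then leaves the characteristic function of a
  finite linear combination of the process.\<close>

lemma mixture_moment:
  fixes Z :: "'p \<Rightarrow> 'a \<Rightarrow> real" and m :: "'p \<Rightarrow> complex"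
  assumes "prob_space M" "sigma_finite_measure K" and m: "integrable K m"
    and Z [measurable]: "(\<lambda>(p, \<omega>). Z p \<omega>) \<in> borel_measurable (K \<Otimes>\<^sub>M M)"
  shows "(CLINT \<omega>|M. (CLINT p|K. m p * iexp (Z p \<omega>)) ^ k) =
    (CLINT x|PiM {..<k} (\<lambda>_. K). (\<Prod>i<k. m (x i)) * (CLINT \<omega>|M. iexp (\<Sum>i<k. Z (x i) \<omega>)))"
    and "integrable (PiM {..<k} (\<lambda>_. K)) (\<lambda>x. \<Prod>i<k. m (x i))"
    and "(\<lambda>x. CLINT \<omega>|M. iexp (\<Sum>i<k. Z (x i) \<omega>)) \<in> borel_measurable (PiM {..<k} (\<lambda>_. K))"
proof -
  interpret M: prob_space M by fact
  interpret K: sigma_finite_measure K by fact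
  interpret product_sigma_finite "\<lambda>_. K" by (unfold_locales) (rule K.sigma_finite_countable)
  let ?P = "PiM {..<k} (\<lambda>_. K)"
  interpret P: sigma_finite_measure ?P by (rule sigma_finite) simp
  interpret PM: pair_sigma_finite ?P M ..
  have [measurable]: "m \<in> borel_measurable K" using m by auto
  show intm: "integrable ?P (\<lambda>x. \<Prod>i<k. m (x i))"
    by (rule product_integrable_prod) (auto intro: m)
  have Zc: "(\<lambda>q. Z (fst q i) (snd q)) \<in> borel_measurable (?P \<Otimes>\<^sub>M M)" if "i \<in> {..<k}" for i
  proof -
    have "(\<lambda>q. (fst q i, snd q)) \<in> measurable (?P \<Otimes>\<^sub>M M) (K \<Otimes>\<^sub>M M)"
      using that by (intro measurable_Pair measurable_compose[OF measurable_fst] measurable_component_singleton measurable_snd)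
    from measurable_compose[OF this Z] show ?thesis by simp
  qed
  have S [measurable]: "(\<lambda>q. \<Sum>i<k. Z (fst q i) (snd q)) \<in> borel_measurable (?P \<Otimes>\<^sub>M M)"
    by (intro borel_measurable_sum Zc)
  have S' [measurable]: "(\<lambda>(x, \<omega>). \<Sum>i<k. Z (x i) \<omega>) \<in> borel_measurable (?P \<Otimes>\<^sub>M M)"
    using S by (simp add: split_beta')
  show "(\<lambda>x. CLINT \<omega>|M. iexp (\<Sum>i<k. Z (x i) \<omega>)) \<in> borel_measurable ?P" by measurable
  have [measurable]: "(\<lambda>x. \<Prod>i<k. m (x i)) \<in> borel_measurable ?P" using intm by auto
  have "integrable (?P \<Otimes>\<^sub>M M) (\<lambda>(x, \<omega>). \<Prod>i<k. m (x i))"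
    by (rule PM.Fubini_integrable) (use intm in \<open>auto simp: M.prob_space intro!: integrable_norm\<close>)
  then have int: "integrable (?P \<Otimes>\<^sub>M M) (\<lambda>(x, \<omega>). (\<Prod>i<k. m (x i)) * iexp (\<Sum>i<k. Z (x i) \<omega>))"
    by (rule Bochner_Integration.integrable_bound) (auto simp: norm_mult)
  have "(CLINT p|K. m p * iexp (Z p \<omega>)) ^ k = (CLINT x|?P. (\<Prod>i<k. m (x i)) * iexp (\<Sum>i<k. Z (x i) \<omega>))"
    if "\<omega> \<in> space M" for \<omega>
  proof -
    have [measurable]: "(\<lambda>p. Z p \<omega>) \<in> borel_measurable K"
      using measurable_compose[OF measurable_Pair2'[OF that] Z] by simp
    have "integrable K (\<lambda>p. m p * iexp (Z p \<omega>))"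
      by (rule Bochner_Integration.integrable_bound[OF m]) (auto simp: norm_mult)
    from product_integral_prod[OF finite_lessThan this, of k]
    have "(CLINT p|K. m p * iexp (Z p \<omega>)) ^ k = (CLINT x|?P. (\<Prod>i<k. m (x i) * iexp (Z (x i) \<omega>)))" by simp
    also have "\<dots> = (CLINT x|?P. (\<Prod>i<k. m (x i)) * iexp (\<Sum>i<k. Z (x i) \<omega>))"
      by (simp add: prod.distrib exp_sum[symmetric] sum_distrib_left)
    finally show ?thesis .
  qed
  then have "(CLINT \<omega>|M. (CLINT p|K. m p * iexp (Z p \<omega>)) ^ k)
      = (CLINT \<omega>|M. CLINT x|?P. (\<Prod>i<k. m (x i)) * iexp (\<Sum>i<k. Z (x i) \<omega>))"
    by (intro Bochner_Integration.integral_cong refl)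
  also have "\<dots> = (CLINT x|?P. CLINT \<omega>|M. (\<Prod>i<k. m (x i)) * iexp (\<Sum>i<k. Z (x i) \<omega>))"
    by (rule PM.Fubini_integral[OF int])
  finally show "(CLINT \<omega>|M. (CLINT p|K. m p * iexp (Z p \<omega>)) ^ k) =
    (CLINT x|?P. (\<Prod>i<k. m (x i)) * (CLINT \<omega>|M. iexp (\<Sum>i<k. Z (x i) \<omega>)))" by simp
qed

text \<open>Characteristic functions are bounded by 1, so the integrable product of the
  \<open>m (x i)\<close> dominates.\<close>

lemma mixture_moment_tendsto:
  fixes Z :: "nat \<Rightarrow> 'p \<Rightarrow> 'a \<Rightarrow> real" and Z' :: "'p \<Rightarrow> 'b \<Rightarrow> real" and m :: "'p \<Rightarrow> complex"
  assumes M: "prob_space M" and N: "prob_space N" and K: "sigma_finite_measure K" and m: "integrable K m"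
    and Z: "\<And>n. (\<lambda>(p, \<omega>). Z n p \<omega>) \<in> borel_measurable (K \<Otimes>\<^sub>M M)"
    and Z': "(\<lambda>(p, \<omega>). Z' p \<omega>) \<in> borel_measurable (K \<Otimes>\<^sub>M N)"
    and fdd: "\<And>x. (\<And>i. i < k \<Longrightarrow> x i \<in> space K) \<Longrightarrow>
      (\<lambda>n. CLINT \<omega>|M. iexp (\<Sum>i<k. Z n (x i) \<omega>)) \<longlonglongrightarrow> (CLINT \<omega>|N. iexp (\<Sum>i<k. Z' (x i) \<omega>))"
  shows "(\<lambda>n. CLINT \<omega>|M. (CLINT p|K. m p * iexp (Z n p \<omega>)) ^ k)
    \<longlonglongrightarrow> (CLINT \<omega>|N. (CLINT p|K. m p * iexp (Z' p \<omega>)) ^ k)"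
proof -
  interpret M: prob_space M by fact
  let ?P = "PiM {..<k} (\<lambda>_. K)"
  note mom = mixture_moment[OF M K m Z] and mom' = mixture_moment[OF N K m Z']
  note [measurable] = mom(3) mom'(3)
  have [measurable]: "(\<lambda>x. \<Prod>i<k. m (x i)) \<in> borel_measurable ?P" using mom(2) by auto
  show ?thesis unfolding mom(1) mom'(1)
  proof (rule integral_dominated_convergence[where w="\<lambda>x. norm (\<Prod>i<k. m (x i))"])
    show "integrable ?P (\<lambda>x. norm (\<Prod>i<k. m (x i)))" using mom(2) by (rule integrable_norm)
    show "AE x in ?P. (\<lambda>n. (\<Prod>i<k. m (x i)) * (CLINT \<omega>|M. iexp (\<Sum>i<k. Z n (x i) \<omega>)))
        \<longlonglongrightarrow> (\<Prod>i<k. m (x i)) * (CLINT \<omega>|N. iexp (\<Sum>i<k. Z' (x i) \<omega>))"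
      by (intro AE_I2 tendsto_intros fdd) (auto simp: space_PiM PiE_iff)
    show "AE x in ?P. norm ((\<Prod>i<k. m (x i)) * (CLINT \<omega>|M. iexp (\<Sum>i<k. Z n (x i) \<omega>)))
        \<le> norm (\<Prod>i<k. m (x i))" for n
    proof (intro AE_I2)
      fix x
      have "norm (CLINT \<omega>|M. iexp (\<Sum>i<k. Z n (x i) \<omega>)) \<le> (LINT \<omega>|M. norm (iexp (\<Sum>i<k. Z n (x i) \<omega>)))"
        by (rule integral_norm_bound)
      also have "\<dots> = 1" by (simp add: M.prob_space)
      finally show "norm ((\<Prod>i<k. m (x i)) * (CLINT \<omega>|M. iexp (\<Sum>i<k. Z n (x i) \<omega>))) \<le> norm (\<Prod>i<k. m (x i))"
        unfolding norm_mult by (rule mult_left_le) simp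
    qed
  qed measurable
qed

section \<open>Time integrals of processes\<close>

lemma fourier_mixture_bounded:
  assumes "fourier_mixture m u"
  shows "\<bar>u x\<bar> \<le> (LINT \<theta>|lborel. norm (m \<theta>))"
proof -
  have "\<bar>u x\<bar> = norm (CLINT \<theta>|lborel. m \<theta> * iexp (\<theta> * x))"
    using assms unfolding fourier_mixture_def by (metis norm_of_real)
  also have "\<dots> \<le> (LINT \<theta>|lborel. norm (m \<theta> * iexp (\<theta> * x)))" by (rule integral_norm_bound)
  finally show ?thesis by (simp add: norm_mult)
qed

lemma fourier_mixture_measurable:
  assumes "fourier_mixture m u"
  shows "u \<in> borel_measurable borel"
proof -
  have [measurable]: "m \<in> borel_measurable borel" using assms by (auto simp: fourier_mixture_def)
  have "u x = Re (CLINT \<theta>|lborel. m \<theta> * iexp (\<theta> * x))" for x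
    using assms unfolding fourier_mixture_def by (metis Re_complex_of_real)
  then have "u = (\<lambda>x. Re (CLINT \<theta>|lborel. m \<theta> * iexp (\<theta> * x)))" by auto
  then show ?thesis by simp
qed

lemma abs_integral_le_measure:
  fixes g :: "'s \<Rightarrow> real"
  assumes "finite_measure T" "\<And>s. \<bar>g s\<bar> \<le> B"
  shows "\<bar>LINT s|T. g s\<bar> \<le> B * measure T (space T)"
proof (cases "integrable T g")
  case True
  interpret finite_measure T by fact
  have "\<bar>LINT s|T. g s\<bar> \<le> (LINT s|T. \<bar>g s\<bar>)" by (rule integral_abs_bound)
  also have "\<dots> \<le> (LINT s|T. B)" using True assms by (intro integral_mono) auto
  finally show ?thesis by (simp add: mult.commute)
next
  case False
  have "0 \<le> B" using assms(2) abs_ge_zero order_trans by blast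
  with False show ?thesis by (simp add: not_integrable_integral_eq)
qed

lemma measurable_section:
  assumes "(\<lambda>(s, \<omega>). X s \<omega>) \<in> measurable (T \<Otimes>\<^sub>M P) Q" "\<omega> \<in> space P"
  shows "(\<lambda>s. X s \<omega>) \<in> measurable T Q"
  using measurable_compose[OF measurable_Pair2'[OF assms(2)] assms(1)] by simp

lemma time_integral_measurable:
  fixes Y :: "'s \<Rightarrow> 'a \<Rightarrow> real"
  assumes "sigma_finite_measure T" and Y: "(\<lambda>(s, \<omega>). Y s \<omega>) \<in> borel_measurable (T \<Otimes>\<^sub>M M)"
    and [measurable]: "g \<in> borel_measurable borel"
  shows "(\<lambda>\<omega>. LINT s|T. (g (Y s \<omega>) :: real)) \<in> borel_measurable M"
proof -
  interpret sigma_finite_measure T by fact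
  have [measurable]: "(\<lambda>(\<omega>, s). Y s \<omega>) \<in> borel_measurable (M \<Otimes>\<^sub>M T)"
    using measurable_pair_swap[OF Y] by (simp add: split_beta')
  show ?thesis by measurable
qed

text \<open>Writes a time integral as one integral over pairs of a time and a frequency, the form in
  which moments are computed.\<close>

lemma mixture_time_integral:
  fixes Y :: "'s \<Rightarrow> 'a \<Rightarrow> real"
  assumes T: "finite_measure T" and u: "fourier_mixture m u"
    and Y [measurable]: "y \<in> borel_measurable T"
  shows "(CLINT p|(T \<Otimes>\<^sub>M lborel). m (snd p) * iexp (snd p * y (fst p))) = of_real (LINT s|T. u (y s))"
    and "integrable (T \<Otimes>\<^sub>M lborel) (\<lambda>p. m (snd p))"
proof -
  interpret T: finite_measure T by fact
  interpret TL: pair_sigma_finite T lborel ..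
  have m: "integrable lborel m" using u by (simp add: fourier_mixture_def)
  then have [measurable]: "m \<in> borel_measurable borel" by auto
  have "integrable (T \<Otimes>\<^sub>M lborel) (\<lambda>(s, \<theta>). m \<theta>)"
    by (rule TL.Fubini_integrable) (use m in auto)
  then show int: "integrable (T \<Otimes>\<^sub>M lborel) (\<lambda>p. m (snd p))" by (simp add: split_beta')
  have int': "integrable (T \<Otimes>\<^sub>M lborel) (\<lambda>p. m (snd p) * iexp (snd p * y (fst p)))"
    by (rule Bochner_Integration.integrable_bound[OF int]) (auto simp: norm_mult)
  have "(CLINT p|(T \<Otimes>\<^sub>M lborel). m (snd p) * iexp (snd p * y (fst p)))
      = (CLINT s|T. CLINT \<theta>|lborel. m \<theta> * iexp (\<theta> * y s))"
    using TL.integral_fst'[OF int'] by simp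
  also have "\<dots> = (CLINT s|T. of_real (u (y s)))"
    using u by (simp only: fourier_mixture_def)
  finally show "(CLINT p|(T \<Otimes>\<^sub>M lborel). m (snd p) * iexp (snd p * y (fst p))) = of_real (LINT s|T. u (y s))"
    by (simp only: integral_complex_of_real)
qed

lemma mixture_exponent_measurable:
  fixes Y :: "'s \<Rightarrow> 'a \<Rightarrow> real"
  assumes Y: "(\<lambda>(s, \<omega>). Y s \<omega>) \<in> borel_measurable (T \<Otimes>\<^sub>M M)"
  shows "(\<lambda>(p, \<omega>). snd p * Y (fst p) \<omega>) \<in> borel_measurable ((T \<Otimes>\<^sub>M lborel) \<Otimes>\<^sub>M M)"
proof -
  let ?P = "(T \<Otimes>\<^sub>M (lborel :: real measure)) \<Otimes>\<^sub>M M"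
  have "(\<lambda>q. (fst (fst q), snd q)) \<in> measurable ?P (T \<Otimes>\<^sub>M M)" by measurable
  from measurable_compose[OF this Y] have [measurable]:
    "(\<lambda>q. Y (fst (fst q)) (snd q)) \<in> borel_measurable ?P" by simp
  have "(\<lambda>q. snd (fst q) * Y (fst (fst q)) (snd q)) \<in> borel_measurable ?P" by measurable
  then show ?thesis by (simp add: split_beta')
qed

lemma mixture_time_integral_iexp_tendsto:
  fixes Y :: "nat \<Rightarrow> 's \<Rightarrow> 'a \<Rightarrow> real" and Y' :: "'s \<Rightarrow> 'b \<Rightarrow> real"
  assumes T: "finite_measure T" and M: "prob_space M" and N: "prob_space N"
    and Y: "\<And>n. (\<lambda>(s, \<omega>). Y n s \<omega>) \<in> borel_measurable (T \<Otimes>\<^sub>M M)"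
    and Y': "(\<lambda>(s, \<omega>). Y' s \<omega>) \<in> borel_measurable (T \<Otimes>\<^sub>M N)"
    and fdd: "\<And>k (s :: nat \<Rightarrow> 's) \<theta>. (\<And>i. i < k \<Longrightarrow> s i \<in> space T) \<Longrightarrow>
      (\<lambda>n. CLINT \<omega>|M. iexp (\<Sum>i<k. \<theta> i * Y n (s i) \<omega>)) \<longlonglongrightarrow> (CLINT \<omega>|N. iexp (\<Sum>i<k. \<theta> i * Y' (s i) \<omega>))"
    and u: "fourier_mixture m u"
  shows "(\<lambda>n. CLINT \<omega>|M. iexp (LINT s|T. u (Y n s \<omega>))) \<longlonglongrightarrow> (CLINT \<omega>|N. iexp (LINT s|T. u (Y' s \<omega>)))"
proof -
  interpret T: finite_measure T by fact
  interpret TL: pair_sigma_finite T lborel ..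
  interpret M: prob_space M by fact
  interpret N: prob_space N by fact
  let ?K = "T \<Otimes>\<^sub>M (lborel :: real measure)"
  have [measurable]: "u \<in> borel_measurable borel" by (rule fourier_mixture_measurable[OF u])
  let ?F = "\<lambda>n \<omega>. LINT s|T. u (Y n s \<omega>)"
  let ?G = "\<lambda>\<omega>. LINT s|T. u (Y' s \<omega>)"
  \<comment> \<open>A common bound for all the variables: \<open>u\<close> is bounded by the L1 norm
    of \<open>m\<close>, and the total time is finite.\<close>
  let ?B = "(LINT \<theta>|lborel. norm (m \<theta>)) * measure T (space T)"
  have F [measurable]: "?F n \<in> borel_measurable M" for n
    by (rule time_integral_measurable[OF _ Y]) (auto intro: T.sigma_finite_measure_axioms)
  have G [measurable]: "?G \<in> borel_measurable N"
    by (rule time_integral_measurable[OF _ Y']) (auto intro: T.sigma_finite_measure_axioms)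
  note Zn = mixture_exponent_measurable[OF Y] and Z' = mixture_exponent_measurable[OF Y']
  have intm: "integrable ?K (\<lambda>p. m (snd p))"
    by (rule mixture_time_integral(2)[OF T u, of "\<lambda>_. 0"]) simp
  have "(\<lambda>n. LINT \<omega>|M. ?F n \<omega> ^ k) \<longlonglongrightarrow> (LINT \<omega>|N. ?G \<omega> ^ k)" for k
  proof -
    have "(\<lambda>n. CLINT \<omega>|M. (CLINT p|?K. m (snd p) * iexp (snd p * Y n (fst p) \<omega>)) ^ k)
        \<longlonglongrightarrow> (CLINT \<omega>|N. (CLINT p|?K. m (snd p) * iexp (snd p * Y' (fst p) \<omega>)) ^ k)"
    proof (rule mixture_moment_tendsto[OF M N _ intm Zn Z'])
      show "sigma_finite_measure ?K" by (rule TL.sigma_finite_measure_axioms)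
      fix x :: "nat \<Rightarrow> 's \<times> real" assume "\<And>i. i < k \<Longrightarrow> x i \<in> space ?K"
      then have "\<And>i. i < k \<Longrightarrow> fst (x i) \<in> space T" by (auto simp: space_pair_measure mem_Times_iff)
      from fdd[of k "\<lambda>i. fst (x i)" "\<lambda>i. snd (x i)", OF this]
      show "(\<lambda>n. CLINT \<omega>|M. iexp (\<Sum>i<k. snd (x i) * Y n (fst (x i)) \<omega>))
          \<longlonglongrightarrow> (CLINT \<omega>|N. iexp (\<Sum>i<k. snd (x i) * Y' (fst (x i)) \<omega>))" .
    qed
    moreover have "(CLINT \<omega>|M. (CLINT p|?K. m (snd p) * iexp (snd p * Y n (fst p) \<omega>)) ^ k)
        = of_real (LINT \<omega>|M. ?F n \<omega> ^ k)" for n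
      by (subst integral_complex_of_real[symmetric], intro Bochner_Integration.integral_cong refl)
         (simp only: of_real_power mixture_time_integral(1)[OF T u measurable_section[OF Y]])
    moreover have "(CLINT \<omega>|N. (CLINT p|?K. m (snd p) * iexp (snd p * Y' (fst p) \<omega>)) ^ k)
        = of_real (LINT \<omega>|N. ?G \<omega> ^ k)"
      by (subst integral_complex_of_real[symmetric], intro Bochner_Integration.integral_cong refl)
         (simp only: of_real_power mixture_time_integral(1)[OF T u measurable_section[OF Y']])
    ultimately show ?thesis by (simp only: tendsto_of_real_iff)
  qed
  with F G show ?thesis
    by (intro moments_tendsto_imp_iexp_tendsto[OF M N, of _ _ ?B] abs_integral_le_measure[OF T]
        fourier_mixture_bounded[OF u])
qed

text \<open>\<open>occ\<close> says that the expected occupation measure is at most \<open>A\<close>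
  times Lebesgue measure. By Tonelli, composition with the process then maps L1 of the line
  boundedly into L1 of the product of time and sample space.\<close>

lemma occupation_integrable:
  fixes Y :: "'s \<Rightarrow> 'a \<Rightarrow> real"
  assumes T: "finite_measure T" and M: "prob_space M"
    and Y [measurable]: "(\<lambda>(s, \<omega>). Y s \<omega>) \<in> borel_measurable (T \<Otimes>\<^sub>M M)"
    and occ: "\<And>h. h \<in> borel_measurable borel \<Longrightarrow>
      (\<integral>\<^sup>+s. \<integral>\<^sup>+\<omega>. h (Y s \<omega>) \<partial>M \<partial>T) \<le> ennreal A * (\<integral>\<^sup>+x. h x \<partial>lborel)"
    and g: "integrable lborel (g :: real \<Rightarrow> real)" and "A \<ge> 0"
  shows "integrable (T \<Otimes>\<^sub>M M) (\<lambda>(s, \<omega>). g (Y s \<omega>))"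
    and "(LINT q|(T \<Otimes>\<^sub>M M). \<bar>g (Y (fst q) (snd q))\<bar>) \<le> A * (LINT x|lborel. \<bar>g x\<bar>)"
proof -
  interpret M: prob_space M by fact
  have [measurable]: "g \<in> borel_measurable borel" using g by auto
  have Y2 [measurable]: "(\<lambda>q. Y (fst q) (snd q)) \<in> borel_measurable (T \<Otimes>\<^sub>M M)"
    using Y by (simp add: split_beta')
  have "(\<integral>\<^sup>+q. ennreal \<bar>g (Y (fst q) (snd q))\<bar> \<partial>(T \<Otimes>\<^sub>M M))
      = (\<integral>\<^sup>+s. \<integral>\<^sup>+\<omega>. ennreal \<bar>g (Y s \<omega>)\<bar> \<partial>M \<partial>T)"
    by (subst M.nn_integral_fst[symmetric]) auto
  also have "\<dots> \<le> ennreal A * (\<integral>\<^sup>+x. ennreal \<bar>g x\<bar> \<partial>lborel)" by (rule occ) simp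
  also have "\<dots> = ennreal (A * (LINT x|lborel. \<bar>g x\<bar>))"
    using g \<open>A \<ge> 0\<close> by (subst nn_integral_eq_integral) (auto simp: ennreal_mult)
  finally have le: "(\<integral>\<^sup>+q. ennreal \<bar>g (Y (fst q) (snd q))\<bar> \<partial>(T \<Otimes>\<^sub>M M)) \<le> ennreal (A * (LINT x|lborel. \<bar>g x\<bar>))" .
  have "integrable (T \<Otimes>\<^sub>M M) (\<lambda>q. g (Y (fst q) (snd q)))"
  proof (rule integrableI_bounded)
    show "(\<integral>\<^sup>+q. ennreal (norm (g (Y (fst q) (snd q)))) \<partial>(T \<Otimes>\<^sub>M M)) < \<infinity>"
      using le_less_trans[OF le ennreal_less_top] by simp
  qed measurable
  then show "integrable (T \<Otimes>\<^sub>M M) (\<lambda>(s, \<omega>). g (Y s \<omega>))" by (simp add: split_beta')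
  show "(LINT q|(T \<Otimes>\<^sub>M M). \<bar>g (Y (fst q) (snd q))\<bar>) \<le> A * (LINT x|lborel. \<bar>g x\<bar>)"
    using le \<open>A \<ge> 0\<close> by (intro integral_real_bounded) auto
qed

text \<open>\<open>f\<close> is compared with \<open>\<phi>\<close> in \<open>L\<^sup>1\<close>, through the occupation bound, and \<open>\<phi>\<close> with \<open>u\<close> uniformly.\<close>

lemma time_integral_iexp_error:
  fixes Y :: "'s \<Rightarrow> 'a \<Rightarrow> real"
  assumes T: "finite_measure T" and M: "prob_space M"
    and Y [measurable]: "(\<lambda>(s, \<omega>). Y s \<omega>) \<in> borel_measurable (T \<Otimes>\<^sub>M M)"
    and occ: "\<And>h. h \<in> borel_measurable borel \<Longrightarrow>
      (\<integral>\<^sup>+s. \<integral>\<^sup>+\<omega>. h (Y s \<omega>) \<partial>M \<partial>T) \<le> ennreal A * (\<integral>\<^sup>+x. h x \<partial>lborel)" "A \<ge> 0"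
    and f: "integrable lborel f" and \<phi>: "integrable lborel \<phi>"
    and u [measurable]: "u \<in> borel_measurable borel" and uB: "\<And>x. \<bar>u x\<bar> \<le> B"
    and close: "\<And>x. \<bar>\<phi> x - u x\<bar> \<le> e"
  shows "norm ((CLINT \<omega>|M. iexp (LINT s|T. f (Y s \<omega>))) - (CLINT \<omega>|M. iexp (LINT s|T. u (Y s \<omega>))))
    \<le> A * (LINT x|lborel. \<bar>f x - \<phi> x\<bar>) + e * measure T (space T)"
proof -
  interpret T: finite_measure T by fact
  interpret M: prob_space M by fact
  interpret TM: pair_sigma_finite T M ..
  interpret P: finite_measure "T \<Otimes>\<^sub>M M" by (rule finite_measure_pair_measure[OF M.finite_measure_axioms T])
  have [measurable]: "f \<in> borel_measurable borel" "\<phi> \<in> borel_measurable borel" using f \<phi> by auto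
  have Y2 [measurable]: "(\<lambda>q. Y (fst q) (snd q)) \<in> borel_measurable (T \<Otimes>\<^sub>M M)"
    using Y by (simp add: split_beta')
  let ?F = "\<lambda>\<omega>. LINT s|T. f (Y s \<omega>)" let ?U = "\<lambda>\<omega>. LINT s|T. u (Y s \<omega>)"
  have [measurable]: "?F \<in> borel_measurable M" "?U \<in> borel_measurable M"
    by (rule time_integral_measurable[OF T.sigma_finite_measure_axioms Y]; simp)+
  have if1: "integrable (T \<Otimes>\<^sub>M M) (\<lambda>(s, \<omega>). f (Y s \<omega>))"
    by (rule occupation_integrable(1)[OF T M Y occ(1) f occ(2)])
  have "integrable (T \<Otimes>\<^sub>M M) (\<lambda>q. u (Y (fst q) (snd q)))"
    by (rule P.integrable_const_bound[where B=B]) (use uB in auto)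
  then have iu: "integrable (T \<Otimes>\<^sub>M M) (\<lambda>(s, \<omega>). u (Y s \<omega>))" by (simp add: split_beta')
  let ?d = "\<lambda>s \<omega>. \<bar>f (Y s \<omega>) - u (Y s \<omega>)\<bar>"
  have id': "integrable (T \<Otimes>\<^sub>M M) (\<lambda>(s, \<omega>). ?d s \<omega>)"
    using integrable_abs[OF Bochner_Integration.integrable_diff[OF if1 iu]] by (simp add: split_beta')
  \<comment> \<open>By Fubini the compositions are integrable in time along almost every path, and
    only there may the two time integrals be subtracted.\<close>
  have AE_le: "AE \<omega> in M. \<bar>?F \<omega> - ?U \<omega>\<bar> \<le> (LINT s|T. ?d s \<omega>)"
    using TM.AE_integrable_snd[OF if1] TM.AE_integrable_snd[OF iu]
  proof eventually_elim
    case (elim \<omega>)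
    then have "?F \<omega> - ?U \<omega> = (LINT s|T. f (Y s \<omega>) - u (Y s \<omega>))" by simp
    then show ?case by (simp only: integral_abs_bound)
  qed
  have intD: "integrable M (\<lambda>\<omega>. LINT s|T. ?d s \<omega>)" by (rule TM.integrable_snd[OF id'])
  have i1: "integrable M (\<lambda>\<omega>. iexp (?F \<omega>))" "integrable M (\<lambda>\<omega>. iexp (?U \<omega>))"
    by (auto intro!: M.integrable_const_bound[where B=1])
  have "norm ((CLINT \<omega>|M. iexp (?F \<omega>)) - (CLINT \<omega>|M. iexp (?U \<omega>)))
      = norm (CLINT \<omega>|M. iexp (?F \<omega>) - iexp (?U \<omega>))" using i1 by simp
  also have "\<dots> \<le> (LINT \<omega>|M. norm (iexp (?F \<omega>) - iexp (?U \<omega>)))" by (rule integral_norm_bound)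
  also have "\<dots> \<le> (LINT \<omega>|M. LINT s|T. ?d s \<omega>)"
  proof (intro integral_mono_AE intD)
    show "integrable M (\<lambda>\<omega>. norm (iexp (?F \<omega>) - iexp (?U \<omega>)))" using i1 by auto
    show "AE \<omega> in M. norm (iexp (?F \<omega>) - iexp (?U \<omega>)) \<le> (LINT s|T. ?d s \<omega>)"
      using AE_le by eventually_elim (rule order_trans[OF norm_iexp_diff_le])
  qed
  also have "\<dots> = (LINT q|(T \<Otimes>\<^sub>M M). ?d (fst q) (snd q))"
    using TM.integral_snd[OF id'] by (simp add: split_beta')
  also have "\<dots> \<le> (LINT q|(T \<Otimes>\<^sub>M M). \<bar>f (Y (fst q) (snd q)) - \<phi> (Y (fst q) (snd q))\<bar> + e)"
  proof (rule integral_mono)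
    show "integrable (T \<Otimes>\<^sub>M M) (\<lambda>q. ?d (fst q) (snd q))" using id' by (simp add: split_beta')
    show "integrable (T \<Otimes>\<^sub>M M) (\<lambda>q. \<bar>f (Y (fst q) (snd q)) - \<phi> (Y (fst q) (snd q))\<bar> + e)"
      using occupation_integrable(1)[OF T M Y occ(1) Bochner_Integration.integrable_diff[OF f \<phi>] occ(2)]
      by (intro Bochner_Integration.integrable_add integrable_abs P.integrable_const) (simp add: split_beta')
    show "?d (fst q) (snd q) \<le> \<bar>f (Y (fst q) (snd q)) - \<phi> (Y (fst q) (snd q))\<bar> + e" for q
      using close[of "Y (fst q) (snd q)"] by linarith
  qed
  also have "\<dots> = (LINT q|(T \<Otimes>\<^sub>M M). \<bar>f (Y (fst q) (snd q)) - \<phi> (Y (fst q) (snd q))\<bar>)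
      + e * measure T (space T)"
  proof -
    have "measure (T \<Otimes>\<^sub>M M) (space (T \<Otimes>\<^sub>M M)) = measure T (space T)"
      by (simp add: measure_def space_pair_measure M.emeasure_pair_measure_Times M.emeasure_space_1)
    then show ?thesis
      using occupation_integrable(1)[OF T M Y occ(1) Bochner_Integration.integrable_diff[OF f \<phi>] occ(2)]
      by (subst Bochner_Integration.integral_add) (auto simp: split_beta' mult.commute)
  qed
  also have "\<dots> \<le> A * (LINT x|lborel. \<bar>f x - \<phi> x\<bar>) + e * measure T (space T)"
    using occupation_integrable(2)[OF T M Y occ(1) Bochner_Integration.integrable_diff[OF f \<phi>] occ(2)] by simp
  finally show ?thesis .
qed

text \<open>A three-term estimate: the same \<open>u\<close> replaces \<open>f\<close> for all large
  \<open>n\<close> and in the limit, with an error independent of \<open>n\<close>, and for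
  \<open>u\<close> the convergence is known. The occupation bound for \<open>Y n\<close> is
  eventual, because the variances of rescaled increments are controlled at small scales
  only.\<close>

theorem time_integral_iexp_tendsto:
  fixes Y :: "nat \<Rightarrow> 's \<Rightarrow> 'a \<Rightarrow> real" and Y' :: "'s \<Rightarrow> 'b \<Rightarrow> real"
  assumes T: "finite_measure T" and M: "prob_space M" and N: "prob_space N"
    and Y: "\<And>n. (\<lambda>(s, \<omega>). Y n s \<omega>) \<in> borel_measurable (T \<Otimes>\<^sub>M M)"
    and Y': "(\<lambda>(s, \<omega>). Y' s \<omega>) \<in> borel_measurable (T \<Otimes>\<^sub>M N)"
    and fdd: "\<And>k (s :: nat \<Rightarrow> 's) \<theta>. (\<And>i. i < k \<Longrightarrow> s i \<in> space T) \<Longrightarrow>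
      (\<lambda>n. CLINT \<omega>|M. iexp (\<Sum>i<k. \<theta> i * Y n (s i) \<omega>)) \<longlonglongrightarrow> (CLINT \<omega>|N. iexp (\<Sum>i<k. \<theta> i * Y' (s i) \<omega>))"
    and "A \<ge> 0"
    and occ: "eventually (\<lambda>n. \<forall>h\<in>borel_measurable borel.
      (\<integral>\<^sup>+s. \<integral>\<^sup>+\<omega>. h (Y n s \<omega>) \<partial>M \<partial>T) \<le> ennreal A * (\<integral>\<^sup>+x. h x \<partial>lborel)) sequentially"
    and occ': "\<And>h. h \<in> borel_measurable borel \<Longrightarrow>
      (\<integral>\<^sup>+s. \<integral>\<^sup>+\<omega>. h (Y' s \<omega>) \<partial>N \<partial>T) \<le> ennreal A * (\<integral>\<^sup>+x. h x \<partial>lborel)"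
    and f: "integrable lborel f"
  shows "(\<lambda>n. CLINT \<omega>|M. iexp (LINT s|T. f (Y n s \<omega>))) \<longlonglongrightarrow> (CLINT \<omega>|N. iexp (LINT s|T. f (Y' s \<omega>)))"
proof (rule tendstoI)
  fix \<epsilon> :: real assume "\<epsilon> > 0"
  \<comment> \<open>\<open>a\<close> and \<open>b\<close> exceed \<open>A\<close> and the total time
    by 1 so that they may serve as divisors. The L1 error and the uniform error contribute
    \<open>\<epsilon> / 6\<close> each, hence \<open>\<epsilon> / 3\<close> on either side.\<close>
  define a where "a = A + 1"
  define b where "b = measure T (space T) + 1"
  have "a > 0" "b > 0" using \<open>A \<ge> 0\<close> by (auto simp: a_def b_def add_nonneg_pos)
  obtain \<phi> R where \<phi>: "continuous_on UNIV \<phi>" "\<And>x. \<bar>x\<bar> > R \<Longrightarrow> \<phi> x = 0" "integrable lborel \<phi>"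
    "(LINT x|lborel. \<bar>f x - \<phi> x\<bar>) < \<epsilon> / (6 * a)"
    using L1_continuous_approx[OF f, of "\<epsilon> / (6 * a)"] \<open>\<epsilon> > 0\<close> \<open>a > 0\<close> by auto
  obtain m u where u: "fourier_mixture m u" "\<And>x. \<bar>\<phi> x - u x\<bar> \<le> \<epsilon> / (6 * b)"
    using uniform_fourier_mixture_approx[of \<phi> R "\<epsilon> / (6 * b)"] \<phi>(1,2) \<open>\<epsilon> > 0\<close> \<open>b > 0\<close> by auto
  have "A * (LINT x|lborel. \<bar>f x - \<phi> x\<bar>) \<le> a * (\<epsilon> / (6 * a))"
    using \<phi>(4) \<open>a > 0\<close> \<open>A \<ge> 0\<close> by (intro mult_mono) (auto simp: a_def)
  moreover have "\<epsilon> / (6 * b) * measure T (space T) \<le> \<epsilon> / (6 * b) * b"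
    using \<open>\<epsilon> > 0\<close> \<open>b > 0\<close> by (intro mult_left_mono) (auto simp: b_def)
  ultimately have err: "A * (LINT x|lborel. \<bar>f x - \<phi> x\<bar>) + \<epsilon> / (6 * b) * measure T (space T) \<le> \<epsilon> / 3"
    using \<open>a > 0\<close> \<open>b > 0\<close> by simp
  note ub = fourier_mixture_measurable[OF u(1)] fourier_mixture_bounded[OF u(1)]
  have "eventually (\<lambda>n. dist (CLINT \<omega>|M. iexp (LINT s|T. u (Y n s \<omega>))) (CLINT \<omega>|N. iexp (LINT s|T. u (Y' s \<omega>))) < \<epsilon> / 3) sequentially"
    using \<open>\<epsilon> > 0\<close> by (intro tendstoD[OF mixture_time_integral_iexp_tendsto[OF T M N Y Y' fdd u(1)]]) auto
  with occ show "eventually (\<lambda>n. dist (CLINT \<omega>|M. iexp (LINT s|T. f (Y n s \<omega>)))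
      (CLINT \<omega>|N. iexp (LINT s|T. f (Y' s \<omega>))) < \<epsilon>) sequentially"
  proof eventually_elim
    case (elim n)
    have 1: "dist (CLINT \<omega>|M. iexp (LINT s|T. f (Y n s \<omega>))) (CLINT \<omega>|M. iexp (LINT s|T. u (Y n s \<omega>))) \<le> \<epsilon> / 3"
      unfolding dist_norm using elim(1)
      by (intro order_trans[OF time_integral_iexp_error[OF T M Y _ \<open>A \<ge> 0\<close> f \<phi>(3) ub u(2)] err]) auto
    have 2: "dist (CLINT \<omega>|N. iexp (LINT s|T. f (Y' s \<omega>))) (CLINT \<omega>|N. iexp (LINT s|T. u (Y' s \<omega>))) \<le> \<epsilon> / 3"
      unfolding dist_norm
      by (intro order_trans[OF time_integral_iexp_error[OF T N Y' occ' \<open>A \<ge> 0\<close> f \<phi>(3) ub u(2)] err])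
    have tri: "dist p q \<le> dist p p' + dist p' q' + dist q q'" for p p' q q' :: complex
      by (metis dist_commute dist_triangle_le add_right_mono dist_triangle order_trans)
    show ?case
      by (rule le_less_trans[OF tri[where p'="CLINT \<omega>|M. iexp (LINT s|T. u (Y n s \<omega>))"
          and q'="CLINT \<omega>|N. iexp (LINT s|T. u (Y' s \<omega>))"]]) (use 1 2 elim(2) in linarith)
  qed
qed

section \<open>Kernels that are self-similar up to a perturbation\<close>

lemma square_integrable_cmult:
  fixes f :: "'a \<Rightarrow> real"
  shows "square_integrable M f \<Longrightarrow> square_integrable M (\<lambda>x. c * f x)"
  by (rule square_integrable_bounded_linear[OF _ bounded_linear_mult_right])

lemma square_integrable_sum:
  fixes f :: "'i \<Rightarrow> 'a \<Rightarrow> real"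
  assumes "\<And>i. i \<in> I \<Longrightarrow> square_integrable M (f i)"
  shows "square_integrable M (\<lambda>x. \<Sum>i\<in>I. c i * f i x)"
  using assms
proof (induction I rule: infinite_finite_induct)
  case (insert i I)
  then show ?case by (simp add: square_integrable_add square_integrable_cmult)
qed (auto simp: square_integrable_def)

lemma square_integrable_affine:
  fixes f :: "real \<Rightarrow> real"
  assumes "square_integrable lborel f" "r > 0"
  shows "square_integrable lborel (\<lambda>u. f ((u - a) / r))"
    and "(LINT u|lborel. (f ((u - a) / r))\<^sup>2) = r * (LINT u|lborel. (f u)\<^sup>2)"
proof -
  have [measurable]: "f \<in> borel_measurable borel" using assms by (auto simp: square_integrable_def)
  have int: "integrable lborel (\<lambda>u. (f u)\<^sup>2)" using assms by (auto simp: square_integrable_def)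
  have eq: "(u - a) / r = - a / r + (1 / r) * u" for u using assms by (simp add: field_simps)
  have "integrable lborel (\<lambda>u. (f (- a / r + (1 / r) * u))\<^sup>2)"
    using lborel_integrable_real_affine[OF int, of "1 / r" "- a / r"] assms by simp
  then show "square_integrable lborel (\<lambda>u. f ((u - a) / r))"
    by (simp add: square_integrable_def eq)
  show "(LINT u|lborel. (f ((u - a) / r))\<^sup>2) = r * (LINT u|lborel. (f u)\<^sup>2)"
    unfolding eq
    using lborel_integral_real_affine[of "1 / r" "\<lambda>u. (f u)\<^sup>2" "- a / r"] assms by simp
qed

lemma integral_sq_add_le:
  fixes f g :: "'a \<Rightarrow> real"
  assumes "square_integrable M f" "square_integrable M g"
  shows "(LINT x|M. (f x + g x)\<^sup>2) \<le> 2 * (LINT x|M. (f x)\<^sup>2) + 2 * (LINT x|M. (g x)\<^sup>2)"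
proof -
  have int: "integrable M (\<lambda>x. (f x)\<^sup>2)" "integrable M (\<lambda>x. (g x)\<^sup>2)" "integrable M (\<lambda>x. (f x + g x)\<^sup>2)"
    using assms square_integrable_add[OF assms] by (auto simp: square_integrable_def)
  have "(LINT x|M. (f x + g x)\<^sup>2) \<le> (LINT x|M. 2 * (f x)\<^sup>2 + 2 * (g x)\<^sup>2)"
    using int norm_add_sq_le[of "f _" "g _"] by (intro integral_mono) auto
  then show ?thesis using int by simp
qed

lemma integral_square_cong_AE:
  fixes f g :: "'a \<Rightarrow> real"
  assumes "square_integrable M f" "square_integrable M g" "AE x in M. f x = g x"
  shows "(LINT x|M. (f x)\<^sup>2) = (LINT x|M. (g x)\<^sup>2)"
proof (rule Bochner_Integration.integral_cong_AE)
  show "(\<lambda>x. (f x)\<^sup>2) \<in> borel_measurable M" "(\<lambda>x. (g x)\<^sup>2) \<in> borel_measurable M"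
    using assms(1,2) by (auto simp: square_integrable_def)
  show "AE x in M. (f x)\<^sup>2 = (g x)\<^sup>2" using assms(3) by eventually_elim simp
qed

lemma powr_square: "(x powr a)\<^sup>2 = x powr (2 * a)" for x :: real
  by (simp add: power2_eq_square powr_add[symmetric])

text \<open>What the two representations have in common. \<open>scaling\<close> holds almost
  everywhere, because an L2 Fourier transform is determined only up to null sets. At
  \<open>v = 0\<close> the condition \<open>near_t0\<close> says that \<open>\<kappa> t0\<close> and
  \<open>k t0\<close> agree almost everywhere, since \<open>0 powr \<beta> = 0\<close>.\<close>

locale self_similar_kernels =
  fixes M :: "'a measure" and N :: "'b measure" and W B :: "real \<Rightarrow> 'a \<Rightarrow> real"
    and V X :: "real \<Rightarrow> 'b \<Rightarrow> real" and \<kappa> k :: "real \<Rightarrow> real \<Rightarrow> real" and h \<beta> t0 :: real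
  assumes W: "two_sided_brownian_motion M W" and V: "two_sided_brownian_motion N V"
    and B: "\<And>t. t \<ge> 0 \<Longrightarrow> has_wiener_integral M W (\<kappa> t) (B t)"
    and X: "\<And>t. t \<ge> 0 \<Longrightarrow> has_wiener_integral N V (k t) (X t)"
    and meas_B: "(\<lambda>(t, \<omega>). B t \<omega>) \<in> borel_measurable (restrict_space borel {0..} \<Otimes>\<^sub>M M)"
    and meas_X: "(\<lambda>(t, \<omega>). X t \<omega>) \<in> borel_measurable (restrict_space borel {0..} \<Otimes>\<^sub>M N)"
    and scaling: "\<And>t r s. t \<ge> 0 \<Longrightarrow> r > 0 \<Longrightarrow> s \<ge> 0 \<Longrightarrow>
      AE u in lborel. k (r * s + t) u - k t u = r powr (h - 1/2) * k s ((u - t) / r)"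
    and near_t0: "\<exists>C v0. v0 > 0 \<and> (\<forall>v\<in>{0..v0}. (LINT u|lborel. (\<kappa> (v + t0) u - k (v + t0) u)\<^sup>2) \<le> (C * v powr \<beta>)\<^sup>2)"
    and h: "0 < h" "h < 1" "h < \<beta>" and t0: "t0 \<ge> 0"
    and local_time: "\<exists>l. jointly_continuous_local_time N X l"
begin

sublocale M: prob_space M by (rule two_sided_brownian_motionD(1)[OF W])
sublocale N: prob_space N by (rule two_sided_brownian_motionD(1)[OF V])

text \<open>The kernel of the rescaled increment \<open>Y r s\<close> is \<open>z r s + e r s\<close>: the main term \<open>z r s\<close> is an
  isometric image of \<open>k s\<close>, and the error \<open>e r s\<close> is negligible because \<open>h < \<beta>\<close>.\<close>

definition Y :: "real \<Rightarrow> real \<Rightarrow> 'a \<Rightarrow> real" where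
  "Y r s \<omega> = (B (r * s + t0) \<omega> - B t0 \<omega>) / r powr h"

definition z :: "real \<Rightarrow> real \<Rightarrow> real \<Rightarrow> real" where
  "z r s u = r powr (- h) * (k (r * s + t0) u - k t0 u)"

definition e :: "real \<Rightarrow> real \<Rightarrow> real \<Rightarrow> real" where
  "e r s u = r powr (- h) * ((\<kappa> (r * s + t0) u - k (r * s + t0) u) - (\<kappa> t0 u - k t0 u))"

definition v where "v = (LINT u|lborel. (k 1 u)\<^sup>2)"

section \<open>Variances of the rescaled increments\<close>

lemma sq_int: "t \<ge> 0 \<Longrightarrow> square_integrable lborel (\<kappa> t)" "t \<ge> 0 \<Longrightarrow> square_integrable lborel (k t)"
  using B X by (auto simp: has_wiener_integral_def)

lemma sq_int_z: "r > 0 \<Longrightarrow> s \<ge> 0 \<Longrightarrow> square_integrable lborel (z r s)"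
  unfolding z_def using t0 by (intro square_integrable_cmult square_integrable_diff sq_int) auto

lemma sq_int_e: "r > 0 \<Longrightarrow> s \<ge> 0 \<Longrightarrow> square_integrable lborel (e r s)"
  unfolding e_def using t0 by (intro square_integrable_cmult square_integrable_diff sq_int) auto

lemma wiener_Y:
  assumes "r > 0" "s \<ge> 0"
  shows "has_wiener_integral M W (\<lambda>u. z r s u + e r s u) (Y r s)"
proof -
  have rs: "r * s + t0 \<ge> 0" using assms t0 by simp
  have "has_wiener_integral M W (\<lambda>u. - \<kappa> t0 u) (\<lambda>\<omega>. - B t0 \<omega>)"
    by (rule has_wiener_integral_bounded_linear[OF W B[OF t0] bounded_linear_minus[OF bounded_linear_ident]])
  from has_wiener_integral_bounded_linear[OF W has_wiener_integral_add[OF W B[OF rs] this]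
      bounded_linear_mult_right[of "r powr (- h)"]]
  show ?thesis
    by (simp add: z_def e_def Y_def[abs_def] algebra_simps powr_minus divide_inverse)
qed

text \<open>For \<open>r = 1\<close> and \<open>s = t = 0\<close> the left side of
  \<open>scaling\<close> vanishes identically.\<close>

lemma k_zero: "AE u in lborel. k 0 u = 0"
  using scaling[of 0 1 0] by simp

lemma z_scaled:
  assumes "r > 0" "s \<ge> 0"
  shows "AE u in lborel. z r s u = r powr (- (1/2)) * k s ((u - t0) / r)"
  using scaling[OF t0 assms]
proof eventually_elim
  case (elim u)
  have "r powr (- h) * r powr (h - 1/2) = r powr (- (1/2))" by (simp add: powr_add[symmetric])
  with elim show ?case by (simp add: z_def mult.assoc[symmetric])
qed

text \<open>The factor \<open>r powr (- (1/2))\<close> makes the dilation an isometry, and all the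
  \<open>s i\<close> share the same affine change of variable. So the covariances of the main terms
  equal those of \<open>X\<close> for every \<open>r\<close>, not merely in the limit.\<close>

lemma variance_lincomb_z:
  assumes "r > 0" and s: "\<And>i. i \<in> I \<Longrightarrow> s i \<ge> 0" and "finite I"
  shows "(LINT u|lborel. (\<Sum>i\<in>I. \<theta> i * z r (s i) u)\<^sup>2) = (LINT u|lborel. (\<Sum>i\<in>I. \<theta> i * k (s i) u)\<^sup>2)"
proof -
  let ?K = "\<lambda>u. \<Sum>i\<in>I. \<theta> i * k (s i) u"
  have sqK: "square_integrable lborel ?K" using s by (intro square_integrable_sum sq_int) auto
  have sqz: "square_integrable lborel (\<lambda>u. \<Sum>i\<in>I. \<theta> i * z r (s i) u)"
    using s assms by (intro square_integrable_sum sq_int_z) auto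
  have sqa: "square_integrable lborel (\<lambda>u. r powr (- (1/2)) * ?K ((u - t0) / r))"
    by (rule square_integrable_cmult[OF square_integrable_affine(1)[OF sqK \<open>r > 0\<close>]])
  have "AE u in lborel. z r (s i) u = r powr (- (1/2)) * k (s i) ((u - t0) / r)" if "i \<in> I" for i
    by (rule z_scaled[OF \<open>r > 0\<close> s[OF that]])
  then have "AE u in lborel. \<forall>i\<in>I. z r (s i) u = r powr (- (1/2)) * k (s i) ((u - t0) / r)"
    using \<open>finite I\<close> by (simp add: AE_finite_all)
  then have "AE u in lborel. (\<Sum>i\<in>I. \<theta> i * z r (s i) u) = r powr (- (1/2)) * ?K ((u - t0) / r)"
  proof eventually_elim
    case (elim u)
    then have "(\<Sum>i\<in>I. \<theta> i * z r (s i) u) = (\<Sum>i\<in>I. \<theta> i * (r powr (- (1/2)) * k (s i) ((u - t0) / r)))"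
      by (intro sum.cong) auto
    then show ?case by (simp add: sum_distrib_left mult.left_commute)
  qed
  then have "(LINT u|lborel. (\<Sum>i\<in>I. \<theta> i * z r (s i) u)\<^sup>2) = (LINT u|lborel. (r powr (- (1/2)) * ?K ((u - t0) / r))\<^sup>2)"
    by (rule integral_square_cong_AE[OF sqz sqa])
  also have "\<dots> = (r powr (- (1/2)))\<^sup>2 * (r * (LINT u|lborel. (?K u)\<^sup>2))"
    unfolding power_mult_distrib by (subst integral_mult_right_zero) (simp only: square_integrable_affine(2)[OF sqK \<open>r > 0\<close>])
  also have "(r powr (- (1/2)))\<^sup>2 = inverse r"
    unfolding powr_square using \<open>r > 0\<close> by (simp add: powr_minus)
  finally show ?thesis using \<open>r > 0\<close> by simp
qed

lemma variance_k:
  assumes "s \<ge> 0"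
  shows "(LINT u|lborel. (k s u)\<^sup>2) = s powr (2 * h) * v"
proof (cases "s = 0")
  case True
  have "AE u in lborel. (k 0 u)\<^sup>2 = 0" using k_zero by eventually_elim simp
  then have "(LINT u|lborel. (k 0 u)\<^sup>2) = 0" by (rule integral_eq_zero_AE)
  then show ?thesis using True by simp
next
  case False
  then have s: "s > 0" using assms by simp
  have "AE u in lborel. k s u = s powr (h - 1/2) * k 1 ((u - 0) / s)"
    using scaling[OF order_refl s zero_le_one] k_zero by eventually_elim simp
  then have "(LINT u|lborel. (k s u)\<^sup>2) = (LINT u|lborel. (s powr (h - 1/2) * k 1 ((u - 0) / s))\<^sup>2)"
    by (rule integral_square_cong_AE[OF sq_int(2)[OF assms]
          square_integrable_cmult[OF square_integrable_affine(1)[OF sq_int(2)[OF zero_le_one] s]]])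
  also have "\<dots> = (s powr (h - 1/2))\<^sup>2 * (s * v)"
    unfolding power_mult_distrib v_def
    by (subst integral_mult_right_zero) (simp only: square_integrable_affine(2)[OF sq_int(2)[OF zero_le_one] s])
  also have "(s powr (h - 1/2))\<^sup>2 * (s * v) = s powr (2 * h - 1) * s powr 1 * v"
    using s by (simp add: powr_square right_diff_distrib)
  also have "s powr (2 * h - 1) * s powr 1 = s powr (2 * h)" unfolding powr_add[symmetric] by simp
  finally show ?thesis .
qed

text \<open>The bound \<open>(r * s) powr (2 * \<beta>)\<close> divided by
  \<open>r powr (2 * h)\<close> is rearranged so that the main variance factor
  \<open>s powr (2 * h)\<close> splits off. What remains is small uniformly in small
  \<open>r * s\<close>, also for \<open>s\<close> near 0.\<close>

lemma variance_e:
  obtains C v0 where "v0 > 0" "C > 0"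
    "\<And>r s. r > 0 \<Longrightarrow> s \<ge> 0 \<Longrightarrow> r * s \<le> v0 \<Longrightarrow> (LINT u|lborel. (e r s u)\<^sup>2) \<le> C * s powr (2 * h) * (r * s) powr (2 * (\<beta> - h))"
proof -
  obtain C v0 where C: "v0 > 0"
    "\<And>v. v \<in> {0..v0} \<Longrightarrow> (LINT u|lborel. (\<kappa> (v + t0) u - k (v + t0) u)\<^sup>2) \<le> (C * v powr \<beta>)\<^sup>2"
    using near_t0 by blast
  \<comment> \<open>The 1 keeps the constant positive when \<open>C = 0\<close>.\<close>
  show thesis
  proof (rule that[of v0 "2 * C\<^sup>2 + 1"])
    fix r s :: real assume r: "r > 0" and s: "s \<ge> 0" and rs: "r * s \<le> v0"
    let ?d = "\<lambda>t u. \<kappa> t u - k t u"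
    have sqd: "square_integrable lborel (?d t)" if "t \<ge> 0" for t using that by (intro square_integrable_diff sq_int)
    have nn: "r * s + t0 \<ge> 0" using r s t0 by simp
    \<comment> \<open>The case \<open>v = 0\<close> of \<open>near_t0\<close>: at \<open>t0\<close>
      itself the two kernels agree.\<close>
    have z0: "(LINT u|lborel. (?d t0 u)\<^sup>2) = 0"
      using C(2)[of 0] \<open>v0 > 0\<close> by (simp add: integral_nonneg_AE antisym)
    have eq: "?d (r * s + t0) u + (- 1) * ?d t0 u = ?d (r * s + t0) u - ?d t0 u" for u
      by (simp only: mult_minus1 add_uminus_conv_diff)
    have "(LINT u|lborel. (?d (r * s + t0) u + (- 1) * ?d t0 u)\<^sup>2)
        \<le> 2 * (LINT u|lborel. (?d (r * s + t0) u)\<^sup>2) + 2 * (LINT u|lborel. ((- 1) * ?d t0 u)\<^sup>2)"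
      by (intro integral_sq_add_le sqd square_integrable_cmult nn t0)
    also have "(LINT u|lborel. ((- 1) * ?d t0 u)\<^sup>2) = 0" using z0 by (simp add: power2_commute)
    also have "2 * (LINT u|lborel. (?d (r * s + t0) u)\<^sup>2) + 2 * 0 \<le> 2 * (C * (r * s) powr \<beta>)\<^sup>2"
      using C(2)[of "r * s"] r s rs by simp
    finally have le: "(LINT u|lborel. (?d (r * s + t0) u - ?d t0 u)\<^sup>2) \<le> 2 * (C * (r * s) powr \<beta>)\<^sup>2" unfolding eq .
    have "(LINT u|lborel. (e r s u)\<^sup>2) = (r powr (- h))\<^sup>2 * (LINT u|lborel. (?d (r * s + t0) u - ?d t0 u)\<^sup>2)"
      unfolding e_def power_mult_distrib by (rule integral_mult_right_zero)
    also have "\<dots> \<le> (r powr (- h))\<^sup>2 * (2 * (C * (r * s) powr \<beta>)\<^sup>2)" using le by (rule mult_left_mono) simp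
    also have "\<dots> = (2 * C\<^sup>2) * (r powr (- (2 * h)) * (r * s) powr (2 * \<beta>))"
      by (simp add: power_mult_distrib powr_square)
    also have "r powr (- (2 * h)) * (r * s) powr (2 * \<beta>) = s powr (2 * h) * (r * s) powr (2 * (\<beta> - h))"
    proof (cases "s = 0")
      case False
      then have "s > 0" using s by simp
      have "(r * s) powr (2 * \<beta>) = (r * s) powr (2 * h) * (r * s) powr (2 * (\<beta> - h))"
        by (simp add: powr_add[symmetric])
      also have "(r * s) powr (2 * h) = r powr (2 * h) * s powr (2 * h)" using r s by (simp add: powr_mult)
      finally show ?thesis using r by (simp add: powr_minus field_simps)
    qed simp
    also have "(2 * C\<^sup>2) * (s powr (2 * h) * (r * s) powr (2 * (\<beta> - h))) \<le> (2 * C\<^sup>2 + 1) * (s powr (2 * h) * (r * s) powr (2 * (\<beta> - h)))"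
      by (rule mult_right_mono) auto
    finally show "(LINT u|lborel. (e r s u)\<^sup>2) \<le> (2 * C\<^sup>2 + 1) * s powr (2 * h) * (r * s) powr (2 * (\<beta> - h))"
      by (simp add: mult.assoc)
  qed (use C in \<open>auto simp: add_nonneg_pos\<close>)
qed

lemma variance_e_tendsto:
  assumes r: "\<And>n. r n > 0" "r \<longlonglongrightarrow> 0" and s: "s \<ge> 0"
  shows "(\<lambda>n. LINT u|lborel. (e (r n) s u)\<^sup>2) \<longlonglongrightarrow> 0"
proof -
  obtain C v0 where C: "v0 > 0" "C > 0"
    "\<And>r s. r > 0 \<Longrightarrow> s \<ge> 0 \<Longrightarrow> r * s \<le> v0 \<Longrightarrow> (LINT u|lborel. (e r s u)\<^sup>2) \<le> C * s powr (2 * h) * (r * s) powr (2 * (\<beta> - h))"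
    by (rule variance_e) blast
  have rs: "(\<lambda>n. r n * s) \<longlonglongrightarrow> 0" using tendsto_mult_left_zero[OF r(2)] by simp
  have "(\<lambda>n. C * s powr (2 * h) * (r n * s) powr (2 * (\<beta> - h))) \<longlonglongrightarrow> C * s powr (2 * h) * 0"
    using h rs r(1) s
    by (intro tendsto_mult_left tendsto_zero_powrI[where b="2 * (\<beta> - h)"] always_eventually allI mult_nonneg_nonneg)
       (auto simp: less_imp_le)
  then have lim: "(\<lambda>n. C * s powr (2 * h) * (r n * s) powr (2 * (\<beta> - h))) \<longlonglongrightarrow> 0" by simp
  have "eventually (\<lambda>n. r n * s < v0) sequentially" by (rule order_tendstoD(2)[OF rs C(1)])
  then have "eventually (\<lambda>n. (LINT u|lborel. (e (r n) s u)\<^sup>2) \<le> C * s powr (2 * h) * (r n * s) powr (2 * (\<beta> - h))) sequentially"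
    by eventually_elim (intro C(3) r(1) s, simp)
  then show ?thesis
    by (intro tendsto_sandwich[OF _ _ tendsto_const lim]) auto
qed

text \<open>Linear combinations are Gaussian on both sides, so only their variances matter: that of
  the main part is already the right one, and the error tends to 0.\<close>

lemma fdd_tendsto:
  fixes s \<theta> :: "nat \<Rightarrow> real"
  assumes r: "\<And>n. r n > 0" "r \<longlonglongrightarrow> 0" and s: "\<And>i. i < m \<Longrightarrow> s i \<ge> 0"
  shows "(\<lambda>n. CLINT \<omega>|M. iexp (\<Sum>i<m. \<theta> i * Y (r n) (s i) \<omega>)) \<longlonglongrightarrow> (CLINT \<omega>|N. iexp (\<Sum>i<m. \<theta> i * X (s i) \<omega>))"
proof -
  let ?z = "\<lambda>n u. \<Sum>i<m. \<theta> i * z (r n) (s i) u"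
  let ?e = "\<lambda>n u. \<Sum>i<m. \<theta> i * e (r n) (s i) u"
  let ?v = "LINT u|lborel. (\<Sum>i<m. \<theta> i * k (s i) u)\<^sup>2"
  have "has_wiener_integral M W (\<lambda>u. \<Sum>i<m. \<theta> i * (z (r n) (s i) u + e (r n) (s i) u)) (\<lambda>\<omega>. \<Sum>i<m. \<theta> i * Y (r n) (s i) \<omega>)" for n
    using r s by (intro has_wiener_integral_sum[OF W] wiener_Y) auto
  from wiener_integral_iexp[OF W this]
  have L: "(CLINT \<omega>|M. iexp (\<Sum>i<m. \<theta> i * Y (r n) (s i) \<omega>))
      = of_real (exp (- (LINT u|lborel. (?z n u + ?e n u)\<^sup>2) / 2))" for n
    by (simp add: ring_distribs sum.distrib)
  have "has_wiener_integral N V (\<lambda>u. \<Sum>i<m. \<theta> i * k (s i) u) (\<lambda>\<omega>. \<Sum>i<m. \<theta> i * X (s i) \<omega>)"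
    using s by (intro has_wiener_integral_sum[OF V] X) auto
  from wiener_integral_iexp[OF V this]
  have R: "(CLINT \<omega>|N. iexp (\<Sum>i<m. \<theta> i * X (s i) \<omega>)) = of_real (exp (- ?v / 2))" .
  have sqe: "square_integrable lborel (?e n)" for n using r s by (intro square_integrable_sum sq_int_e) auto
  have sqz: "square_integrable lborel (?z n)" for n using r s by (intro square_integrable_sum sq_int_z) auto
  have inte: "integrable lborel (\<lambda>u. (e (r n) (s i) u)\<^sup>2)" if "i < m" for n i
    using sq_int_e[OF r(1) s[OF that]] by (auto simp: square_integrable_def)
  have "(\<lambda>n. LINT u|lborel. (?e n u)\<^sup>2) \<longlonglongrightarrow> 0"
  proof (rule tendsto_sandwich[OF _ _ tendsto_const])
    \<comment> \<open>Cauchy-Schwarz for a finite sum reduces the combination to its single terms at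
      the cost of the factor \<open>m\<close>.\<close>
    show "eventually (\<lambda>n. (LINT u|lborel. (?e n u)\<^sup>2)
        \<le> (\<Sum>i<m. (\<theta> i)\<^sup>2 * (LINT u|lborel. (e (r n) (s i) u)\<^sup>2)) * m) sequentially"
    proof (intro always_eventually allI)
      fix n
      have "(LINT u|lborel. (?e n u)\<^sup>2) \<le> (LINT u|lborel. (\<Sum>i<m. (\<theta> i)\<^sup>2 * (e (r n) (s i) u)\<^sup>2) * m)"
      proof (intro integral_mono)
        show "(?e n u)\<^sup>2 \<le> (\<Sum>i<m. (\<theta> i)\<^sup>2 * (e (r n) (s i) u)\<^sup>2) * m" for u
          using sum_squared_le_sum_of_squares[of "\<lambda>i. \<theta> i * e (r n) (s i) u" "{..<m}"]
          by (simp add: power_mult_distrib)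
      qed (use sqe[of n] inte in \<open>auto simp: square_integrable_def\<close>)
      also have "\<dots> = (\<Sum>i<m. (\<theta> i)\<^sup>2 * (LINT u|lborel. (e (r n) (s i) u)\<^sup>2)) * m"
        using inte by simp
      finally show "(LINT u|lborel. (?e n u)\<^sup>2) \<le> (\<Sum>i<m. (\<theta> i)\<^sup>2 * (LINT u|lborel. (e (r n) (s i) u)\<^sup>2)) * m" .
    qed
    have "(\<lambda>n. (\<Sum>i<m. (\<theta> i)\<^sup>2 * (LINT u|lborel. (e (r n) (s i) u)\<^sup>2)) * m) \<longlonglongrightarrow> (\<Sum>i<m. (\<theta> i)\<^sup>2 * 0) * m"
      using s by (intro tendsto_intros variance_e_tendsto[OF r]) auto
    then show "(\<lambda>n. (\<Sum>i<m. (\<theta> i)\<^sup>2 * (LINT u|lborel. (e (r n) (s i) u)\<^sup>2)) * m) \<longlonglongrightarrow> 0" by simp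
  qed auto
  from integral_square_tendsto[where y'="?z" and e="?e" and v="?v", OF sqz sqe _ this]
  have "(\<lambda>n. LINT u|lborel. (?z n u + ?e n u)\<^sup>2) \<longlonglongrightarrow> ?v"
    using variance_lincomb_z[OF r(1), of "{..<m}" s] s by auto
  then show ?thesis unfolding L R by (intro tendsto_intros) auto
qed

section \<open>Measurability, non-degeneracy and occupation bounds\<close>

lemma measurable_Y:
  assumes "r > 0"
  shows "(\<lambda>(s, \<omega>). Y r s \<omega>) \<in> borel_measurable (restrict_space lborel {0..t} \<Otimes>\<^sub>M M)"
proof -
  let ?T = "restrict_space lborel {0..t}"
  have "(\<lambda>q. (r * fst q + t0, snd q)) \<in> measurable (?T \<Otimes>\<^sub>M M) (restrict_space borel {0..} \<Otimes>\<^sub>M M)"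
    using assms t0
    by (intro measurable_Pair measurable_restrict_space2 measurable_snd)
       (auto simp: space_pair_measure space_restrict_space intro!: borel_measurable_add borel_measurable_times measurable_compose[OF measurable_fst] measurable_restrict_space1)
  from measurable_compose[OF this meas_B]
  have 1 [measurable]: "(\<lambda>q. B (r * fst q + t0) (snd q)) \<in> borel_measurable (?T \<Otimes>\<^sub>M M)" by simp
  have [measurable]: "B t0 \<in> borel_measurable M" using B[OF t0] by (auto simp: has_wiener_integral_def)
  have "(\<lambda>q. (B (r * fst q + t0) (snd q) - B t0 (snd q)) / r powr h) \<in> borel_measurable (?T \<Otimes>\<^sub>M M)" by measurable
  then show ?thesis by (simp add: Y_def split_beta')
qed

lemma measurable_X: "(\<lambda>(s, \<omega>). X s \<omega>) \<in> borel_measurable (restrict_space lborel {0..t} \<Otimes>\<^sub>M N)"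
proof -
  let ?T = "restrict_space lborel {0..t}"
  have "(\<lambda>q. (fst q, snd q)) \<in> measurable (?T \<Otimes>\<^sub>M N) (restrict_space borel {0..} \<Otimes>\<^sub>M N)"
    by (intro measurable_Pair measurable_restrict_space2 measurable_snd)
       (auto simp: space_pair_measure space_restrict_space intro!: measurable_compose[OF measurable_fst] measurable_restrict_space1)
  from measurable_compose[OF this meas_X] show ?thesis by (simp add: split_beta')
qed

lemma finite_measure_restrict_interval: "finite_measure (restrict_space lborel {0..t::real})"
  by (intro finite_measureI) (simp add: emeasure_restrict_space space_restrict_space emeasure_lborel_Icc_eq)

text \<open>A degenerate \<open>X\<close> vanishes almost surely at all times, so its occupation measure has an atom
  at \<open>0\<close>, which a local time excludes.\<close>

lemma v_positive: "v > 0"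
proof (rule ccontr)
  assume "\<not> v > 0"
  moreover have "v \<ge> 0" unfolding v_def by (intro integral_nonneg_AE) auto
  ultimately have "v = 0" by simp
  let ?T = "restrict_space lborel {0..1::real}"
  interpret T: finite_measure ?T by (rule finite_measure_restrict_interval)
  interpret TN: pair_sigma_finite ?T N ..
  have X2 [measurable]: "(\<lambda>q. X (fst q) (snd q)) \<in> borel_measurable (?T \<Otimes>\<^sub>M N)"
    using measurable_X[of 1] by (simp add: split_beta')
  have "AE \<omega> in N. X s \<omega> = 0" if "s \<ge> 0" for s
    by (rule wiener_integral_zero_AE[OF V X[OF that]]) (simp add: variance_k[OF that] \<open>v = 0\<close>)
  then have "AE s in ?T. AE \<omega> in N. X s \<omega> = 0" by (rule AE_I2) (simp add: space_restrict_space)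
  \<comment> \<open>Fubini exchanges the quantifiers: vanishing almost surely at each time becomes
    vanishing at almost every time along almost every path.\<close>
  then have "AE \<omega> in N. AE s in ?T. X s \<omega> = 0"
    by (subst (asm) TN.AE_commute) (auto intro: measurable_sets_Collect)
  moreover obtain l where "jointly_continuous_local_time N X l" using local_time by blast
  ultimately have "AE \<omega> in N. False"
    unfolding jointly_continuous_local_time_def using AE_space
  proof eventually_elim
    case (elim \<omega>)
    have [measurable]: "(\<lambda>s. X s \<omega>) \<in> borel_measurable ?T" by (rule measurable_section[OF measurable_X]) (use elim in auto)
    have eq: "occupation_measure X {0..1} \<omega> = density lborel (\<lambda>x. ennreal (l 1 x \<omega>))" using elim by auto
    have "sets (occupation_measure X {0..1} \<omega>) = sets borel" by (simp add: occupation_measure_def)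
    have cont: "continuous_on ({0..} \<times> UNIV) (\<lambda>(t, x). l t x \<omega>)" using elim by auto
    have "continuous_on UNIV (\<lambda>x. l 1 x \<omega>)"
      using continuous_on_compose2[OF cont, of UNIV "\<lambda>x. (1, x)"]
      by (simp add: continuous_on_Pair continuous_on_const continuous_on_id image_subset_iff)
    then have [measurable]: "(\<lambda>x. l 1 x \<omega>) \<in> borel_measurable borel" by (rule borel_measurable_continuous_onI)
    have "emeasure (occupation_measure X {0..1} \<omega>) {0} = emeasure ?T {s \<in> space ?T. X s \<omega> = 0}"
      unfolding occupation_measure_def by (subst emeasure_distr) (auto intro!: arg_cong[where f="emeasure ?T"])
    also have "\<dots> = emeasure ?T (space ?T)"
    proof (rule emeasure_eq_AE)
      show "{s \<in> space ?T. X s \<omega> = 0} \<in> sets ?T" by measurable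
      show "AE s in ?T. (s \<in> {s \<in> space ?T. X s \<omega> = 0}) = (s \<in> space ?T)"
        using elim(1) by eventually_elim simp
    qed (rule sets.top)
    also have "\<dots> = 1" by (simp add: emeasure_restrict_space space_restrict_space)
    finally have one: "emeasure (occupation_measure X {0..1} \<omega>) {0} = 1" .
    have "emeasure (density lborel (\<lambda>x. ennreal (l 1 x \<omega>))) {0} = (\<integral>\<^sup>+x. ennreal (l 1 x \<omega>) * indicator {0} x \<partial>lborel)"
      by (rule emeasure_density) auto
    also have "\<dots> = 0" by (subst nn_integral_0_iff_AE) (auto intro!: AE_I[where N="{0}"] simp: indicator_def)
    finally show False using one unfolding eq by simp
  qed
  then show False by simp
qed

text \<open>A Gaussian density is at most the inverse of its standard deviation, and
  \<open>s powr (- h)\<close> is integrable at \<open>0\<close>.\<close>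

lemma occupation_bound:
  fixes Z :: "real \<Rightarrow> 'c \<Rightarrow> real"
  assumes P: "two_sided_brownian_motion P Q"
    and Z: "\<And>s. s \<ge> 0 \<Longrightarrow> has_wiener_integral P Q (\<zeta> s) (Z s)"
    and var: "\<And>s. s > 0 \<Longrightarrow> s \<le> t \<Longrightarrow> (LINT u|lborel. (\<zeta> s u)\<^sup>2) \<ge> s powr (2 * h) * v / 4"
    and [measurable]: "g \<in> borel_measurable borel" and "t \<ge> 0"
  shows "(\<integral>\<^sup>+s. \<integral>\<^sup>+\<omega>. g (Z s \<omega>) \<partial>P \<partial>restrict_space lborel {0..t})
    \<le> ennreal (2 / sqrt v * (t powr (1 - h) / (1 - h))) * (\<integral>\<^sup>+x. g x \<partial>lborel)"
proof -
  have "(\<integral>\<^sup>+s. \<integral>\<^sup>+\<omega>. g (Z s \<omega>) \<partial>P \<partial>restrict_space lborel {0..t})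
      \<le> (\<integral>\<^sup>+s. (\<integral>\<^sup>+\<omega>. g (Z s \<omega>) \<partial>P) * indicator {0..t} s \<partial>lborel)"
    by (subst nn_integral_restrict_space) auto
  also have "\<dots> \<le> (\<integral>\<^sup>+s. ennreal (2 / sqrt v * s powr (- h)) * indicator {0..t} s * (\<integral>\<^sup>+x. g x \<partial>lborel) \<partial>lborel)"
  proof (intro nn_integral_mono_AE)
    \<comment> \<open>At time 0 the variance is zero and no density exists; a single instant does
      not matter.\<close>
    have "AE s in lborel. s \<noteq> (0::real)" by (rule AE_lborel_singleton)
    then show "AE s in lborel. (\<integral>\<^sup>+\<omega>. g (Z s \<omega>) \<partial>P) * indicator {0..t} s
        \<le> ennreal (2 / sqrt v * s powr (- h)) * indicator {0..t} s * (\<integral>\<^sup>+x. g x \<partial>lborel)"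
    proof eventually_elim
      case (elim s)
      show ?case
      proof (cases "s \<in> {0..t}")
        case True
        then have s: "s > 0" "s \<le> t" using elim by auto
        have "(s powr h * sqrt v / 2)\<^sup>2 = s powr (2 * h) * v / 4"
          using s v_positive by (simp add: power_mult_distrib power_divide powr_square)
        with var[OF s] have "(LINT u|lborel. (\<zeta> s u)\<^sup>2) \<ge> (s powr h * sqrt v / 2)\<^sup>2" by simp
        from wiener_integral_nn_integral_le[OF P Z this] s v_positive
        have "(\<integral>\<^sup>+\<omega>. g (Z s \<omega>) \<partial>P) \<le> ennreal (1 / (s powr h * sqrt v / 2)) * (\<integral>\<^sup>+x. g x \<partial>lborel)" by simp
        also have "1 / (s powr h * sqrt v / 2) = 2 / sqrt v * s powr (- h)"
          by (simp add: powr_minus field_simps)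
        finally show ?thesis using True by simp
      qed simp
    qed
  qed
  also have "\<dots> = (\<integral>\<^sup>+s. ennreal (2 / sqrt v * s powr (- h)) * indicator {0..t} s \<partial>lborel) * (\<integral>\<^sup>+x. g x \<partial>lborel)"
    by (rule nn_integral_multc) simp
  also have "(\<integral>\<^sup>+s. ennreal (2 / sqrt v * s powr (- h)) * indicator {0..t} s \<partial>lborel)
      = ennreal (2 / sqrt v * (t powr (1 - h) / (1 - h)))"
  proof (rule nn_integral_has_integral_lebesgue')
    show "0 \<le> 2 / sqrt v * s powr (- h)" for s using v_positive by simp
    have "((\<lambda>s. s powr (- h)) has_integral (t powr (- h + 1) / (- h + 1))) {0..t}"
      using has_integral_powr_from_0[of "- h" t] h \<open>t \<ge> 0\<close> by simp
    then show "((\<lambda>s. 2 / sqrt v * s powr (- h)) has_integral (2 / sqrt v * (t powr (1 - h) / (1 - h)))) {0..t}"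
      by (intro has_integral_mult_right) (simp add: algebra_simps)
  qed
  finally show ?thesis .
qed

text \<open>From \<open>z = (z + e) - e\<close> the squared norm of \<open>z\<close> is at most
  twice that of \<open>z + e\<close> plus twice that of \<open>e\<close>. If the error has at most a
  quarter of the main variance, a quarter of the latter survives.\<close>

lemma variance_Y_ge:
  assumes "t \<ge> 0"
  obtains r0 where "r0 > 0" "\<And>r s. r > 0 \<Longrightarrow> r < r0 \<Longrightarrow> s > 0 \<Longrightarrow> s \<le> t \<Longrightarrow>
    (LINT u|lborel. (z r s u + e r s u)\<^sup>2) \<ge> s powr (2 * h) * v / 4"
proof -
  obtain C v0 where C: "v0 > 0" "C > 0"
    "\<And>r s. r > 0 \<Longrightarrow> s \<ge> 0 \<Longrightarrow> r * s \<le> v0 \<Longrightarrow> (LINT u|lborel. (e r s u)\<^sup>2) \<le> C * s powr (2 * h) * (r * s) powr (2 * (\<beta> - h))"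
    by (rule variance_e) blast
  \<comment> \<open>Chosen so that \<open>C * d powr (2 * (\<beta> - h)) \<le> v / 4\<close>.
    Dividing by \<open>t + 1\<close> below keeps \<open>r * s \<le> d\<close> up to time
    \<open>t\<close> and is safe for \<open>t = 0\<close>.\<close>
  define d where "d = min v0 ((v / (4 * C)) powr (1 / (2 * (\<beta> - h))))"
  have "d > 0" using C v_positive by (simp add: d_def)
  show thesis
  proof (rule that[of "d / (t + 1)"])
    show "d / (t + 1) > 0" using \<open>d > 0\<close> assms by simp
    fix r s :: real assume r: "r > 0" "r < d / (t + 1)" and s: "s > 0" "s \<le> t"
    have "r * s \<le> r * (t + 1)" using r s by (intro mult_left_mono) auto
    also have "\<dots> \<le> d" using r assms by (simp add: pos_less_divide_eq less_imp_le)
    finally have rs: "r * s \<le> d" .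
    have "(r * s) powr (2 * (\<beta> - h)) \<le> ((v / (4 * C)) powr (1 / (2 * (\<beta> - h)))) powr (2 * (\<beta> - h))"
      using rs r s h by (intro powr_mono2) (auto simp: d_def)
    also have "\<dots> = v / (4 * C)" using h v_positive C by (simp add: powr_powr)
    finally have "C * s powr (2 * h) * (r * s) powr (2 * (\<beta> - h)) \<le> C * s powr (2 * h) * (v / (4 * C))"
      using C by (intro mult_left_mono) auto
    moreover have "C * s powr (2 * h) * (v / (4 * C)) = s powr (2 * h) * v / 4" using C by simp
    moreover have "(LINT u|lborel. (e r s u)\<^sup>2) \<le> C * s powr (2 * h) * (r * s) powr (2 * (\<beta> - h))"
      using rs r s by (intro C(3)) (auto simp: d_def)
    ultimately have le: "(LINT u|lborel. (e r s u)\<^sup>2) \<le> s powr (2 * h) * v / 4" by linarith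
    have z: "(LINT u|lborel. (z r s u)\<^sup>2) = s powr (2 * h) * v"
      using variance_lincomb_z[of r "{()}" "\<lambda>_. s" "\<lambda>_. 1"] r s variance_k[of s] by simp
    have sq: "square_integrable lborel (z r s)" "square_integrable lborel (e r s)"
      using r s by (auto intro: sq_int_z sq_int_e)
    have "(LINT u|lborel. ((z r s u + e r s u) + (- 1) * e r s u)\<^sup>2)
        \<le> 2 * (LINT u|lborel. (z r s u + e r s u)\<^sup>2) + 2 * (LINT u|lborel. ((- 1) * e r s u)\<^sup>2)"
      by (intro integral_sq_add_le square_integrable_add square_integrable_cmult sq)
    then show "(LINT u|lborel. (z r s u + e r s u)\<^sup>2) \<ge> s powr (2 * h) * v / 4"
      using le z by simp
  qed
qed

theorem occupation_functional_iexp_tendsto: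
  assumes g: "integrable lborel g" and r: "\<And>n. r n > 0" "r \<longlonglongrightarrow> 0" and "t \<ge> 0"
  defines "T \<equiv> restrict_space lborel {0..t}"
  shows "(\<lambda>n. CLINT \<omega>|M. iexp (LINT s|T. g (Y (r n) s \<omega>))) \<longlonglongrightarrow> (CLINT \<omega>|N. iexp (LINT s|T. g (X s \<omega>)))"
  unfolding T_def
proof (rule time_integral_iexp_tendsto[OF finite_measure_restrict_interval M.prob_space_axioms N.prob_space_axioms measurable_Y[OF r(1)] measurable_X _ _ _ _ g])
  let ?A = "2 / sqrt v * (t powr (1 - h) / (1 - h))"
  show "0 \<le> ?A" using v_positive h by simp
  obtain r0 where r0: "r0 > 0" "\<And>r s. r > 0 \<Longrightarrow> r < r0 \<Longrightarrow> s > 0 \<Longrightarrow> s \<le> t \<Longrightarrow>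
    (LINT u|lborel. (z r s u + e r s u)\<^sup>2) \<ge> s powr (2 * h) * v / 4"
    by (rule variance_Y_ge[OF \<open>t \<ge> 0\<close>]) blast
  have "eventually (\<lambda>n. r n < r0) sequentially" by (rule order_tendstoD(2)[OF r(2) r0(1)])
  then show "eventually (\<lambda>n. \<forall>g\<in>borel_measurable borel.
      (\<integral>\<^sup>+s. \<integral>\<^sup>+\<omega>. g (Y (r n) s \<omega>) \<partial>M \<partial>restrict_space lborel {0..t}) \<le> ennreal ?A * (\<integral>\<^sup>+x. g x \<partial>lborel)) sequentially"
    by eventually_elim (intro ballI occupation_bound[OF W wiener_Y[OF r(1)] r0(2)[OF r(1)]] \<open>t \<ge> 0\<close>)
  have "s powr (2 * h) * v / 4 \<le> s powr (2 * h) * v" for s using v_positive by simp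
  then show "(\<integral>\<^sup>+s. \<integral>\<^sup>+\<omega>. g (X s \<omega>) \<partial>N \<partial>restrict_space lborel {0..t}) \<le> ennreal ?A * (\<integral>\<^sup>+x. g x \<partial>lborel)"
    if "g \<in> borel_measurable borel" for g
    using that by (intro occupation_bound[OF V X _ that \<open>t \<ge> 0\<close>]) (simp_all add: variance_k less_imp_le[OF v_positive])
  show "(\<lambda>n. CLINT \<omega>|M. iexp (\<Sum>i<m. \<theta> i * Y (r n) (s i) \<omega>)) \<longlonglongrightarrow> (CLINT \<omega>|N. iexp (\<Sum>i<m. \<theta> i * X (s i) \<omega>))"
    if "\<And>i. i < m \<Longrightarrow> s i \<in> space (restrict_space lborel {0..t})" for m \<theta> and s :: "nat \<Rightarrow> real"
    using that by (intro fdd_tendsto[OF r]) (auto simp: space_restrict_space)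
qed

end

section \<open>The moving average kernel\<close>

lemma power2_mono_abs:
  fixes x y :: real
  assumes "\<bar>x\<bar> \<le> y"
  shows "x\<^sup>2 \<le> y\<^sup>2"
  using power_mono[OF assms, of 2] by simp

lemma integrable_powr_from_0:
  assumes "p > -1" "b \<ge> 0"
  shows "integrable lborel (\<lambda>x::real. indicator {0..b} x * x powr p)"
proof (rule integrableI_nn_integral_finite)
  show "(\<integral>\<^sup>+x. ennreal (indicator {0..b} x * x powr p) \<partial>lborel) = ennreal (b powr (p + 1) / (p + 1))"
    by (rule nn_integral_has_integral_lebesgue[OF _ has_integral_powr_from_0[OF assms]]) simp
qed auto

lemma integrable_powr_to_inf:
  assumes "p < -1" "b > 0"
  shows "integrable lborel (\<lambda>x::real. indicator {b..} x * x powr p)"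
proof (rule integrableI_nn_integral_finite)
  show "(\<integral>\<^sup>+x. ennreal (indicator {b..} x * x powr p) \<partial>lborel) = ennreal (- (b powr (p + 1)) / (p + 1))"
    by (rule nn_integral_has_integral_lebesgue[OF _ has_integral_powr_to_inf[OF assms]]) simp
qed auto

lemma integrable_reflect:
  fixes f :: "real \<Rightarrow> real"
  assumes "integrable lborel f"
  shows "integrable lborel (\<lambda>u. f (t - u))" "(LINT u|lborel. f (t - u)) = (LINT u|lborel. f u)"
  using lborel_integrable_real_affine[OF assms, of "-1" t] lborel_integral_real_affine[of "-1" f t] by simp_all

text \<open>Convexity of the exponential trades a small change \<open>\<eta>\<close> of the exponent for a fixed loss \<open>\<delta>\<close>,
  which keeps logarithms out of all later estimates.\<close>

lemma powr_perturb:
  fixes x \<eta> \<delta> :: real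
  assumes "x > 0" "\<bar>\<eta>\<bar> \<le> \<delta>" "\<delta> > 0"
  shows "\<bar>x powr \<eta> - 1\<bar> \<le> \<bar>\<eta>\<bar> / \<delta> * (x powr \<delta> + x powr (- \<delta>))"
proof -
  define L where "L = ln x"
  define \<theta> where "\<theta> = \<bar>\<eta>\<bar> / \<delta>"
  have \<theta>: "0 \<le> \<theta>" "\<theta> \<le> 1" using assms by (auto simp: \<theta>_def)
  have conv: "exp (\<theta> * y) \<le> 1 - \<theta> + \<theta> * exp y" for y :: real
    using convex_onD[OF exp_convex \<theta>, of 0 y] by simp
  have abs: "\<bar>exp s - 1\<bar> \<le> exp \<bar>s\<bar> - 1" for s :: real
  proof (cases "s \<ge> 0")
    case False
    have "2 \<le> exp s + exp (- s)"
      using exp_ge_add_one_self[of s] exp_ge_add_one_self[of "- s"] by linarith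
    with False show ?thesis by simp
  qed simp
  have "\<bar>x powr \<eta> - 1\<bar> = \<bar>exp (\<eta> * L) - 1\<bar>" using assms by (simp add: powr_def L_def)
  also have "\<dots> \<le> exp \<bar>\<eta> * L\<bar> - 1" by (rule abs)
  also have "\<bar>\<eta> * L\<bar> = \<theta> * (\<delta> * \<bar>L\<bar>)" using assms by (simp add: \<theta>_def abs_mult)
  also have "exp (\<theta> * (\<delta> * \<bar>L\<bar>)) - 1 \<le> \<theta> * exp (\<delta> * \<bar>L\<bar>)"
    using conv[of "\<delta> * \<bar>L\<bar>"] \<theta> by linarith
  also have "\<dots> \<le> \<theta> * (exp (\<delta> * L) + exp (- \<delta> * L))"
  proof (rule mult_left_mono)
    show "exp (\<delta> * \<bar>L\<bar>) \<le> exp (\<delta> * L) + exp (- \<delta> * L)" by (cases "L \<ge> 0") auto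
  qed (rule \<theta>)
  also have "exp (\<delta> * L) + exp (- \<delta> * L) = x powr \<delta> + x powr (- \<delta>)"
    using assms by (simp add: powr_def L_def)
  finally show ?thesis by (simp add: \<theta>_def)
qed

text \<open>The truncated power. With it the kernels on the two intervals of the moving average
  merge into one formula, which scales without case distinctions.\<close>

definition pos_powr :: "real \<Rightarrow> real \<Rightarrow> real" where
  "pos_powr a x = (if x > 0 then x powr a else 0)"

lemma pos_powr_measurable [measurable]: "pos_powr a \<in> borel_measurable borel"
  unfolding pos_powr_def by measurable

lemma pos_powr_scale: "r > 0 \<Longrightarrow> pos_powr a (r * x) = r powr a * pos_powr a x"
  by (auto simp: pos_powr_def powr_mult zero_less_mult_iff)

lemma pos_powr_diff_le:
  assumes "\<bar>\<eta>\<bar> \<le> \<delta>" "\<delta> > 0"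
  shows "\<bar>pos_powr (a + \<eta>) x - pos_powr a x\<bar> \<le> \<bar>\<eta>\<bar> / \<delta> * (pos_powr (a + \<delta>) x + pos_powr (a - \<delta>) x)"
proof (cases "x > 0")
  case True
  have "x powr (a + \<eta>) - x powr a = x powr a * (x powr \<eta> - 1)" by (simp add: powr_add algebra_simps)
  then have "\<bar>pos_powr (a + \<eta>) x - pos_powr a x\<bar> = x powr a * \<bar>x powr \<eta> - 1\<bar>"
    using True by (simp add: pos_powr_def abs_mult)
  also have "\<dots> \<le> x powr a * (\<bar>\<eta>\<bar> / \<delta> * (x powr \<delta> + x powr (- \<delta>)))"
    by (intro mult_left_mono powr_perturb True assms) simp
  also have "\<dots> = \<bar>\<eta>\<bar> / \<delta> * (x powr (a + \<delta>) + x powr (a + - \<delta>))"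
    unfolding powr_add by (simp add: algebra_simps)
  finally show ?thesis using True by (simp add: pos_powr_def)
qed (simp add: pos_powr_def)

text \<open>The mean value theorem lowers the exponent by 1. For \<open>a = h - 1/2\<close> the
  power \<open>y powr (a + \<delta>)\<close> is not square integrable at infinity, but
  \<open>y powr (a + \<delta> - 1)\<close> is as soon as \<open>h + \<delta> < 1\<close>.\<close>

lemma powr_diff_increment_le:
  fixes y t a \<delta> \<eta> :: real
  assumes "\<bar>\<eta>\<bar> \<le> \<delta>" "\<delta> > 0" "\<bar>a\<bar> \<le> 1" "a + \<delta> \<le> 1" and y: "y \<ge> 1" and t: "t \<ge> 0"
  shows "\<bar>((y + t) powr (a + \<eta>) - (y + t) powr a) - (y powr (a + \<eta>) - y powr a)\<bar>
    \<le> \<bar>\<eta>\<bar> * (t * (2 / \<delta> + 1) * y powr (a + \<delta> - 1))"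
proof (cases "t = 0")
  case False
  then have "y < y + t" using t by (simp add: less_le)
  define \<psi> where "\<psi> x = x powr (a + \<eta>) - x powr a" for x :: real
  define \<psi>' where "\<psi>' x = (a + \<eta>) * x powr (a + \<eta> - 1) - a * x powr (a - 1)" for x :: real
  have "(\<psi> has_real_derivative \<psi>' x) (at x)" if "y \<le> x" "x \<le> y + t" for x
    unfolding \<psi>_def \<psi>'_def using that y by (auto intro!: derivative_eq_intros)
  from MVT2[OF \<open>y < y + t\<close> this] obtain c where
    c: "y < c" "c < y + t" "\<psi> (y + t) - \<psi> y = (y + t - y) * \<psi>' c" by blast
  have "c \<ge> 1" using c y by simp
  have "\<psi>' c = a * (c powr (a + \<eta> - 1) - c powr (a - 1)) + \<eta> * c powr (a + \<eta> - 1)"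
    by (simp add: \<psi>'_def algebra_simps)
  also have "\<bar>\<dots>\<bar> \<le> \<bar>a\<bar> * \<bar>c powr (a + \<eta> - 1) - c powr (a - 1)\<bar> + \<bar>\<eta>\<bar> * c powr (a + \<eta> - 1)"
    by (intro order_trans[OF abs_triangle_ineq]) (simp add: abs_mult)
  also have "\<dots> \<le> 1 * (\<bar>\<eta>\<bar> / \<delta> * (2 * c powr (a + \<delta> - 1))) + \<bar>\<eta>\<bar> * c powr (a + \<delta> - 1)"
  proof (intro add_mono mult_mono)
    have "\<bar>c powr (a + \<eta> - 1) - c powr (a - 1)\<bar>
        \<le> \<bar>\<eta>\<bar> / \<delta> * (c powr (a - 1 + \<delta>) + c powr (a - 1 - \<delta>))"
      using pos_powr_diff_le[OF assms(1,2), of "a - 1" c] \<open>c \<ge> 1\<close> by (simp add: pos_powr_def algebra_simps)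
    also have "\<dots> \<le> \<bar>\<eta>\<bar> / \<delta> * (2 * c powr (a + \<delta> - 1))"
    proof (rule mult_left_mono)
      have "c powr (a - 1 - \<delta>) \<le> c powr (a + \<delta> - 1)" using \<open>c \<ge> 1\<close> assms by (intro powr_mono) auto
      then show "c powr (a - 1 + \<delta>) + c powr (a - 1 - \<delta>) \<le> 2 * c powr (a + \<delta> - 1)"
        by (simp add: algebra_simps)
    qed (use assms in auto)
    finally show "\<bar>c powr (a + \<eta> - 1) - c powr (a - 1)\<bar> \<le> \<bar>\<eta>\<bar> / \<delta> * (2 * c powr (a + \<delta> - 1))" .
    show "c powr (a + \<eta> - 1) \<le> c powr (a + \<delta> - 1)" using \<open>c \<ge> 1\<close> assms by (intro powr_mono) auto
  qed (use assms in auto)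
  also have "\<dots> = \<bar>\<eta>\<bar> * (2 / \<delta> + 1) * c powr (a + \<delta> - 1)" by (simp add: algebra_simps)
  also have "\<dots> \<le> \<bar>\<eta>\<bar> * (2 / \<delta> + 1) * y powr (a + \<delta> - 1)"
    using c y assms by (intro mult_left_mono powr_mono2') auto
  finally have "t * \<bar>\<psi>' c\<bar> \<le> t * (\<bar>\<eta>\<bar> * (2 / \<delta> + 1) * y powr (a + \<delta> - 1))"
    using t by (rule mult_left_mono)
  moreover have "\<bar>\<psi> (y + t) - \<psi> y\<bar> = t * \<bar>\<psi>' c\<bar>" using c t by (simp add: abs_mult)
  ultimately show ?thesis by (simp add: \<psi>_def mult_ac)
qed simp

text \<open>The Mandelbrot-Van Ness kernel without its normalising constant.\<close>

definition ma_increment :: "real \<Rightarrow> real \<Rightarrow> real \<Rightarrow> real" where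
  "ma_increment a t u = pos_powr a (t - u) - pos_powr a (- u)"

lemma ma_increment_measurable [measurable]: "ma_increment a t \<in> borel_measurable borel"
  unfolding ma_increment_def by measurable

text \<open>The line is split at \<open>u = -1\<close>. To the left the increments of the two powers
  are compared by the mean value theorem; to the right each truncated power is compared separately,
  on a bounded range where only its singularity at 0 counts.\<close>

lemma ma_increment_perturb:
  assumes h: "0 < h" "h < 1" and "T \<ge> 0"
  shows "\<exists>C \<delta>. \<delta> > 0 \<and> (\<forall>\<eta> t. \<bar>\<eta>\<bar> \<le> \<delta> \<longrightarrow> 0 \<le> t \<longrightarrow> t \<le> T \<longrightarrow>
    square_integrable lborel (\<lambda>u. ma_increment (h + \<eta> - 1/2) t u - ma_increment (h - 1/2) t u) \<and>
    (LINT u|lborel. (ma_increment (h + \<eta> - 1/2) t u - ma_increment (h - 1/2) t u)\<^sup>2) \<le> C * \<eta>\<^sup>2)"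
proof -
  \<comment> \<open>Half the distance of \<open>h\<close> from the ends of the unit interval. It
    keeps \<open>2 * (a - \<delta>)\<close> and \<open>2 * (a + \<delta>)\<close> above -1, and
    \<open>2 * (a + \<delta> - 1)\<close> below -1.\<close>
  define \<delta> where "\<delta> = min h (1 - h) / 2"
  have \<delta>: "\<delta> > 0" "\<delta> < h" "h + \<delta> < 1" using h by (auto simp: \<delta>_def min_def field_simps)
  define a where "a = h - 1/2"
  define w where "w x = pos_powr (a + \<delta>) x + pos_powr (a - \<delta>) x" for x
  \<comment> \<open>Dominates the square of \<open>w\<close> up to \<open>T + 1\<close>, which
    covers \<open>t - u\<close> and \<open>- u\<close> when \<open>u > -1\<close> and
    \<open>t \<le> T\<close>.\<close>
  define wsq where "wsq x = 2 * (indicator {0..T + 1} x * x powr (2 * (a + \<delta>))) + 2 * (indicator {0..T + 1} x * x powr (2 * (a - \<delta>)))" for x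
  define c where "c = T * (2 / \<delta> + 1)"
  define far where "far y = c\<^sup>2 * (indicator {1..} y * y powr (2 * (a + \<delta> - 1)))" for y
  have far: "integrable lborel far" unfolding far_def
    by (intro integrable_mult_right integrable_powr_to_inf) (use \<delta> in \<open>auto simp: a_def\<close>)
  have wsq: "integrable lborel wsq" unfolding wsq_def
    by (intro Bochner_Integration.integrable_add integrable_mult_right integrable_powr_from_0)
       (use \<delta> h \<open>T \<ge> 0\<close> in \<open>auto simp: a_def\<close>)
  have w_sq: "(w x)\<^sup>2 \<le> wsq x" if "x \<le> T + 1" for x
  proof (cases "x > 0")
    case True
    have "(w x)\<^sup>2 \<le> 2 * (x powr (a + \<delta>))\<^sup>2 + 2 * (x powr (a - \<delta>))\<^sup>2"
      using norm_add_sq_le[of "x powr (a + \<delta>)" "x powr (a - \<delta>)"] True by (simp add: w_def pos_powr_def)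
    then show ?thesis using True that by (simp add: wsq_def powr_square)
  qed (auto simp: w_def wsq_def pos_powr_def)
  have wsq_nn: "wsq x \<ge> 0" "far x \<ge> 0" for x by (auto simp: wsq_def far_def)
  \<comment> \<open>The envelope is free of \<open>\<eta>\<close> and depends on \<open>t\<close>
    only through a shift, so its integral \<open>C\<close> serves all times.\<close>
  define Env where "Env t u = far (- u) + 2 / \<delta>\<^sup>2 * (wsq (t - u) + wsq (- u))" for t u
  define C where "C = (LINT u|lborel. far u) + 2 / \<delta>\<^sup>2 * (2 * (LINT u|lborel. wsq u))"
  have Env: "integrable lborel (Env t)" "(LINT u|lborel. Env t u) = C" for t
    using integrable_reflect[OF far, of 0] integrable_reflect[OF wsq, of 0] integrable_reflect[OF wsq, of t]
    unfolding Env_def C_def by auto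
  have main: "(ma_increment (h + \<eta> - 1/2) t u - ma_increment (h - 1/2) t u)\<^sup>2 \<le> \<eta>\<^sup>2 * Env t u"
    if \<eta>: "\<bar>\<eta>\<bar> \<le> \<delta>" and t: "0 \<le> t" "t \<le> T" for \<eta> t u
  proof -
    let ?\<psi> = "\<lambda>x. pos_powr (a + \<eta>) x - pos_powr a x"
    have eq: "ma_increment (h + \<eta> - 1/2) t u - ma_increment (h - 1/2) t u = ?\<psi> (t - u) - ?\<psi> (- u)"
      by (simp add: ma_increment_def a_def algebra_simps)
    show ?thesis
    proof (cases "u \<le> -1")
      case True
      have "\<bar>?\<psi> (t - u) - ?\<psi> (- u)\<bar> \<le> \<bar>\<eta>\<bar> * (t * (2 / \<delta> + 1) * (- u) powr (a + \<delta> - 1))"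
        using powr_diff_increment_le[OF \<eta> \<delta>(1), of a "- u" t] True t h \<delta>
        by (simp add: pos_powr_def a_def abs_le_iff algebra_simps)
      also have "\<dots> \<le> \<bar>\<eta>\<bar> * (c * (- u) powr (a + \<delta> - 1))"
        unfolding c_def using t \<delta> by (intro mult_left_mono mult_right_mono) auto
      finally have "(?\<psi> (t - u) - ?\<psi> (- u))\<^sup>2 \<le> (\<bar>\<eta>\<bar> * (c * (- u) powr (a + \<delta> - 1)))\<^sup>2"
        by (rule power2_mono_abs)
      also have "\<dots> = \<eta>\<^sup>2 * far (- u)"
        using True by (simp add: power_mult_distrib far_def powr_square indicator_def)
      also have "\<dots> \<le> \<eta>\<^sup>2 * Env t u"
        unfolding Env_def using wsq_nn \<delta> by (intro mult_left_mono) auto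
      finally show ?thesis unfolding eq .
    next
      case False
      have "\<bar>?\<psi> (t - u) - ?\<psi> (- u)\<bar> \<le> \<bar>\<eta>\<bar> / \<delta> * w (t - u) + \<bar>\<eta>\<bar> / \<delta> * w (- u)"
        unfolding w_def
        by (rule order_trans[OF abs_triangle_ineq4 add_mono[OF pos_powr_diff_le pos_powr_diff_le]]) (use \<eta> \<delta> in auto)
      then have "(?\<psi> (t - u) - ?\<psi> (- u))\<^sup>2 \<le> (\<bar>\<eta>\<bar> / \<delta> * (w (t - u) + w (- u)))\<^sup>2"
        by (intro power2_mono_abs) (simp add: distrib_left)
      also have "\<dots> = \<eta>\<^sup>2 / \<delta>\<^sup>2 * (w (t - u) + w (- u))\<^sup>2" by (simp add: power_mult_distrib power_divide)
      also have "\<dots> \<le> \<eta>\<^sup>2 / \<delta>\<^sup>2 * (2 * wsq (t - u) + 2 * wsq (- u))"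
      proof (rule mult_left_mono)
        have "(w (t - u) + w (- u))\<^sup>2 \<le> 2 * (w (t - u))\<^sup>2 + 2 * (w (- u))\<^sup>2"
          using norm_add_sq_le[of "w (t - u)" "w (- u)"] by simp
        also have "\<dots> \<le> 2 * wsq (t - u) + 2 * wsq (- u)"
          using False t \<open>T \<ge> 0\<close> by (intro add_mono mult_left_mono w_sq) auto
        finally show "(w (t - u) + w (- u))\<^sup>2 \<le> 2 * wsq (t - u) + 2 * wsq (- u)" .
      qed simp
      also have "\<dots> = \<eta>\<^sup>2 * (2 / \<delta>\<^sup>2 * (wsq (t - u) + wsq (- u)))" by (simp add: algebra_simps add_divide_distrib)
      also have "\<dots> \<le> \<eta>\<^sup>2 * Env t u" unfolding Env_def using wsq_nn by (intro mult_left_mono) auto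
      finally show ?thesis unfolding eq .
    qed
  qed
  have "square_integrable lborel (\<lambda>u. ma_increment (h + \<eta> - 1/2) t u - ma_increment (h - 1/2) t u) \<and>
    (LINT u|lborel. (ma_increment (h + \<eta> - 1/2) t u - ma_increment (h - 1/2) t u)\<^sup>2) \<le> C * \<eta>\<^sup>2"
    if \<eta>: "\<bar>\<eta>\<bar> \<le> \<delta>" and t: "0 \<le> t" "t \<le> T" for \<eta> t
  proof -
    have dom: "integrable lborel (\<lambda>u. \<eta>\<^sup>2 * Env t u)" using Env(1) by (rule integrable_mult_right)
    have int: "integrable lborel (\<lambda>u. (ma_increment (h + \<eta> - 1/2) t u - ma_increment (h - 1/2) t u)\<^sup>2)"
      by (rule Bochner_Integration.integrable_bound[OF dom])
         (use main[OF that] in \<open>auto intro: order_trans[OF _ abs_ge_self]\<close>)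
    moreover have "(LINT u|lborel. (ma_increment (h + \<eta> - 1/2) t u - ma_increment (h - 1/2) t u)\<^sup>2) \<le> (LINT u|lborel. \<eta>\<^sup>2 * Env t u)"
      by (rule integral_mono[OF int dom main[OF that]])
    ultimately show ?thesis using Env by (simp add: square_integrable_def mult.commute)
  qed
  with \<delta>(1) show ?thesis by blast
qed

text \<open>The constant is written with the reciprocal Gamma function, whose differentiability at
  \<open>h + 1/2\<close> gives a Lipschitz bound directly.\<close>

definition ma_kernel :: "real \<Rightarrow> real \<Rightarrow> real \<Rightarrow> real" where
  "ma_kernel h t u = rGamma (h + 1/2) * ma_increment (h - 1/2) t u"

lemma moving_average_value_imp_wiener:
  assumes W: "two_sided_brownian_motion M W" and mav: "moving_average_value M W h t X"
    and "t \<ge> 0" and [measurable]: "X \<in> borel_measurable M"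
  shows "has_wiener_integral M W (ma_kernel h t) X"
proof -
  obtain I J where
    I: "has_wiener_integral M W (\<lambda>u. indicator {..0} u * ((t - u) powr (h - 1/2) - (- u) powr (h - 1/2))) I" and
    J: "has_wiener_integral M W (\<lambda>u. indicator {0..t} u * (t - u) powr (h - 1/2)) J" and
    XIJ: "AE \<omega> in M. X \<omega> = 1 / Gamma (h + 1/2) * (I \<omega> + J \<omega>)"
    using mav unfolding moving_average_value_def has_wiener_integral_on_def
    by (elim exE conjE) (rule that)
  have "has_wiener_integral M W (\<lambda>u. rGamma (h + 1/2) *
      (indicator {..0} u * ((t - u) powr (h - 1/2) - (- u) powr (h - 1/2)) + indicator {0..t} u * (t - u) powr (h - 1/2)))
      (\<lambda>\<omega>. rGamma (h + 1/2) * (I \<omega> + J \<omega>))"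
    by (rule has_wiener_integral_bounded_linear[OF W has_wiener_integral_add[OF W I J] bounded_linear_mult_right])
  then show ?thesis
  proof (rule has_wiener_integral_AE_cong)
    \<comment> \<open>The closed intervals of the two integrals share the point 0, so the kernels
      are compared off the endpoints.\<close>
    have "AE u in lborel. u \<noteq> (0::real)" "AE u in lborel. u \<noteq> t" by (rule AE_lborel_singleton)+
    then show "AE u in lborel. rGamma (h + 1/2) * (indicator {..0} u * ((t - u) powr (h - 1/2) - (- u) powr (h - 1/2))
        + indicator {0..t} u * (t - u) powr (h - 1/2)) = ma_kernel h t u"
    proof eventually_elim
      case (elim u)
      consider "u < 0" | "0 < u" "u < t" | "0 < u" "t < u" using elim by linarith
      then show ?case
        using \<open>t \<ge> 0\<close> by cases (simp_all add: ma_kernel_def ma_increment_def pos_powr_def)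
    qed
    show "AE \<omega> in M. rGamma (h + 1/2) * (I \<omega> + J \<omega>) = X \<omega>"
      using XIJ by eventually_elim (simp only: rGamma_inverse_Gamma inverse_eq_divide)
    show "ma_kernel h t \<in> borel_measurable borel" unfolding ma_kernel_def by measurable
  qed fact
qed

lemma ma_kernel_scaling:
  assumes "r > 0"
  shows "ma_kernel h (r * s + t) u - ma_kernel h t u = r powr (h - 1/2) * ma_kernel h s ((u - t) / r)"
proof -
  have "r * s + t - u = r * (s - (u - t) / r)" using assms by (simp add: field_simps)
  then have A: "pos_powr (h - 1/2) (r * s + t - u) = r powr (h - 1/2) * pos_powr (h - 1/2) (s - (u - t) / r)"
    by (simp only: pos_powr_scale[OF assms])
  have "t - u = r * (- ((u - t) / r))" using assms by (simp add: field_simps)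
  then have B: "pos_powr (h - 1/2) (t - u) = r powr (h - 1/2) * pos_powr (h - 1/2) (- ((u - t) / r))"
    by (simp only: pos_powr_scale[OF assms])
  show ?thesis unfolding ma_kernel_def ma_increment_def A B by (simp only: right_diff_distrib) simp
qed

lemma local_lipschitz_at:
  fixes f :: "real \<Rightarrow> real"
  assumes "(f has_real_derivative D) (at x)"
  shows "\<exists>d>0. \<forall>k. \<bar>k\<bar> \<le> d \<longrightarrow> \<bar>f (x + k) - f x\<bar> \<le> (\<bar>D\<bar> + 1) * \<bar>k\<bar>"
proof -
  have "(\<lambda>k. (f (x + k) - f x) / k) \<midarrow>0\<rightarrow> D" using assms by (simp add: DERIV_def)
  from LIM_D[OF this, of 1] obtain s where s: "s > 0"
    "\<And>k. k \<noteq> 0 \<Longrightarrow> \<bar>k\<bar> < s \<Longrightarrow> \<bar>(f (x + k) - f x) / k - D\<bar> < 1" by auto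
  have "\<bar>f (x + k) - f x\<bar> \<le> (\<bar>D\<bar> + 1) * \<bar>k\<bar>" if "\<bar>k\<bar> \<le> s / 2" for k
  proof (cases "k = 0")
    case False
    with s(2)[of k] that s(1) have "\<bar>(f (x + k) - f x) / k\<bar> \<le> \<bar>D\<bar> + 1" by linarith
    then show ?thesis using False by (simp add: abs_divide pos_divide_le_eq)
  qed simp
  with s(1) show ?thesis by (intro exI[of _ "s / 2"]) auto
qed

text \<open>The change of \<open>h\<close> affects the constant and the increment. As in the product
  rule the difference is one term for each, and both are of order \<open>\<eta>\<close> in
  L2.\<close>

lemma ma_kernel_near:
  assumes h: "0 < h" "h < 1" and sq: "\<And>t. t \<ge> 0 \<Longrightarrow> square_integrable lborel (ma_kernel h t)"
  shows "\<exists>C \<delta>. \<delta> > 0 \<and> (\<forall>\<eta> t. \<bar>\<eta>\<bar> \<le> \<delta> \<longrightarrow> 0 \<le> t \<longrightarrow> t \<le> T \<longrightarrow>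
    (LINT u|lborel. (ma_kernel (h + \<eta>) t u - ma_kernel h t u)\<^sup>2) \<le> C * \<eta>\<^sup>2)"
proof (cases "T \<ge> 0")
  case T: True
  obtain C0 \<delta>0 where \<delta>0: "\<delta>0 > 0" and C0: "\<And>\<eta> t. \<bar>\<eta>\<bar> \<le> \<delta>0 \<Longrightarrow> 0 \<le> t \<Longrightarrow> t \<le> T \<Longrightarrow>
      square_integrable lborel (\<lambda>u. ma_increment (h + \<eta> - 1/2) t u - ma_increment (h - 1/2) t u) \<and>
      (LINT u|lborel. (ma_increment (h + \<eta> - 1/2) t u - ma_increment (h - 1/2) t u)\<^sup>2) \<le> C0 * \<eta>\<^sup>2"
    using ma_increment_perturb[OF h T] by blast
  define x where "x = h + 1/2"
  have "x > 0" using h by (simp add: x_def)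
  have "x \<notin> \<int>\<^sub>\<le>\<^sub>0" using \<open>x > 0\<close> by (auto elim!: nonpos_Ints_cases)
  then obtain D where "(rGamma has_real_derivative D) (at x)"
    using has_field_derivative_rGamma_no_nonpos_int[of x UNIV] by blast
  from local_lipschitz_at[OF this] obtain d where d: "d > 0"
    "\<And>k. \<bar>k\<bar> \<le> d \<Longrightarrow> \<bar>rGamma (x + k) - rGamma x\<bar> \<le> (\<bar>D\<bar> + 1) * \<bar>k\<bar>" by blast
  define c where "c = rGamma x"
  have "c \<noteq> 0" using \<open>x \<notin> \<int>\<^sub>\<le>\<^sub>0\<close> by (simp add: c_def rGamma_eq_zero_iff)
  define K where "K = \<bar>D\<bar> + 1"
  \<comment> \<open>A bound for \<open>rGamma (x + \<eta>)\<close> as long as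
    \<open>\<bar>\<eta>\<bar> \<le> d\<close>.\<close>
  define c' where "c' = \<bar>c\<bar> + K * d"
  have "K > 0" by (simp add: K_def add_nonneg_pos)
  \<comment> \<open>By self-similarity the squared norm of the kernel at time \<open>t\<close> is
    \<open>t powr (2 * h)\<close> times that at time 1, hence bounded up to
    \<open>T\<close>.\<close>
  define S where "S = T powr (2 * h) * (LINT u|lborel. (ma_kernel h 1 u)\<^sup>2)"
  have S: "(LINT u|lborel. (ma_kernel h t u)\<^sup>2) \<le> S" if t: "0 \<le> t" "t \<le> T" for t
  proof (cases "t = 0")
    case True
    then show ?thesis by (simp add: ma_kernel_def ma_increment_def S_def integral_nonneg_AE)
  next
    case False
    with t have "t > 0" by simp
    have "ma_kernel h t u = t powr (h - 1/2) * ma_kernel h 1 ((u - 0) / t)" for u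
      using ma_kernel_scaling[OF \<open>t > 0\<close>, of h 1 0 u] by (simp add: ma_kernel_def[of h 0] ma_increment_def[of _ 0])
    then have "(LINT u|lborel. (ma_kernel h t u)\<^sup>2) = (t powr (h - 1/2))\<^sup>2 * (LINT u|lborel. (ma_kernel h 1 ((u - 0) / t))\<^sup>2)"
      by (simp only: power_mult_distrib integral_mult_right_zero)
    also have "\<dots> = t powr (2 * h - 1) * t powr 1 * (LINT u|lborel. (ma_kernel h 1 u)\<^sup>2)"
      using square_integrable_affine(2)[OF sq[of 1] \<open>t > 0\<close>, of 0] \<open>t > 0\<close> by (simp add: powr_square right_diff_distrib)
    also have "t powr (2 * h - 1) * t powr 1 = t powr (2 * h)" unfolding powr_add[symmetric] by simp
    also have "t powr (2 * h) * (LINT u|lborel. (ma_kernel h 1 u)\<^sup>2) \<le> S"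
      unfolding S_def using t h by (intro mult_right_mono powr_mono2) (auto intro: integral_nonneg_AE)
    finally show ?thesis .
  qed
  define C where "C = 2 * (c'\<^sup>2 * C0) + 2 * ((K / c)\<^sup>2 * S)"
  have S0: "S \<ge> 0" unfolding S_def by (intro mult_nonneg_nonneg integral_nonneg_AE) auto
  have "(LINT u|lborel. (ma_kernel (h + \<eta>) t u - ma_kernel h t u)\<^sup>2) \<le> C * \<eta>\<^sup>2"
    if \<eta>: "\<bar>\<eta>\<bar> \<le> min \<delta>0 d" and t: "0 \<le> t" "t \<le> T" for \<eta> t
  proof -
    let ?U = "\<lambda>u. ma_increment (h + \<eta> - 1/2) t u - ma_increment (h - 1/2) t u"
    let ?g = "rGamma (x + \<eta>)"
    have U: "square_integrable lborel ?U" "(LINT u|lborel. (?U u)\<^sup>2) \<le> C0 * \<eta>\<^sup>2" using C0[of \<eta> t] \<eta> t by auto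
    have g: "\<bar>?g - c\<bar> \<le> K * \<bar>\<eta>\<bar>" using d(2)[of \<eta>] \<eta> by (simp add: c_def K_def)
    have "K * \<bar>\<eta>\<bar> \<le> K * d" using \<eta> \<open>K > 0\<close> by (intro mult_left_mono) auto
    with g have "\<bar>?g\<bar> \<le> c'" unfolding c'_def by linarith
    then have g2: "?g\<^sup>2 \<le> c'\<^sup>2" by (rule power2_mono_abs[of ?g c'])
    have gc2: "((?g - c) / c)\<^sup>2 \<le> (K / c)\<^sup>2 * \<eta>\<^sup>2"
      using power2_mono_abs[OF g] \<open>c \<noteq> 0\<close> by (simp add: power_divide power_mult_distrib divide_right_mono)
    have eq: "ma_kernel (h + \<eta>) t u - ma_kernel h t u = ?g * ?U u + (?g - c) / c * ma_kernel h t u" for u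
      using \<open>c \<noteq> 0\<close> by (simp add: ma_kernel_def c_def x_def field_simps)
    have "(LINT u|lborel. (ma_kernel (h + \<eta>) t u - ma_kernel h t u)\<^sup>2)
        \<le> 2 * (LINT u|lborel. (?g * ?U u)\<^sup>2) + 2 * (LINT u|lborel. ((?g - c) / c * ma_kernel h t u)\<^sup>2)"
      unfolding eq by (intro integral_sq_add_le square_integrable_cmult U sq t)
    also have "\<dots> = 2 * (?g\<^sup>2 * (LINT u|lborel. (?U u)\<^sup>2)) + 2 * (((?g - c) / c)\<^sup>2 * (LINT u|lborel. (ma_kernel h t u)\<^sup>2))"
      by (simp only: power_mult_distrib integral_mult_right_zero)
    also have "\<dots> \<le> 2 * (c'\<^sup>2 * (C0 * \<eta>\<^sup>2)) + 2 * (((K / c)\<^sup>2 * \<eta>\<^sup>2) * S)"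
      by (intro add_mono mult_left_mono[of _ _ 2] mult_mono g2 gc2 U S t) (auto intro: integral_nonneg_AE)
    also have "\<dots> = C * \<eta>\<^sup>2" by (simp add: C_def algebra_simps)
    finally show ?thesis .
  qed
  then show ?thesis using \<delta>0 d(1) by (intro exI[of _ C] exI[of _ "min \<delta>0 d"]) auto
next
  case False
  then show ?thesis by (intro exI[of _ 0] exI[of _ 1]) auto
qed

section \<open>The Fourier transform on square integrable functions\<close>

definition truncated_fourier :: "real \<Rightarrow> (real \<Rightarrow> complex) \<Rightarrow> real \<Rightarrow> complex" where
  "truncated_fourier R g \<xi> = (1 / complex_of_real (sqrt (2 * pi))) *
     (LINT x:{-R..R}|lborel. cis (- (\<xi> * x)) * g x)"

lemma has_L2_fourier_transform_iff:
  "has_L2_fourier_transform g G \<longleftrightarrow> square_integrable lborel g \<and> square_integrable lborel G \<and>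
     tendsto_L2 lborel (\<lambda>R. truncated_fourier R g) G at_top"
  by (simp add: has_L2_fourier_transform_def truncated_fourier_def[abs_def])

lemma cis_measurable [measurable]: "cis \<in> borel_measurable borel"
  by (intro borel_measurable_continuous_onI continuous_intros)

lemma cnj_measurable [measurable]: "cnj \<in> borel_measurable borel"
  by (intro borel_measurable_continuous_onI continuous_intros)

lemma truncated_fourier_measurable:
  assumes [measurable]: "g \<in> borel_measurable borel"
  shows "truncated_fourier R g \<in> borel_measurable borel"
  unfolding truncated_fourier_def set_lebesgue_integral_def by measurable

lemma square_integrable_truncation:
  fixes g :: "real \<Rightarrow> complex"
  assumes "square_integrable lborel g"
  shows "integrable lborel (\<lambda>x. indicator {-R..R} x *\<^sub>R g x)"
    and "square_integrable lborel (\<lambda>x. indicator {-R..R} x *\<^sub>R g x)"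
    and "(LINT x|lborel. (norm (indicator {-R..R} x *\<^sub>R g x))\<^sup>2) \<le> (LINT x|lborel. (norm (g x))\<^sup>2)"
proof -
  have [measurable]: "g \<in> borel_measurable borel" and int: "integrable lborel (\<lambda>x. (norm (g x))\<^sup>2)"
    using assms by (auto simp: square_integrable_def)
  have le: "norm (g x) \<le> 1 + (norm (g x))\<^sup>2" for x
    using zero_le_power2[of "norm (g x) - 1/2"] by (simp add: power2_eq_square algebra_simps)
  show "integrable lborel (\<lambda>x. indicator {-R..R} x *\<^sub>R g x)"
  proof (rule Bochner_Integration.integrable_bound)
    show "integrable lborel (\<lambda>x. indicator {-R..R} x + (norm (g x))\<^sup>2)"
      by (intro Bochner_Integration.integrable_add integrable_real_indicator int) (simp_all add: emeasure_lborel_Icc_eq)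
    show "AE x in lborel. norm (indicator {-R..R} x *\<^sub>R g x) \<le> norm (indicator {-R..R} x + (norm (g x))\<^sup>2)"
      using le by (intro AE_I2) (simp add: indicator_def)
  qed simp
  have le2: "(norm (indicator {-R..R} x *\<^sub>R g x))\<^sup>2 \<le> (norm (g x))\<^sup>2" for x by (simp add: indicator_def)
  have int2: "integrable lborel (\<lambda>x. (norm (indicator {-R..R} x *\<^sub>R g x))\<^sup>2)"
    by (rule Bochner_Integration.integrable_bound[OF int]) (use le2 in auto)
  then show "square_integrable lborel (\<lambda>x. indicator {-R..R} x *\<^sub>R g x)" by (simp add: square_integrable_def)
  show "(LINT x|lborel. (norm (indicator {-R..R} x *\<^sub>R g x))\<^sup>2) \<le> (LINT x|lborel. (norm (g x))\<^sup>2)"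
    by (rule integral_mono[OF int2 int le2])
qed

lemma truncated_fourier_eq:
  "truncated_fourier R g \<xi> = (1 / complex_of_real (sqrt (2 * pi))) *
     (LINT x|lborel. cis (- (\<xi> * x)) * (indicator {-R..R} x *\<^sub>R g x))"
  unfolding truncated_fourier_def set_lebesgue_integral_def by simp

lemma integrable_cis_mult:
  assumes "integrable lborel g"
  shows "integrable lborel (\<lambda>x. cis (- (\<xi> * x)) * g x)"
proof -
  have [measurable]: "g \<in> borel_measurable borel" using assms by auto
  show ?thesis by (rule Bochner_Integration.integrable_bound[OF assms]) (auto simp: norm_mult)
qed

lemma truncated_fourier_diff:
  assumes "square_integrable lborel g" "square_integrable lborel g'"
  shows "truncated_fourier R (\<lambda>x. g x - g' x) \<xi> = truncated_fourier R g \<xi> - truncated_fourier R g' \<xi>"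
proof -
  let ?t = "\<lambda>g x. cis (- (\<xi> * x)) * (indicator {-R..R} x *\<^sub>R g x)"
  have int: "integrable lborel (?t g)" "integrable lborel (?t g')"
    by (intro integrable_cis_mult square_integrable_truncation assms)+
  have "(LINT x|lborel. ?t (\<lambda>x. g x - g' x) x) = (LINT x|lborel. ?t g x - ?t g' x)"
    by (intro Bochner_Integration.integral_cong refl) (simp only: scaleR_diff_right right_diff_distrib)
  also have "\<dots> = (LINT x|lborel. ?t g x) - (LINT x|lborel. ?t g' x)"
    by (rule Bochner_Integration.integral_diff[OF int])
  finally show ?thesis unfolding truncated_fourier_eq by (simp only: right_diff_distrib)
qed

lemma has_L2_fourier_transform_diff:
  assumes "has_L2_fourier_transform g G" "has_L2_fourier_transform g' G'"
  shows "has_L2_fourier_transform (\<lambda>x. g x - g' x) (\<lambda>\<xi>. G \<xi> - G' \<xi>)"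
proof -
  have sq: "square_integrable lborel g" "square_integrable lborel g'" "square_integrable lborel G" "square_integrable lborel G'"
    using assms by (auto simp: has_L2_fourier_transform_iff)
  have m: "truncated_fourier R g \<in> borel_measurable lborel" "truncated_fourier R g' \<in> borel_measurable lborel"
    "G \<in> borel_measurable lborel" "G' \<in> borel_measurable lborel" for R
    using sq by (auto simp: square_integrable_def intro!: truncated_fourier_measurable)
  have "tendsto_L2 lborel (\<lambda>R \<xi>. truncated_fourier R g \<xi> - truncated_fourier R g' \<xi>) (\<lambda>\<xi>. G \<xi> - G' \<xi>) at_top"
    using assms m by (intro tendsto_L2_diff) (auto simp: has_L2_fourier_transform_iff)
  moreover have "truncated_fourier R (\<lambda>x. g x - g' x) = (\<lambda>\<xi>. truncated_fourier R g \<xi> - truncated_fourier R g' \<xi>)" for R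
    by (rule ext) (rule truncated_fourier_diff[OF sq(1,2)])
  ultimately show ?thesis
    using square_integrable_diff[OF sq(1,2)] square_integrable_diff[OF sq(3,4)]
    by (simp add: has_L2_fourier_transform_iff)
qed

lemma has_L2_fourier_transform_unique:
  assumes "has_L2_fourier_transform g G" "has_L2_fourier_transform g G'"
  shows "AE \<xi> in lborel. G \<xi> = G' \<xi>"
proof (rule tendsto_L2_unique)
  show "tendsto_L2 lborel (\<lambda>R. truncated_fourier R g) G at_top" "tendsto_L2 lborel (\<lambda>R. truncated_fourier R g) G' at_top"
    using assms by (auto simp: has_L2_fourier_transform_iff)
  have "g \<in> borel_measurable borel" using assms by (auto simp: has_L2_fourier_transform_iff square_integrable_def)
  then show "truncated_fourier R g \<in> borel_measurable lborel" for R using truncated_fourier_measurable by simp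
qed (use assms in \<open>auto simp: has_L2_fourier_transform_iff square_integrable_def\<close>)

lemma square_integrable_affine_complex:
  fixes f :: "real \<Rightarrow> complex"
  assumes "square_integrable lborel f" "r > 0"
  shows "square_integrable lborel (\<lambda>u. f ((u - a) / r))"
proof -
  have [measurable]: "f \<in> borel_measurable borel" using assms by (auto simp: square_integrable_def)
  have "square_integrable lborel (\<lambda>u. norm (f u))" using assms by (simp add: square_integrable_def)
  from square_integrable_affine(1)[OF this \<open>r > 0\<close>, of a] show ?thesis
    by (auto simp: square_integrable_def)
qed

text \<open>Dilation and modulation commute with the truncated transform except that the truncation
  radius changes from \<open>R\<close> to \<open>r * R\<close>, which is immaterial in the
  limit.\<close>

lemma truncated_fourier_affine:
  assumes "r > 0"
  shows "truncated_fourier R (\<lambda>x. cis (t * x) * (of_real (sqrt r) * g (r * x))) \<xi>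
    = of_real (1 / sqrt r) * truncated_fourier (r * R) g ((\<xi> - t) / r)"
proof -
  let ?f = "\<lambda>y. cis (- ((\<xi> - t) / r * y)) * (indicator {- (r * R)..r * R} y *\<^sub>R g y)"
  have ind: "indicator {- (r * R)..r * R} (r * x) = (indicator {-R..R} x :: real)" for x
  proof -
    have "- (r * R) \<le> r * x \<longleftrightarrow> - R \<le> x" using mult_le_cancel_left_pos[OF assms, of "- R" x] by simp
    moreover have "r * x \<le> r * R \<longleftrightarrow> x \<le> R" using assms by simp
    ultimately show ?thesis by (simp add: indicator_def)
  qed
  have pt: "cis (- (\<xi> * x)) * (indicator {-R..R} x *\<^sub>R (cis (t * x) * (of_real (sqrt r) * g (r * x))))
      = of_real (sqrt r) * ?f (0 + r * x)" for x
  proof -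
    have "cis (- (\<xi> * x)) * cis (t * x) = cis (- ((\<xi> - t) / r * (r * x)))"
    proof -
      have "- ((\<xi> - t) / r * (r * x)) = - (\<xi> * x) + t * x" using assms by (simp add: field_simps)
      then show ?thesis by (simp only: cis_mult)
    qed
    then have A: "cis (- ((\<xi> - t) / r * (r * x))) = cis (- (\<xi> * x)) * cis (t * x)" ..
    show ?thesis unfolding add_0 ind A scaleR_conv_of_real by (simp only: mult_ac)
  qed
  have "(LINT y|lborel. ?f y) = r *\<^sub>R (LINT x|lborel. ?f (0 + r * x))"
    using lborel_integral_real_affine[of r ?f 0] assms by simp
  then have I: "(LINT x|lborel. ?f (0 + r * x)) = of_real (1 / r) * (LINT y|lborel. ?f y)"
    using assms by (simp add: scaleR_conv_of_real)
  have c: "complex_of_real (sqrt r) * of_real (1 / r) = of_real (1 / sqrt r)"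
    using assms by (simp add: real_div_sqrt field_simps flip: of_real_mult of_real_divide)
  have "truncated_fourier R (\<lambda>x. cis (t * x) * (of_real (sqrt r) * g (r * x))) \<xi>
      = (1 / of_real (sqrt (2 * pi))) * (of_real (sqrt r) * (LINT x|lborel. ?f (0 + r * x)))"
    unfolding truncated_fourier_eq pt by (simp only: integral_mult_right_zero)
  also have "\<dots> = of_real (sqrt r) * of_real (1 / r) * ((1 / of_real (sqrt (2 * pi))) * (LINT y|lborel. ?f y))"
    unfolding I by (simp only: mult_ac)
  finally show ?thesis unfolding c truncated_fourier_eq .
qed

lemma has_L2_fourier_transform_affine:
  assumes FT: "has_L2_fourier_transform g G" and r: "r > 0"
  shows "has_L2_fourier_transform (\<lambda>x. cis (t * x) * (of_real (sqrt r) * g (r * x)))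
    (\<lambda>\<xi>. of_real (1 / sqrt r) * G ((\<xi> - t) / r))"
proof -
  have sq: "square_integrable lborel g" "square_integrable lborel G"
    and lim: "tendsto_L2 lborel (\<lambda>R. truncated_fourier R g) G at_top"
    using FT by (auto simp: has_L2_fourier_transform_iff)
  have [measurable]: "g \<in> borel_measurable borel" "G \<in> borel_measurable borel" using sq by (auto simp: square_integrable_def)
  note [measurable] = truncated_fourier_measurable
  have "square_integrable lborel (\<lambda>x. g (r * x))"
    using square_integrable_affine_complex[OF sq(1), of "1 / r" 0] r by (simp add: mult.commute)
  then have "square_integrable lborel (\<lambda>x. cis (t * x) * (of_real (sqrt r) * g (r * x)))"
    by (auto simp: square_integrable_def norm_mult power_mult_distrib)
  moreover have "square_integrable lborel (\<lambda>\<xi>. of_real (1 / sqrt r) * G ((\<xi> - t) / r))"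
    by (rule square_integrable_bounded_linear[OF square_integrable_affine_complex[OF sq(2) r] bounded_linear_mult_right])
  moreover have "tendsto_L2 lborel (\<lambda>R \<xi>. of_real (1 / sqrt r) * truncated_fourier (r * R) g ((\<xi> - t) / r))
      (\<lambda>\<xi>. of_real (1 / sqrt r) * G ((\<xi> - t) / r)) at_top"
  proof -
    let ?n = "\<lambda>R \<xi>. ennreal ((norm (truncated_fourier R g \<xi> - G \<xi>))\<^sup>2)"
    have "(\<integral>\<^sup>+\<xi>. ennreal ((norm (of_real (1 / sqrt r) * truncated_fourier R g ((\<xi> - t) / r) - of_real (1 / sqrt r) * G ((\<xi> - t) / r)))\<^sup>2) \<partial>lborel)
        = (\<integral>\<^sup>+\<xi>. ?n R \<xi> \<partial>lborel)" for R
    proof -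
      have "(norm (of_real (1 / sqrt r) * truncated_fourier R g ((\<xi> - t) / r) - of_real (1 / sqrt r) * G ((\<xi> - t) / r)))\<^sup>2
          = 1 / r * (norm (truncated_fourier R g ((\<xi> - t) / r) - G ((\<xi> - t) / r)))\<^sup>2" for \<xi>
        using r by (simp only: right_diff_distrib[symmetric] norm_mult power_mult_distrib norm_of_real power2_abs)
          (simp add: power_divide)
      then have "(\<integral>\<^sup>+\<xi>. ennreal ((norm (of_real (1 / sqrt r) * truncated_fourier R g ((\<xi> - t) / r) - of_real (1 / sqrt r) * G ((\<xi> - t) / r)))\<^sup>2) \<partial>lborel)
          = (\<integral>\<^sup>+\<xi>. ennreal (1 / r) * ?n R ((\<xi> - t) / r) \<partial>lborel)"
        by (intro nn_integral_cong) (simp only: ennreal_mult''[OF zero_le_power2])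
      also have "\<dots> = ennreal (1 / r) * (\<integral>\<^sup>+\<xi>. ?n R ((\<xi> - t) / r) \<partial>lborel)" by (rule nn_integral_cmult) measurable
      also have "(\<lambda>\<xi>. (\<xi> - t) / r) = (\<lambda>\<xi>. - t / r + 1 / r * \<xi>)" by (auto simp: field_simps diff_divide_distrib)
      then have "(\<integral>\<^sup>+\<xi>. ?n R ((\<xi> - t) / r) \<partial>lborel) = (\<integral>\<^sup>+\<xi>. ?n R (- t / r + 1 / r * \<xi>) \<partial>lborel)" by metis
      also have "ennreal (1 / r) * (\<integral>\<^sup>+\<xi>. ?n R (- t / r + 1 / r * \<xi>) \<partial>lborel) = (\<integral>\<^sup>+\<xi>. ?n R \<xi> \<partial>lborel)"
        using nn_integral_real_affine[of "?n R" "1 / r" "- t / r"] r by simp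
      finally show ?thesis .
    qed
    \<comment> \<open>The radius \<open>r * R\<close> tends to infinity with \<open>R\<close>, so
      the limit defining \<open>G\<close> may be taken along it.\<close>
    moreover have "((\<lambda>R. \<integral>\<^sup>+\<xi>. ?n (r * R) \<xi> \<partial>lborel) \<longlongrightarrow> 0) at_top"
      using lim unfolding tendsto_L2_def
      by (rule filterlim_compose) (rule filterlim_tendsto_pos_mult_at_top[OF tendsto_const r filterlim_ident])
    ultimately show ?thesis unfolding tendsto_L2_def by simp
  qed
  ultimately show ?thesis
    unfolding has_L2_fourier_transform_iff by (simp add: truncated_fourier_affine[OF r, abs_def])
qed

text \<open>Integrating the squared transform against a Gaussian weight gives the integral of
  \<open>g x * cnj (g y)\<close> against a normal density in \<open>x - y\<close>, of total mass 1 in each variable.\<close>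

lemma fourier_bessel_gaussian:
  fixes g :: "real \<Rightarrow> complex"
  assumes g: "integrable lborel g" "square_integrable lborel g" and \<sigma>: "\<sigma> > 0"
  defines "F \<equiv> \<lambda>\<xi>. LINT x|lborel. cis (- (\<xi> * x)) * g x"
  shows "(LINT \<xi>|lborel. (norm (F \<xi>))\<^sup>2 * exp (- (\<sigma> * \<xi>)\<^sup>2 / 2)) \<le> 2 * pi * (LINT x|lborel. (norm (g x))\<^sup>2)"
    and "integrable lborel (\<lambda>\<xi>. (norm (F \<xi>))\<^sup>2 * exp (- (\<sigma> * \<xi>)\<^sup>2 / 2))"
proof -
  have [measurable]: "g \<in> borel_measurable borel" using g by auto
  have sq: "integrable lborel (\<lambda>x. (norm (g x))\<^sup>2)" using g by (simp add: square_integrable_def)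
  have [measurable]: "F \<in> borel_measurable borel" unfolding F_def by measurable
  let ?w = "\<lambda>\<xi>. exp (- (\<sigma> * \<xi>)\<^sup>2 / 2)"
  let ?n = "normal_density 0 \<sigma>"
  let ?P = "(lborel :: real measure) \<Otimes>\<^sub>M (lborel :: real measure)"
  interpret PP: sigma_finite_measure ?P unfolding lborel_prod by (rule lborel.sigma_finite_measure_axioms)
  interpret LP: pair_sigma_finite "lborel :: real measure" ?P ..
  define \<phi> where "\<phi> q = g (fst q) * cnj (g (snd q))" for q
  have [measurable]: "\<phi> \<in> borel_measurable ?P" unfolding \<phi>_def by measurable
  have w: "integrable lborel ?w" by (rule gaussian_fourier(2)[OF \<sigma>])
  have "integrable ?P (\<lambda>(x, y). g x * cnj (g y))"
    by (rule lborel_pair.Fubini_integrable) (use g in \<open>auto simp: norm_mult\<close>)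
  then have int\<phi>: "integrable ?P \<phi>" by (simp add: \<phi>_def[abs_def] split_beta')
  have FF: "of_real ((norm (F \<xi>))\<^sup>2) = (LINT q|?P. \<phi> q * cis (- (\<xi> * (fst q - snd q))))" for \<xi>
  proof -
    have "integrable ?P (\<lambda>q. \<phi> q * cis (- (\<xi> * (fst q - snd q))))"
      by (rule Bochner_Integration.integrable_bound[OF int\<phi>]) (auto simp: norm_mult)
    from lborel_pair.integral_fst'[OF this]
    have "(LINT q|?P. \<phi> q * cis (- (\<xi> * (fst q - snd q))))
        = (LINT x|lborel. LINT y|lborel. g x * cnj (g y) * cis (- (\<xi> * (x - y))))" by (simp add: \<phi>_def)
    also have "\<dots> = (LINT x|lborel. LINT y|lborel. (cis (- (\<xi> * x)) * g x) * cnj (cis (- (\<xi> * y)) * g y))"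
    proof (intro Bochner_Integration.integral_cong refl)
      fix x y
      have "cis (- (\<xi> * (x - y))) = cis (- (\<xi> * x)) * cis (\<xi> * y)" by (simp add: cis_mult algebra_simps)
      then show "g x * cnj (g y) * cis (- (\<xi> * (x - y))) = (cis (- (\<xi> * x)) * g x) * cnj (cis (- (\<xi> * y)) * g y)"
        by (simp add: cis_cnj)
    qed
    also have "\<dots> = F \<xi> * cnj (F \<xi>)"
      unfolding F_def by (simp only: integral_mult_right_zero integral_mult_left_zero Bochner_Integration.integral_cnj)
    finally show ?thesis by (simp only: complex_norm_square)
  qed
  have Fb: "norm (F \<xi>) \<le> (LINT x|lborel. norm (g x))" for \<xi>
  proof -
    have "norm (F \<xi>) \<le> (LINT x|lborel. norm (cis (- (\<xi> * x)) * g x))" unfolding F_def by (rule integral_norm_bound)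
    then show ?thesis by (simp add: norm_mult)
  qed
  show intF: "integrable lborel (\<lambda>\<xi>. (norm (F \<xi>))\<^sup>2 * ?w \<xi>)"
    by (rule Bochner_Integration.integrable_bound[OF integrable_mult_right[OF w, of "(LINT x|lborel. norm (g x))\<^sup>2"]])
       (auto intro!: mult_right_mono power_mono Fb)
  let ?h = "\<lambda>\<xi> q. of_real (?w \<xi>) * (\<phi> q * cis (- (\<xi> * (fst q - snd q))))"
  have "integrable (lborel \<Otimes>\<^sub>M ?P) (\<lambda>(\<xi>, q). of_real (?w \<xi>) * \<phi> q)"
    by (rule LP.Fubini_integrable) (use int\<phi> w in \<open>auto simp: norm_mult\<close>)
  then have inth: "integrable (lborel \<Otimes>\<^sub>M ?P) (\<lambda>(\<xi>, q). ?h \<xi> q)"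
    by (rule Bochner_Integration.integrable_bound) (auto simp: norm_mult)
  have "complex_of_real (LINT \<xi>|lborel. (norm (F \<xi>))\<^sup>2 * ?w \<xi>) = (LINT \<xi>|lborel. LINT q|?P. ?h \<xi> q)"
    unfolding integral_complex_of_real[symmetric]
    by (intro Bochner_Integration.integral_cong refl)
       (simp only: of_real_mult FF integral_mult_right_zero mult.commute[of _ "complex_of_real (exp _)"])
  also have "\<dots> = (LINT q|?P. LINT \<xi>|lborel. ?h \<xi> q)" by (rule LP.Fubini_integral[OF inth, symmetric])
  also have "\<dots> = (LINT q|?P. \<phi> q * of_real (2 * pi * ?n (fst q - snd q)))"
  proof (intro Bochner_Integration.integral_cong refl)
    fix q :: "real \<times> real"
    have cis: "cis (- (\<xi> * (fst q - snd q))) = iexp (\<xi> * (snd q - fst q))" for \<xi>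
      by (simp add: cis_conv_exp algebra_simps)
    have "(LINT \<xi>|lborel. ?h \<xi> q) = (LINT \<xi>|lborel. \<phi> q * (iexp (\<xi> * (snd q - fst q)) * of_real (?w \<xi>)))"
      unfolding cis by (intro Bochner_Integration.integral_cong refl) (simp only: mult_ac)
    also have "\<dots> = \<phi> q * of_real (2 * pi * ?n (snd q - fst q))"
      unfolding integral_mult_right_zero gaussian_fourier(1)[OF \<sigma>] ..
    finally show "(LINT \<xi>|lborel. ?h \<xi> q) = \<phi> q * of_real (2 * pi * ?n (fst q - snd q))"
      by (simp add: normal_density_def power2_commute)
  qed
  finally have eq: "complex_of_real (LINT \<xi>|lborel. (norm (F \<xi>))\<^sup>2 * ?w \<xi>)
      = (LINT q|?P. \<phi> q * of_real (2 * pi * ?n (fst q - snd q)))" .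
  have nint: "integrable lborel (\<lambda>y. ?n (x - y))" "(LINT y|lborel. ?n (x - y)) = 1" for x
    using integrable_reflect[of ?n x] \<sigma> by auto
  have nsym: "?n (x - y) = ?n (y - x)" for x y by (simp add: normal_density_def power2_commute)
  let ?a = "\<lambda>x y. (norm (g x))\<^sup>2 * ?n (x - y)"
  have ia: "integrable ?P (\<lambda>(x, y). ?a x y)"
    by (rule lborel_pair.Fubini_integrable) (use sq nint in \<open>auto simp: abs_mult\<close>)
  have Ia: "(LINT q|?P. ?a (fst q) (snd q)) = (LINT x|lborel. (norm (g x))\<^sup>2)"
    using lborel_pair.integral_fst[OF ia] nint by (simp add: split_beta')
  have ib: "integrable ?P (\<lambda>(x, y). ?a y x)"
    using lborel_pair.integrable_product_swap[OF ia] by (simp add: split_beta')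
  have Ib: "(LINT q|?P. ?a (snd q) (fst q)) = (LINT x|lborel. (norm (g x))\<^sup>2)"
    using lborel_pair.integral_snd[OF ib] nint by (simp add: split_beta')
  have "(LINT \<xi>|lborel. (norm (F \<xi>))\<^sup>2 * ?w \<xi>) \<le> norm (complex_of_real (LINT \<xi>|lborel. (norm (F \<xi>))\<^sup>2 * ?w \<xi>))"
    by simp
  also have "\<dots> \<le> (LINT q|?P. norm (\<phi> q * of_real (2 * pi * ?n (fst q - snd q))))"
    unfolding eq by (rule integral_norm_bound)
  \<comment> \<open>Schur's test: the inequality between arithmetic and geometric mean splits the
    product, and in each half one variable occurs only in the normal density and integrates to
    1.\<close>
  also have "\<dots> \<le> (LINT q|?P. pi * (?a (fst q) (snd q) + ?a (snd q) (fst q)))"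
  proof (rule Bochner_Integration.integral_mono')
    show "integrable ?P (\<lambda>q. pi * (?a (fst q) (snd q) + ?a (snd q) (fst q)))"
      using ia ib by (intro integrable_mult_right Bochner_Integration.integrable_add) (simp_all add: split_beta')
    fix q
    let ?x = "norm (g (fst q))" and ?y = "norm (g (snd q))" and ?m = "?n (fst q - snd q)"
    have "2 * (?x * ?y) \<le> ?x\<^sup>2 + ?y\<^sup>2"
      using zero_le_power2[of "?x - ?y"] by (simp add: power2_eq_square algebra_simps)
    then have "pi * ?m * (2 * (?x * ?y)) \<le> pi * ?m * (?x\<^sup>2 + ?y\<^sup>2)" by (intro mult_left_mono) auto
    moreover have "norm (\<phi> q * of_real (2 * pi * ?m)) = pi * ?m * (2 * (?x * ?y))"
      by (simp add: \<phi>_def norm_mult)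
    ultimately show "norm (\<phi> q * of_real (2 * pi * ?m)) \<le> pi * (?a (fst q) (snd q) + ?a (snd q) (fst q))"
      using nsym[of "snd q" "fst q"] by (simp add: algebra_simps)
  qed simp
  also have "\<dots> = 2 * pi * (LINT x|lborel. (norm (g x))\<^sup>2)"
    using ia ib Ia Ib by (simp add: split_beta')
  finally show "(LINT \<xi>|lborel. (norm (F \<xi>))\<^sup>2 * ?w \<xi>) \<le> 2 * pi * (LINT x|lborel. (norm (g x))\<^sup>2)" .
qed

text \<open>The Gaussian weights tend to 1 as they flatten, and Fatou's lemma passes the uniform
  bound to the unweighted integral.\<close>

lemma fourier_bessel:
  fixes g :: "real \<Rightarrow> complex"
  assumes g: "integrable lborel g" "square_integrable lborel g"
  defines "F \<equiv> \<lambda>\<xi>. LINT x|lborel. cis (- (\<xi> * x)) * g x"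
  shows "(\<integral>\<^sup>+\<xi>. ennreal ((norm (F \<xi>))\<^sup>2) \<partial>lborel) \<le> ennreal (2 * pi * (LINT x|lborel. (norm (g x))\<^sup>2))"
proof -
  have [measurable]: "g \<in> borel_measurable borel" using g by auto
  have [measurable]: "F \<in> borel_measurable borel" unfolding F_def by measurable
  let ?w = "\<lambda>n \<xi>. exp (- (1 / real (Suc n) * \<xi>)\<^sup>2 / 2)"
  let ?u = "\<lambda>n \<xi>. ennreal ((norm (F \<xi>))\<^sup>2 * ?w n \<xi>)"
  have lim: "(\<lambda>n. ?u n \<xi>) \<longlonglongrightarrow> ennreal ((norm (F \<xi>))\<^sup>2)" for \<xi>
  proof -
    have "(\<lambda>n. 1 / real (Suc n)) \<longlonglongrightarrow> 0" by (rule LIMSEQ_Suc[OF lim_1_over_n])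
    then have "(\<lambda>n. (norm (F \<xi>))\<^sup>2 * ?w n \<xi>) \<longlonglongrightarrow> (norm (F \<xi>))\<^sup>2 * exp (- (0 * \<xi>)\<^sup>2 / 2)"
      by (intro tendsto_intros) auto
    then show ?thesis by (intro tendsto_ennrealI) simp
  qed
  have "(\<integral>\<^sup>+\<xi>. ennreal ((norm (F \<xi>))\<^sup>2) \<partial>lborel) = (\<integral>\<^sup>+\<xi>. liminf (\<lambda>n. ?u n \<xi>) \<partial>lborel)"
    by (intro nn_integral_cong) (simp only: lim_imp_Liminf[OF sequentially_bot lim])
  also have "\<dots> \<le> liminf (\<lambda>n. \<integral>\<^sup>+\<xi>. ?u n \<xi> \<partial>lborel)" by (rule nn_integral_liminf) measurable
  also have "\<dots> \<le> liminf (\<lambda>n :: nat. ennreal (2 * pi * (LINT x|lborel. (norm (g x))\<^sup>2)))"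
  proof (intro Liminf_mono always_eventually allI)
    fix n
    have \<sigma>: "1 / real (Suc n) > 0" by simp
    have B: "(LINT \<xi>|lborel. (norm (F \<xi>))\<^sup>2 * ?w n \<xi>) \<le> 2 * pi * (LINT x|lborel. (norm (g x))\<^sup>2)"
      "integrable lborel (\<lambda>\<xi>. (norm (F \<xi>))\<^sup>2 * ?w n \<xi>)"
      unfolding F_def by (rule fourier_bessel_gaussian[OF g \<sigma>])+
    have "(\<integral>\<^sup>+\<xi>. ?u n \<xi> \<partial>lborel) = ennreal (LINT \<xi>|lborel. (norm (F \<xi>))\<^sup>2 * ?w n \<xi>)"
      by (rule nn_integral_eq_integral[OF B(2)]) simp
    also have "\<dots> \<le> ennreal (2 * pi * (LINT x|lborel. (norm (g x))\<^sup>2))" by (rule ennreal_leI[OF B(1)])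
    finally show "(\<integral>\<^sup>+\<xi>. ?u n \<xi> \<partial>lborel) \<le> ennreal (2 * pi * (LINT x|lborel. (norm (g x))\<^sup>2))" .
  qed
  also have "\<dots> = ennreal (2 * pi * (LINT x|lborel. (norm (g x))\<^sup>2))" by (simp add: Liminf_const)
  finally show ?thesis .
qed

text \<open>The factor 2 comes from splitting \<open>G\<close> into a truncated transform and a
  remainder that tends to 0 in L2. Only the order of magnitude matters, since the bound serves to
  estimate perturbations.\<close>

lemma has_L2_fourier_transform_bessel:
  assumes FT: "has_L2_fourier_transform g G"
  shows "(LINT \<xi>|lborel. (norm (G \<xi>))\<^sup>2) \<le> 2 * (LINT x|lborel. (norm (g x))\<^sup>2)"
proof -
  let ?I = "LINT x|lborel. (norm (g x))\<^sup>2"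
  have sq: "square_integrable lborel g" "square_integrable lborel G"
    and lim: "tendsto_L2 lborel (\<lambda>R. truncated_fourier R g) G at_top"
    using FT by (auto simp: has_L2_fourier_transform_iff)
  have [measurable]: "g \<in> borel_measurable borel" "G \<in> borel_measurable borel" using sq by (auto simp: square_integrable_def)
  note [measurable] = truncated_fourier_measurable
  have tr: "(\<integral>\<^sup>+\<xi>. ennreal ((norm (truncated_fourier R g \<xi>))\<^sup>2) \<partial>lborel) \<le> ennreal ?I" for R
  proof -
    let ?g = "\<lambda>x. indicator {-R..R} x *\<^sub>R g x"
    let ?F = "\<lambda>\<xi>. LINT x|lborel. cis (- (\<xi> * x)) * ?g x"
    have "(norm (truncated_fourier R g \<xi>))\<^sup>2 = 1 / (2 * pi) * (norm (?F \<xi>))\<^sup>2" for \<xi>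
      unfolding truncated_fourier_eq norm_mult power_mult_distrib by (simp add: norm_divide power_divide)
    then have "(\<integral>\<^sup>+\<xi>. ennreal ((norm (truncated_fourier R g \<xi>))\<^sup>2) \<partial>lborel)
        = (\<integral>\<^sup>+\<xi>. ennreal (1 / (2 * pi)) * ennreal ((norm (?F \<xi>))\<^sup>2) \<partial>lborel)"
      by (intro nn_integral_cong) (simp only: ennreal_mult''[OF zero_le_power2])
    also have "\<dots> = ennreal (1 / (2 * pi)) * (\<integral>\<^sup>+\<xi>. ennreal ((norm (?F \<xi>))\<^sup>2) \<partial>lborel)"
      by (rule nn_integral_cmult) measurable
    also have "\<dots> \<le> ennreal (1 / (2 * pi)) * ennreal (2 * pi * (LINT x|lborel. (norm (?g x))\<^sup>2))"
      by (intro mult_left_mono fourier_bessel square_integrable_truncation sq) simp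
    also have "\<dots> = ennreal (LINT x|lborel. (norm (?g x))\<^sup>2)" by (simp add: ennreal_mult''[symmetric])
    also have "\<dots> \<le> ennreal ?I" by (intro ennreal_leI square_integrable_truncation sq)
    finally show ?thesis .
  qed
  have bound: "(\<integral>\<^sup>+\<xi>. ennreal ((norm (G \<xi>))\<^sup>2) \<partial>lborel)
      \<le> 2 * ennreal ?I + 2 * (\<integral>\<^sup>+\<xi>. ennreal ((norm (truncated_fourier R g \<xi> - G \<xi>))\<^sup>2) \<partial>lborel)" for R
  proof -
    have "(\<integral>\<^sup>+\<xi>. ennreal ((norm (G \<xi>))\<^sup>2) \<partial>lborel)
        \<le> (\<integral>\<^sup>+\<xi>. 2 * ennreal ((norm (truncated_fourier R g \<xi>))\<^sup>2)
            + 2 * ennreal ((norm (truncated_fourier R g \<xi> - G \<xi>))\<^sup>2) \<partial>lborel)"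
    proof (intro nn_integral_mono)
      fix \<xi>
      have "(norm (G \<xi>))\<^sup>2 \<le> 2 * (norm (truncated_fourier R g \<xi>))\<^sup>2 + 2 * (norm (truncated_fourier R g \<xi> - G \<xi>))\<^sup>2"
        using norm_add_sq_le[of "truncated_fourier R g \<xi>" "G \<xi> - truncated_fourier R g \<xi>"]
        by (simp add: norm_minus_commute)
      from ennreal_leI[OF this]
      show "ennreal ((norm (G \<xi>))\<^sup>2) \<le> 2 * ennreal ((norm (truncated_fourier R g \<xi>))\<^sup>2)
          + 2 * ennreal ((norm (truncated_fourier R g \<xi> - G \<xi>))\<^sup>2)"
        by (simp add: ennreal_mult'' ennreal_plus)
    qed
    also have "\<dots> = 2 * (\<integral>\<^sup>+\<xi>. ennreal ((norm (truncated_fourier R g \<xi>))\<^sup>2) \<partial>lborel)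
        + 2 * (\<integral>\<^sup>+\<xi>. ennreal ((norm (truncated_fourier R g \<xi> - G \<xi>))\<^sup>2) \<partial>lborel)"
      by (subst nn_integral_add) (auto simp: nn_integral_cmult)
    also have "\<dots> \<le> 2 * ennreal ?I + 2 * (\<integral>\<^sup>+\<xi>. ennreal ((norm (truncated_fourier R g \<xi> - G \<xi>))\<^sup>2) \<partial>lborel)"
      by (intro add_right_mono mult_left_mono tr) simp
    finally show ?thesis .
  qed
  have "((\<lambda>R. 2 * ennreal ?I + 2 * (\<integral>\<^sup>+\<xi>. ennreal ((norm (truncated_fourier R g \<xi> - G \<xi>))\<^sup>2) \<partial>lborel))
      \<longlongrightarrow> 2 * ennreal ?I + 2 * 0) at_top"
    using lim unfolding tendsto_L2_def by (intro tendsto_add tendsto_const ennreal_tendsto_cmult) auto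
  then have "(\<integral>\<^sup>+\<xi>. ennreal ((norm (G \<xi>))\<^sup>2) \<partial>lborel) \<le> 2 * ennreal ?I + 2 * 0"
    by (rule tendsto_lowerbound) (intro always_eventually allI bound, simp)
  also have "2 * ennreal ?I + 2 * 0 = ennreal (2 * ?I)" by (simp add: ennreal_mult'')
  finally have "(\<integral>\<^sup>+\<xi>. ennreal ((norm (G \<xi>))\<^sup>2) \<partial>lborel) \<le> ennreal (2 * ?I)" .
  moreover have "(\<integral>\<^sup>+\<xi>. ennreal ((norm (G \<xi>))\<^sup>2) \<partial>lborel) = ennreal (LINT \<xi>|lborel. (norm (G \<xi>))\<^sup>2)"
    using sq by (intro nn_integral_eq_integral) (auto simp: square_integrable_def)
  ultimately show ?thesis by (simp add: ennreal_le_iff integral_nonneg_AE)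
qed

section \<open>The harmonizable kernel\<close>

definition harm_kernel :: "real \<Rightarrow> real \<Rightarrow> real \<Rightarrow> complex" where
  "harm_kernel h t \<xi> = (cis (t * \<xi>) - 1) / complex_of_real (\<bar>\<xi>\<bar> powr (h + 1/2))"

lemma harm_kernel_measurable [measurable]: "harm_kernel h t \<in> borel_measurable borel"
  unfolding harm_kernel_def by measurable

text \<open>On the frequency side a shift in time is a modulation. The factors are grouped as
  \<open>r powr h\<close> times a modulated, norm-preserving dilation, whose transform is
  known.\<close>

lemma harm_kernel_scaling:
  assumes "r > 0"
  shows "harm_kernel h (r * s + t) \<xi> - harm_kernel h t \<xi>
    = of_real (r powr h) * (cis (t * \<xi>) * (of_real (sqrt r) * harm_kernel h s (r * \<xi>)))"
proof -
  have 1: "cis ((r * s + t) * \<xi>) - cis (t * \<xi>) = cis (t * \<xi>) * (cis (s * (r * \<xi>)) - 1)"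
    by (simp add: cis_mult algebra_simps)
  have "\<bar>r * \<xi>\<bar> powr (h + 1/2) = r powr (h + 1/2) * \<bar>\<xi>\<bar> powr (h + 1/2)"
    using assms by (simp add: abs_mult powr_mult)
  also have "r powr (h + 1/2) = r powr h * sqrt r" using assms by (simp add: powr_add powr_half_sqrt)
  finally have 2: "complex_of_real (\<bar>r * \<xi>\<bar> powr (h + 1/2))
      = of_real (r powr h) * of_real (sqrt r) * of_real (\<bar>\<xi>\<bar> powr (h + 1/2))" by simp
  have ne: "complex_of_real (r powr h) \<noteq> 0" "complex_of_real (sqrt r) \<noteq> 0" using assms by auto
  have "harm_kernel h (r * s + t) \<xi> - harm_kernel h t \<xi>
      = cis (t * \<xi>) * (cis (s * (r * \<xi>)) - 1) / of_real (\<bar>\<xi>\<bar> powr (h + 1/2))"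
    unfolding harm_kernel_def diff_divide_distrib[symmetric] 1[symmetric] by simp
  also have "\<dots> = of_real (r powr h) * (cis (t * \<xi>) * (of_real (sqrt r) * harm_kernel h s (r * \<xi>)))"
    unfolding harm_kernel_def 2 using ne by (simp add: divide_simps)
  finally show ?thesis .
qed

lemma norm_cis_diff_one_le: "norm (cis x - 1) \<le> \<bar>x\<bar>" "norm (cis x - 1) \<le> 2"
  using norm_iexp_diff_le[of x 0] norm_triangle_ineq4[of "cis x" 1] by (simp_all add: cis_conv_exp)

text \<open>Near frequency 0 the numerator gains the factor \<open>t * \<bar>\<xi>\<bar>\<close>,
  and \<open>2 * (b - \<delta>) + 2 > -1\<close> because \<open>h + \<delta> < 1\<close>. At
  infinity it is bounded by 2, and \<open>2 * (b + \<delta>) < -1\<close> because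
  \<open>\<delta> < h\<close>.\<close>

lemma harm_kernel_perturb:
  assumes h: "0 < h" "h < 1" and "T \<ge> 0"
  shows "\<exists>C \<delta>. \<delta> > 0 \<and> (\<forall>\<eta> t. \<bar>\<eta>\<bar> \<le> \<delta> \<longrightarrow> 0 \<le> t \<longrightarrow> t \<le> T \<longrightarrow>
    (LINT \<xi>|lborel. (norm (harm_kernel (h + \<eta>) t \<xi> - harm_kernel h t \<xi>))\<^sup>2) \<le> C * \<eta>\<^sup>2)"
proof -
  define \<delta> where "\<delta> = min h (1 - h) / 2"
  have \<delta>: "\<delta> > 0" "\<delta> < h" "h + \<delta> < 1" using h by (auto simp: \<delta>_def min_def field_simps)
  define b where "b = - (h + 1/2)"
  define env where "env y = (2 * T / \<delta>)\<^sup>2 * (indicator {0..1} y * y powr (2 * (b - \<delta>) + 2))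
      + (4 / \<delta>)\<^sup>2 * (indicator {1..} y * y powr (2 * (b + \<delta>)))" for y :: real
  have env: "integrable lborel env" unfolding env_def
    by (intro Bochner_Integration.integrable_add integrable_mult_right integrable_powr_from_0 integrable_powr_to_inf)
       (use \<delta> in \<open>auto simp: b_def\<close>)
  define Env where "Env \<xi> = env \<xi> + env (0 - \<xi>)" for \<xi>
  have Env: "integrable lborel Env" unfolding Env_def
    by (intro Bochner_Integration.integrable_add env integrable_reflect(1))
  have env_nn: "env y \<ge> 0" for y by (auto simp: env_def)
  have main: "(norm (harm_kernel (h + \<eta>) t \<xi> - harm_kernel h t \<xi>))\<^sup>2 \<le> \<eta>\<^sup>2 * Env \<xi>"
    if \<eta>: "\<bar>\<eta>\<bar> \<le> \<delta>" and t: "0 \<le> t" "t \<le> T" for \<eta> t \<xi>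
  proof (cases "\<xi> = 0")
    case True
    then show ?thesis using env_nn by (simp add: harm_kernel_def Env_def)
  next
    case False
    define y where "y = \<bar>\<xi>\<bar>"
    have "y > 0" using False by (simp add: y_def)
    \<comment> \<open>The Hurst parameter sits in the denominator, so raising it by
      \<open>\<eta>\<close> lowers the exponent \<open>b\<close> by \<open>\<eta>\<close>.\<close>
    have pw: "\<bar>y powr (b - \<eta>) - y powr b\<bar> \<le> \<bar>\<eta>\<bar> / \<delta> * (y powr (b + \<delta>) + y powr (b - \<delta>))"
      using pos_powr_diff_le[of "- \<eta>" \<delta> b y] \<eta> \<delta> \<open>y > 0\<close> by (simp add: pos_powr_def)
    have "b - \<eta> = - (h + \<eta> + 1/2)" by (simp add: b_def)
    then have p: "y powr (b - \<eta>) = inverse (y powr (h + \<eta> + 1/2))" "y powr b = inverse (y powr (h + 1/2))"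
      by (simp_all only: powr_minus b_def)
    have "harm_kernel (h + \<eta>) t \<xi> - harm_kernel h t \<xi> = (cis (t * \<xi>) - 1) * of_real (y powr (b - \<eta>) - y powr b)"
      unfolding harm_kernel_def y_def[symmetric] p of_real_diff of_real_inverse divide_inverse
      by (simp only: right_diff_distrib)
    then have n: "norm (harm_kernel (h + \<eta>) t \<xi> - harm_kernel h t \<xi>) = norm (cis (t * \<xi>) - 1) * \<bar>y powr (b - \<eta>) - y powr b\<bar>"
      by (simp only: norm_mult norm_of_real)
    have "env y \<le> Env \<xi>" using env_nn[of \<xi>] env_nn[of "0 - \<xi>"] by (cases "\<xi> > 0") (auto simp: Env_def y_def)
    moreover have "(norm (harm_kernel (h + \<eta>) t \<xi> - harm_kernel h t \<xi>))\<^sup>2 \<le> \<eta>\<^sup>2 * env y"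
    proof (cases "y \<le> 1")
      case True
      have "norm (cis (t * \<xi>) - 1) \<le> t * y" using norm_cis_diff_one_le(1)[of "t * \<xi>"] t by (simp add: abs_mult y_def)
      also have "\<dots> \<le> T * y" using t \<open>y > 0\<close> by (intro mult_right_mono) auto
      finally have c: "norm (cis (t * \<xi>) - 1) \<le> T * y" .
      have "y powr (b + \<delta>) \<le> y powr (b - \<delta>)" using True \<open>y > 0\<close> \<delta> by (intro powr_mono') auto
      then have "\<bar>\<eta>\<bar> / \<delta> * (y powr (b + \<delta>) + y powr (b - \<delta>)) \<le> \<bar>\<eta>\<bar> / \<delta> * (2 * y powr (b - \<delta>))"
        using \<delta> by (intro mult_left_mono) auto
      with pw have "\<bar>y powr (b - \<eta>) - y powr b\<bar> \<le> \<bar>\<eta>\<bar> / \<delta> * (2 * y powr (b - \<delta>))" by linarith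
      then have "norm (harm_kernel (h + \<eta>) t \<xi> - harm_kernel h t \<xi>) \<le> T * y * (\<bar>\<eta>\<bar> / \<delta> * (2 * y powr (b - \<delta>)))"
        unfolding n using \<open>T \<ge> 0\<close> \<open>y > 0\<close> by (intro mult_mono c) auto
      then have "(norm (harm_kernel (h + \<eta>) t \<xi> - harm_kernel h t \<xi>))\<^sup>2 \<le> (T * y * (\<bar>\<eta>\<bar> / \<delta> * (2 * y powr (b - \<delta>))))\<^sup>2"
        by (intro power_mono) auto
      also have "\<dots> = \<eta>\<^sup>2 * ((2 * T / \<delta>)\<^sup>2 * (y powr (2 * (b - \<delta>)) * y\<^sup>2))"
        by (simp add: power_mult_distrib power_divide powr_square)
      also have "y powr (2 * (b - \<delta>)) * y\<^sup>2 = y powr (2 * (b - \<delta>) + 2)"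
        using \<open>y > 0\<close> by (simp add: powr_add)
      also have "\<eta>\<^sup>2 * ((2 * T / \<delta>)\<^sup>2 * y powr (2 * (b - \<delta>) + 2)) \<le> \<eta>\<^sup>2 * env y"
        using True \<open>y > 0\<close> by (intro mult_left_mono) (auto simp: env_def)
      finally show ?thesis .
    next
      case False
      then have "y powr (b - \<delta>) \<le> y powr (b + \<delta>)" using \<delta> by (intro powr_mono) auto
      then have "\<bar>\<eta>\<bar> / \<delta> * (y powr (b + \<delta>) + y powr (b - \<delta>)) \<le> \<bar>\<eta>\<bar> / \<delta> * (2 * y powr (b + \<delta>))"
        using \<delta> by (intro mult_left_mono) auto
      with pw have "\<bar>y powr (b - \<eta>) - y powr b\<bar> \<le> \<bar>\<eta>\<bar> / \<delta> * (2 * y powr (b + \<delta>))" by linarith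
      then have "norm (harm_kernel (h + \<eta>) t \<xi> - harm_kernel h t \<xi>) \<le> 2 * (\<bar>\<eta>\<bar> / \<delta> * (2 * y powr (b + \<delta>)))"
        unfolding n by (intro mult_mono norm_cis_diff_one_le(2)) auto
      then have "(norm (harm_kernel (h + \<eta>) t \<xi> - harm_kernel h t \<xi>))\<^sup>2 \<le> (2 * (\<bar>\<eta>\<bar> / \<delta> * (2 * y powr (b + \<delta>))))\<^sup>2"
        by (intro power_mono) auto
      also have "\<dots> = \<eta>\<^sup>2 * ((4 / \<delta>)\<^sup>2 * y powr (2 * (b + \<delta>)))"
        by (simp add: power_mult_distrib power_divide powr_square)
      also have "\<dots> \<le> \<eta>\<^sup>2 * env y"
        using False by (intro mult_left_mono) (auto simp: env_def)
      finally show ?thesis .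
    qed
    ultimately show ?thesis by (meson mult_left_mono order_trans zero_le_power2)
  qed
  have "(LINT \<xi>|lborel. (norm (harm_kernel (h + \<eta>) t \<xi> - harm_kernel h t \<xi>))\<^sup>2) \<le> (LINT \<xi>|lborel. Env \<xi>) * \<eta>\<^sup>2"
    if \<eta>: "\<bar>\<eta>\<bar> \<le> \<delta>" and t: "0 \<le> t" "t \<le> T" for \<eta> t
  proof -
    have dom: "integrable lborel (\<lambda>\<xi>. \<eta>\<^sup>2 * Env \<xi>)" using Env by (rule integrable_mult_right)
    have int: "integrable lborel (\<lambda>\<xi>. (norm (harm_kernel (h + \<eta>) t \<xi> - harm_kernel h t \<xi>))\<^sup>2)"
      by (rule Bochner_Integration.integrable_bound[OF dom])
         (use main[OF that] in \<open>auto intro: order_trans[OF _ abs_ge_self]\<close>)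
    have "(LINT \<xi>|lborel. (norm (harm_kernel (h + \<eta>) t \<xi> - harm_kernel h t \<xi>))\<^sup>2) \<le> (LINT \<xi>|lborel. \<eta>\<^sup>2 * Env \<xi>)"
      by (rule integral_mono[OF int dom main[OF that]])
    then show ?thesis by (simp add: mult.commute)
  qed
  with \<delta>(1) show ?thesis by blast
qed

text \<open>The value is real, so taking real parts leaves the random variable as it is and turns
  the complex kernel into a real one.\<close>

lemma harmonizable_value_imp_wiener:
  assumes W: "two_sided_brownian_motion M W" and hv: "harmonizable_value M W h t X"
  obtains G where "has_L2_fourier_transform (harm_kernel h t) G" "has_wiener_integral M W (\<lambda>x. Re (G x)) X"
proof -
  obtain G where G: "has_L2_fourier_transform (harm_kernel h t) G"
    "has_wiener_integral M W G (\<lambda>\<omega>. complex_of_real (X \<omega>))"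
    using hv unfolding harmonizable_value_def has_fourier_wiener_integral_def harm_kernel_def[abs_def] by blast
  have "has_wiener_integral M W (\<lambda>x. Re (G x)) X"
    using has_wiener_integral_bounded_linear[OF W G(2) bounded_linear_Re] by simp
  with G(1) show ?thesis by (rule that)
qed

lemma integral_Re_square_le:
  fixes G :: "real \<Rightarrow> complex"
  assumes "square_integrable lborel G"
  shows "(LINT x|lborel. (Re (G x))\<^sup>2) \<le> (LINT x|lborel. (norm (G x))\<^sup>2)"
proof (rule integral_mono)
  have "(Re z)\<^sup>2 \<le> (norm z)\<^sup>2" for z using power_mono[OF abs_Re_le_cmod[of z], of 2] by simp
  then show "(Re (G x))\<^sup>2 \<le> (norm (G x))\<^sup>2" for x .
  show "integrable lborel (\<lambda>x. (norm (G x))\<^sup>2)" using assms by (simp add: square_integrable_def)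
  show "integrable lborel (\<lambda>x. (Re (G x))\<^sup>2)"
    using square_integrable_bounded_linear[OF assms bounded_linear_Re] by (simp add: square_integrable_def)
qed

lemma harm_transform_near:
  assumes "has_L2_fourier_transform (harm_kernel h' t) G'" "has_L2_fourier_transform (harm_kernel h t) G"
  shows "(LINT x|lborel. (Re (G' x) - Re (G x))\<^sup>2)
    \<le> 2 * (LINT \<xi>|lborel. (norm (harm_kernel h' t \<xi> - harm_kernel h t \<xi>))\<^sup>2)"
proof -
  note D = has_L2_fourier_transform_diff[OF assms]
  have "(LINT x|lborel. (Re (G' x) - Re (G x))\<^sup>2) = (LINT x|lborel. (Re (G' x - G x))\<^sup>2)" by simp
  also have "\<dots> \<le> (LINT x|lborel. (norm (G' x - G x))\<^sup>2)"
    using D by (intro integral_Re_square_le) (simp add: has_L2_fourier_transform_iff)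
  also have "\<dots> \<le> 2 * (LINT \<xi>|lborel. (norm (harm_kernel h' t \<xi> - harm_kernel h t \<xi>))\<^sup>2)"
    by (rule has_L2_fourier_transform_bessel[OF D])
  finally show ?thesis .
qed

lemma has_L2_fourier_transform_cmult:
  assumes "has_L2_fourier_transform g G"
  shows "has_L2_fourier_transform (\<lambda>x. c * g x) (\<lambda>\<xi>. c * G \<xi>)"
proof -
  have sq: "square_integrable lborel g" "square_integrable lborel G"
    using assms by (auto simp: has_L2_fourier_transform_iff)
  have m: "truncated_fourier R g \<in> borel_measurable lborel" "G \<in> borel_measurable lborel" for R
    using sq by (auto simp: square_integrable_def intro!: truncated_fourier_measurable)
  have "tendsto_L2 lborel (\<lambda>R \<xi>. c * truncated_fourier R g \<xi>) (\<lambda>\<xi>. c * G \<xi>) at_top"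
    using assms m by (intro tendsto_L2_bounded_linear[OF _ bounded_linear_mult_right]) (auto simp: has_L2_fourier_transform_iff)
  moreover have "truncated_fourier R (\<lambda>x. c * g x) = (\<lambda>\<xi>. c * truncated_fourier R g \<xi>)" for R
  proof
    fix \<xi>
    have "(LINT x|lborel. cis (- (\<xi> * x)) * (indicator {-R..R} x *\<^sub>R (c * g x)))
        = (LINT x|lborel. c * (cis (- (\<xi> * x)) * (indicator {-R..R} x *\<^sub>R g x)))"
      by (intro Bochner_Integration.integral_cong refl) (simp only: scaleR_conv_of_real mult_ac)
    then show "truncated_fourier R (\<lambda>x. c * g x) \<xi> = c * truncated_fourier R g \<xi>"
      unfolding truncated_fourier_eq integral_mult_right_zero by (simp only: mult_ac)
  qed
  ultimately show ?thesis
    using square_integrable_bounded_linear[OF sq(1) bounded_linear_mult_right]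
      square_integrable_bounded_linear[OF sq(2) bounded_linear_mult_right]
    by (simp add: has_L2_fourier_transform_iff)
qed

text \<open>Two L2 transforms of the same function agree almost everywhere: one is the difference of
  \<open>G1\<close> and \<open>G2\<close>, the other comes from dilating and modulating the kernel
  of \<open>G3\<close>.\<close>

lemma harm_transform_scaling:
  assumes "r > 0" and G: "has_L2_fourier_transform (harm_kernel h (r * s + t)) G1"
    "has_L2_fourier_transform (harm_kernel h t) G2" "has_L2_fourier_transform (harm_kernel h s) G3"
  shows "AE u in lborel. Re (G1 u) - Re (G2 u) = r powr (h - 1/2) * Re (G3 ((u - t) / r))"
proof -
  have "has_L2_fourier_transform (\<lambda>\<xi>. harm_kernel h (r * s + t) \<xi> - harm_kernel h t \<xi>)
      (\<lambda>u. of_real (r powr h) * (of_real (1 / sqrt r) * G3 ((u - t) / r)))"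
    unfolding harm_kernel_scaling[OF \<open>r > 0\<close>]
    by (rule has_L2_fourier_transform_cmult[OF has_L2_fourier_transform_affine[OF G(3) \<open>r > 0\<close>]])
  from has_L2_fourier_transform_unique[OF has_L2_fourier_transform_diff[OF G(1,2)] this]
  show ?thesis
  proof eventually_elim
    case (elim u)
    have "r powr h * (1 / sqrt r) = r powr (h - 1/2)"
      using \<open>r > 0\<close> by (simp add: powr_diff powr_half_sqrt)
    then have "G1 u - G2 u = of_real (r powr (h - 1/2)) * G3 ((u - t) / r)"
      unfolding elim mult.assoc[symmetric] of_real_mult[symmetric] by simp
    then have "Re (G1 u - G2 u) = Re (of_real (r powr (h - 1/2)) * G3 ((u - t) / r))" by (rule arg_cong)
    then show ?case by simp
  qed
qed

section \<open>Convergence in law\<close>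

text \<open>The path integrals of \<open>f\<close> and the local time agree only almost surely with
  measurable functions. On the completion such a function is measurable and has the law of its
  measurable version.\<close>

lemma measurable_completion_AE_eq:
  fixes F E :: "'a \<Rightarrow> real"
  assumes [measurable]: "E \<in> borel_measurable M" and AE: "AE \<omega> in M. F \<omega> = E \<omega>"
  shows "F \<in> borel_measurable (completion M)" "distr (completion M) borel F = distr M borel E"
proof -
  have Ec: "E \<in> borel_measurable (completion M)" by (simp add: measurable_completion)
  have AEc: "AE \<omega> in completion M. F \<omega> = E \<omega>" by (rule AE_completion[OF AE])
  show Fc: "F \<in> borel_measurable (completion M)"
  proof (rule measurableI)
    fix A :: "real set" assume A: "A \<in> sets borel"
    show "F -` A \<inter> space (completion M) \<in> sets (completion M)"
    proof (rule completion.in_sets_AE)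
      show "AE \<omega> in completion M. (\<omega> \<in> E -` A \<inter> space (completion M)) = (\<omega> \<in> F -` A \<inter> space (completion M))"
        using AEc by eventually_elim auto
      show "E -` A \<inter> space (completion M) \<in> sets (completion M)" by (rule measurable_sets[OF Ec A])
    qed auto
  qed simp
  have "distr (completion M) borel F = distr (completion M) borel E"
    by (rule distr_cong_AE[OF refl refl AEc Fc Ec])
  also have "\<dots> = distr M borel E" by (rule distr_completion) simp
  finally show "distr (completion M) borel F = distr M borel E" .
qed

lemma real_distribution_distr_of_prob_space:
  assumes "prob_space M" "E \<in> borel_measurable M"
  shows "real_distribution (distr M borel E)"
  using prob_space.real_distribution_distr[OF assms(1)] assms(2) by simp

lemma char_distr_eq:
  assumes "E \<in> borel_measurable M"
  shows "char (distr M borel E) \<theta> = (CLINT \<omega>|M. iexp (\<theta> * E \<omega>))"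
  unfolding char_def using assms by (subst integral_distr) auto

text \<open>Levy's continuity theorem speaks of sequences, and a limit along
  \<open>at_right 0\<close> is tested on positive null sequences. The bound \<open>a\<close> is
  there because the laws are identified for small \<open>r\<close> only.\<close>

lemma converges_in_law_at_right_sequentially:
  fixes P :: "real \<Rightarrow> real measure"
  assumes Q: "real_distribution Q" and "a > 0"
    and P: "\<And>r. 0 < r \<Longrightarrow> r < a \<Longrightarrow> real_distribution (P r)"
    and conv: "\<And>r \<theta>. (\<And>n. 0 < r n) \<Longrightarrow> (\<And>n. r n < a) \<Longrightarrow> r \<longlonglongrightarrow> 0 \<Longrightarrow> (\<lambda>n. char (P (r n)) \<theta>) \<longlonglongrightarrow> char Q \<theta>"
  shows "converges_in_law P Q (at_right 0)"
  unfolding converges_in_law_def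
proof (intro conjI allI impI)
  show "\<forall>\<^sub>F r in at_right 0. real_distribution (P r)"
    using eventually_at_right_less eventually_at_right_real[OF \<open>a > 0\<close>] by eventually_elim (auto intro: P)
  fix x assume x: "isCont (cdf Q) x"
  show "((\<lambda>r. cdf (P r) x) \<longlongrightarrow> cdf Q x) (at_right 0)"
  proof (rule tendsto_at_right_sequentially[OF \<open>a > 0\<close>])
    fix r :: "nat \<Rightarrow> real" assume r: "\<And>n. 0 < r n" "\<And>n. r n < a" "r \<longlonglongrightarrow> 0"
    have "weak_conv_m (\<lambda>n. P (r n)) Q"
      by (rule levy_continuity[OF P[OF r(1,2)] Q conv[OF r]])
    then show "(\<lambda>n. cdf (P (r n)) x) \<longlonglongrightarrow> cdf Q x"
      using x by (simp add: weak_conv_m_def weak_conv_def)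
  qed
qed fact

lemma converges_in_law_at_top_sequentially:
  fixes P :: "real \<Rightarrow> real measure"
  assumes Q: "real_distribution Q" and P: "\<And>r. real_distribution (P r)"
    and conv: "\<And>r \<theta>. filterlim r at_top sequentially \<Longrightarrow> (\<lambda>n. char (P (r n)) \<theta>) \<longlonglongrightarrow> char Q \<theta>"
  shows "converges_in_law P Q at_top"
  unfolding converges_in_law_def
proof (intro conjI allI impI)
  fix x assume x: "isCont (cdf Q) x"
  show "((\<lambda>r. cdf (P r) x) \<longlongrightarrow> cdf Q x) at_top"
  proof (rule tendsto_at_topI_sequentially)
    fix r :: "nat \<Rightarrow> real" assume r: "filterlim r at_top sequentially"
    have "weak_conv_m (\<lambda>n. P (r n)) Q" by (rule levy_continuity[OF P Q conv[OF r]])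
    then show "(\<lambda>n. cdf (P (r n)) x) \<longlonglongrightarrow> cdf Q x"
      using x by (simp add: weak_conv_m_def weak_conv_def)
  qed
qed (simp_all add: P Q)

section \<open>The inner and the outer limit\<close>

context self_similar_kernels
begin

text \<open>Allows \<open>f\<close> to be replaced by a Borel function equal to it off a null set:
  by the occupation bound for the indicator of \<open>Z\<close>, the process almost surely spends no
  time there.\<close>

lemma occupation_null:
  assumes "t \<ge> 0" and Z: "Z \<in> null_sets lborel"
  obtains r0 where "r0 > 0"
    "\<And>r. r > 0 \<Longrightarrow> r < r0 \<Longrightarrow> AE \<omega> in M. AE s in restrict_space lborel {0..t}. Y r s \<omega> \<notin> Z"
proof -
  let ?T = "restrict_space lborel {0..t}"
  obtain r0 where r0: "r0 > 0" "\<And>r s. r > 0 \<Longrightarrow> r < r0 \<Longrightarrow> s > 0 \<Longrightarrow> s \<le> t \<Longrightarrow>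
    (LINT u|lborel. (z r s u + e r s u)\<^sup>2) \<ge> s powr (2 * h) * v / 4"
    by (rule variance_Y_ge[OF \<open>t \<ge> 0\<close>]) blast
  show thesis
  proof (rule that[OF r0(1)])
    fix r assume r: "0 < r" "r < r0"
    interpret T: finite_measure ?T by (rule finite_measure_restrict_interval)
    interpret TM: pair_sigma_finite ?T M ..
    have [measurable]: "Z \<in> sets borel" using Z by auto
    have Y2 [measurable]: "(\<lambda>q. Y r (fst q) (snd q)) \<in> borel_measurable (?T \<Otimes>\<^sub>M M)"
      using measurable_Y[OF r(1)] by (simp add: split_beta')
    have "(\<integral>\<^sup>+s. \<integral>\<^sup>+\<omega>. indicator Z (Y r s \<omega>) \<partial>M \<partial>?T)
        \<le> ennreal (2 / sqrt v * (t powr (1 - h) / (1 - h))) * (\<integral>\<^sup>+x. indicator Z x \<partial>lborel)"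
      by (rule occupation_bound[OF W wiener_Y[OF r(1)] r0(2)[OF r] _ \<open>t \<ge> 0\<close>]) auto
    also have "\<dots> = 0" using Z by (simp add: null_sets_def)
    finally have "(\<integral>\<^sup>+s. \<integral>\<^sup>+\<omega>. indicator Z (Y r s \<omega>) \<partial>M \<partial>?T) = 0" by simp
    also have "(\<integral>\<^sup>+s. \<integral>\<^sup>+\<omega>. indicator Z (Y r s \<omega>) \<partial>M \<partial>?T) = (\<integral>\<^sup>+q. indicator Z (Y r (fst q) (snd q)) \<partial>(?T \<Otimes>\<^sub>M M))"
      by (subst M.nn_integral_fst[symmetric]) auto
    finally have "AE q in ?T \<Otimes>\<^sub>M M. indicator Z (Y r (fst q) (snd q)) = (0 :: ennreal)"
      by (subst (asm) nn_integral_0_iff_AE) auto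
    then have "AE q in ?T \<Otimes>\<^sub>M M. Y r (fst q) (snd q) \<notin> Z"
      by eventually_elim (auto simp: indicator_def split: if_splits)
    then have "AE s in ?T. AE \<omega> in M. Y r s \<omega> \<notin> Z" by (drule_tac TM.AE_pair) simp
    then show "AE \<omega> in M. AE s in ?T. Y r s \<omega> \<notin> Z"
      by (subst (asm) TM.AE_commute) (auto intro: measurable_sets_Collect)
  qed
qed

lemma occupation_functional_measurable:
  fixes g :: "real \<Rightarrow> real"
  assumes "g \<in> borel_measurable borel" "r > 0"
  shows "(\<lambda>\<omega>. LINT s|restrict_space lborel {0..t}. g (Y r s \<omega>)) \<in> borel_measurable M"
    and "(\<lambda>\<omega>. LINT s|restrict_space lborel {0..t}. g (X s \<omega>)) \<in> borel_measurable N"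
proof -
  interpret T: finite_measure "restrict_space lborel {0..t}" by (rule finite_measure_restrict_interval)
  show "(\<lambda>\<omega>. LINT s|restrict_space lborel {0..t}. g (Y r s \<omega>)) \<in> borel_measurable M"
    by (rule time_integral_measurable[OF T.sigma_finite_measure_axioms measurable_Y[OF assms(2)] assms(1)])
  show "(\<lambda>\<omega>. LINT s|restrict_space lborel {0..t}. g (X s \<omega>)) \<in> borel_measurable N"
    by (rule time_integral_measurable[OF T.sigma_finite_measure_axioms measurable_X assms(1)])
qed

text \<open>The change of variables \<open>s = \<Lambda> u\<close> absorbs the horizon \<open>\<Lambda> t\<close> into the space scale
  \<open>\<Lambda> powr h\<close> of the rescaled function, so that only the horizon \<open>t\<close> has to be treated.\<close>

lemma rescaled_functional_eq:
  fixes f f' :: "real \<Rightarrow> real"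
  assumes "\<Lambda> > 0" "\<rho> > 0" "t \<ge> 0" and [measurable]: "f' \<in> borel_measurable borel" and \<omega>: "\<omega> \<in> space M"
    and Z: "\<And>x. x \<notin> Z \<Longrightarrow> f x = f' x" "AE s in restrict_space lborel {0..\<Lambda> * t}. Y \<rho> s \<omega> \<notin> Z"
  shows "1 / \<Lambda> powr (1 - h) * (LINT s:{0..\<Lambda> * t}|lebesgue. f (Y \<rho> s \<omega>))
    = (LINT s|restrict_space lborel {0..t}. \<Lambda> powr h * f' (\<Lambda> powr h * Y (\<rho> * \<Lambda>) s \<omega>))"
proof -
  have [measurable]: "(\<lambda>s. Y \<rho> s \<omega>) \<in> borel_measurable (restrict_space lborel {0..\<Lambda> * t})"
    by (rule measurable_section[OF measurable_Y[OF \<open>\<rho> > 0\<close>] \<omega>])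
  have "(\<lambda>s. f' (Y \<rho> s \<omega>)) \<in> borel_measurable (restrict_space lborel {0..\<Lambda> * t})" by measurable
  then have m: "(\<lambda>s. indicator {0..\<Lambda> * t} s *\<^sub>R f' (Y \<rho> s \<omega>)) \<in> borel_measurable lborel"
    by (subst (asm) borel_measurable_restrict_space_iff) auto
  have mc: "(\<lambda>s. indicator {0..\<Lambda> * t} s *\<^sub>R f' (Y \<rho> s \<omega>)) \<in> borel_measurable lebesgue"
    by (rule measurable_completion[OF m])
  have "AE s in lborel. s \<in> {0..\<Lambda> * t} \<longrightarrow> Y \<rho> s \<omega> \<notin> Z"
    using Z(2) by (subst (asm) AE_restrict_space_iff) auto
  then have "AE s in lborel. indicator {0..\<Lambda> * t} s *\<^sub>R f (Y \<rho> s \<omega>) = indicator {0..\<Lambda> * t} s *\<^sub>R f' (Y \<rho> s \<omega>)"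
    by eventually_elim (auto simp: indicator_def Z(1))
  note AE = this
  have "(LINT s:{0..\<Lambda> * t}|lebesgue. f (Y \<rho> s \<omega>)) = (LINT s|lebesgue. indicator {0..\<Lambda> * t} s *\<^sub>R f' (Y \<rho> s \<omega>))"
    unfolding set_lebesgue_integral_def
    by (rule Bochner_Integration.integral_cong_AE[OF measurable_completion_AE_eq(1)[OF m AE] mc AE_completion[OF AE]])
  also have "\<dots> = (LINT s|lborel. indicator {0..\<Lambda> * t} s *\<^sub>R f' (Y \<rho> s \<omega>))" by (rule integral_completion[OF m])
  also have "\<dots> = \<Lambda> * (LINT u|lborel. indicator {0..\<Lambda> * t} (0 + \<Lambda> * u) *\<^sub>R f' (Y \<rho> (0 + \<Lambda> * u) \<omega>))"
    using lborel_integral_real_affine[of \<Lambda> "\<lambda>s. indicator {0..\<Lambda> * t} s *\<^sub>R f' (Y \<rho> s \<omega>)" 0] \<open>\<Lambda> > 0\<close> by simp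
  also have "(LINT u|lborel. indicator {0..\<Lambda> * t} (0 + \<Lambda> * u) *\<^sub>R f' (Y \<rho> (0 + \<Lambda> * u) \<omega>))
      = (LINT u|lborel. indicator {0..t} u *\<^sub>R f' (\<Lambda> powr h * Y (\<rho> * \<Lambda>) u \<omega>))"
  proof (intro Bochner_Integration.integral_cong refl)
    fix u
    have 1: "indicator {0..\<Lambda> * t} (0 + \<Lambda> * u) = (indicator {0..t} u :: real)"
      using \<open>\<Lambda> > 0\<close> by (auto simp: indicator_def zero_le_mult_iff)
    \<comment> \<open>Holds exactly on every path: both sides contain the same increment of
      \<open>B\<close>, and \<open>(\<rho> * \<Lambda>) powr h\<close> factors.\<close>
    have "Y \<rho> (0 + \<Lambda> * u) \<omega> = \<Lambda> powr h * Y (\<rho> * \<Lambda>) u \<omega>"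
      using \<open>\<Lambda> > 0\<close> \<open>\<rho> > 0\<close> by (simp add: Y_def powr_mult mult.assoc)
    with 1 show "indicator {0..\<Lambda> * t} (0 + \<Lambda> * u) *\<^sub>R f' (Y \<rho> (0 + \<Lambda> * u) \<omega>)
        = indicator {0..t} u *\<^sub>R f' (\<Lambda> powr h * Y (\<rho> * \<Lambda>) u \<omega>)" by simp
  qed
  also have "(LINT u|lborel. indicator {0..t} u *\<^sub>R f' (\<Lambda> powr h * Y (\<rho> * \<Lambda>) u \<omega>))
      = (LINT u|restrict_space lborel {0..t}. f' (\<Lambda> powr h * Y (\<rho> * \<Lambda>) u \<omega>))"
    by (subst integral_restrict_space) auto
  finally have "1 / \<Lambda> powr (1 - h) * (LINT s:{0..\<Lambda> * t}|lebesgue. f (Y \<rho> s \<omega>))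
      = (\<Lambda> / \<Lambda> powr (1 - h)) * (LINT u|restrict_space lborel {0..t}. f' (\<Lambda> powr h * Y (\<rho> * \<Lambda>) u \<omega>))" by simp
  also have "\<Lambda> / \<Lambda> powr (1 - h) = \<Lambda> powr h"
    using \<open>\<Lambda> > 0\<close> by (simp add: powr_diff)
  finally show ?thesis by simp
qed

text \<open>The horizon is \<open>t\<close> for every \<open>\<Lambda>\<close>, so all these laws
  are carried by the same paths of \<open>X\<close> and the outer limit becomes an almost sure
  one.\<close>

definition limit_law :: "(real \<Rightarrow> real) \<Rightarrow> real \<Rightarrow> real \<Rightarrow> real measure" where
  "limit_law f t \<Lambda> = distr N borel
     (\<lambda>\<omega>. LINT s|restrict_space lborel {0..t}. \<Lambda> powr h * f (\<Lambda> powr h * X s \<omega>))"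

lemma real_distribution_limit_law:
  assumes [measurable]: "f \<in> borel_measurable borel"
  shows "real_distribution (limit_law f t \<Lambda>)"
  unfolding limit_law_def
  by (intro real_distribution_distr_of_prob_space[OF N.prob_space_axioms]
      occupation_functional_measurable(2)[where g="\<lambda>x. \<Lambda> powr h * f (\<Lambda> powr h * x)" and r=1]) auto

text \<open>For fixed \<open>\<Lambda>\<close> the functional is that of the rescaled function
  \<open>g\<close> along the scales \<open>\<rho> * \<Lambda>\<close>, which tend to 0 with
  \<open>\<rho>\<close>.\<close>

lemma inner_limit:
  fixes f f' :: "real \<Rightarrow> real"
  assumes "\<Lambda> > 0" "t \<ge> 0" and f': "integrable lborel f'"
    and Z: "Z \<in> null_sets lborel" "\<And>x. x \<notin> Z \<Longrightarrow> f x = f' x"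
  shows "converges_in_law (\<lambda>\<rho>. distr (completion M) borel
      (\<lambda>\<omega>. 1 / \<Lambda> powr (1 - h) * (LINT s:{0..\<Lambda> * t}|lebesgue. f ((B (\<rho> * s + t0) \<omega> - B t0 \<omega>) / \<rho> powr h))))
    (limit_law f' t \<Lambda>) (at_right 0)"
proof -
  have [measurable]: "f' \<in> borel_measurable borel" using f' by auto
  define g where "g x = \<Lambda> powr h * f' (\<Lambda> powr h * x)" for x
  have g: "integrable lborel g"
    unfolding g_def using lborel_integrable_real_affine[OF f', of "\<Lambda> powr h" 0] \<open>\<Lambda> > 0\<close> by auto
  then have [measurable]: "g \<in> borel_measurable borel" by auto
  let ?T = "restrict_space lborel {0..t}"
  let ?F = "\<lambda>\<rho> \<omega>. 1 / \<Lambda> powr (1 - h) * (LINT s:{0..\<Lambda> * t}|lebesgue. f ((B (\<rho> * s + t0) \<omega> - B t0 \<omega>) / \<rho> powr h))"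
  let ?E = "\<lambda>\<rho> \<omega>. LINT s|?T. g (Y (\<rho> * \<Lambda>) s \<omega>)"
  have "\<Lambda> * t \<ge> 0" using assms by simp
  obtain r0 where r0: "r0 > 0"
    "\<And>r. r > 0 \<Longrightarrow> r < r0 \<Longrightarrow> AE \<omega> in M. AE s in restrict_space lborel {0..\<Lambda> * t}. Y r s \<omega> \<notin> Z"
    using occupation_null[OF \<open>\<Lambda> * t \<ge> 0\<close> Z(1)] by blast
  have E: "?E \<rho> \<in> borel_measurable M" if "\<rho> > 0" for \<rho>
    using that \<open>\<Lambda> > 0\<close> by (intro occupation_functional_measurable(1)) auto
  have eq: "distr (completion M) borel (?F \<rho>) = distr M borel (?E \<rho>)" if \<rho>: "0 < \<rho>" "\<rho> < r0" for \<rho>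
  proof (rule measurable_completion_AE_eq(2)[OF E[OF \<rho>(1)]])
    show "AE \<omega> in M. ?F \<rho> \<omega> = ?E \<rho> \<omega>"
      using r0(2)[OF \<rho>] AE_space
    proof eventually_elim
      case (elim \<omega>)
      show ?case
        using rescaled_functional_eq[where f=f and f'=f' and Z=Z, OF \<open>\<Lambda> > 0\<close> \<rho>(1) \<open>t \<ge> 0\<close> _ elim(2) Z(2) elim(1)]
        by (simp add: g_def Y_def)
    qed
  qed
  show ?thesis
  proof (rule converges_in_law_at_right_sequentially[OF _ r0(1)])
    show "real_distribution (limit_law f' t \<Lambda>)" by (rule real_distribution_limit_law) simp
    show "real_distribution (distr (completion M) borel (?F \<rho>))" if "0 < \<rho>" "\<rho> < r0" for \<rho>
      unfolding eq[OF that] by (rule real_distribution_distr_of_prob_space[OF M.prob_space_axioms E[OF that(1)]])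
    fix r :: "nat \<Rightarrow> real" and \<theta> assume r: "\<And>n. 0 < r n" "\<And>n. r n < r0" "r \<longlonglongrightarrow> 0"
    have "(\<lambda>n. r n * \<Lambda>) \<longlonglongrightarrow> 0" using tendsto_mult_left_zero[OF r(3)] by simp
    \<comment> \<open>The argument \<open>\<theta>\<close> is moved into the function, because the
      convergence theorem treats characteristic functions at 1.\<close>
    then have "(\<lambda>n. CLINT \<omega>|M. iexp (LINT s|?T. \<theta> * g (Y (r n * \<Lambda>) s \<omega>))) \<longlonglongrightarrow> (CLINT \<omega>|N. iexp (LINT s|?T. \<theta> * g (X s \<omega>)))"
      using r(1) \<open>\<Lambda> > 0\<close> \<open>t \<ge> 0\<close> g
      by (intro occupation_functional_iexp_tendsto[where g="\<lambda>x. \<theta> * g x"] integrable_mult_right) auto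
    moreover have "char (limit_law f' t \<Lambda>) \<theta> = (CLINT \<omega>|N. iexp (\<theta> * (LINT s|?T. g (X s \<omega>))))"
      unfolding limit_law_def g_def[symmetric]
      by (rule char_distr_eq[OF occupation_functional_measurable(2)[where r=1]]) auto
    ultimately show "(\<lambda>n. char (distr (completion M) borel (?F (r n))) \<theta>) \<longlonglongrightarrow> char (limit_law f' t \<Lambda>) \<theta>"
      by (simp only: eq[OF r(1,2)] char_distr_eq[OF E[OF r(1)]] integral_mult_right_zero)
  qed
qed

text \<open>Along a fixed path the occupation formula turns the time integral into an integral of
  \<open>f\<close> against the local time at \<open>y / \<Lambda> powr h\<close>, and these points
  shrink to 0. Almost sure convergence then gives convergence in law.\<close>

lemma outer_limit:
  fixes f :: "real \<Rightarrow> real"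
  assumes l: "jointly_continuous_local_time N X l" and f: "integrable lborel f"
    and supp: "\<And>x. \<bar>x\<bar> > R \<Longrightarrow> f x = 0" and "t \<ge> 0"
  shows "converges_in_law (limit_law f t)
    (distr (completion N) borel (\<lambda>\<omega>. (LINT x|lborel. f x) * l t 0 \<omega>)) at_top"
proof -
  have [measurable]: "f \<in> borel_measurable borel" using f by auto
  let ?T = "restrict_space lborel {0..t}"
  define F where "F \<Lambda> \<omega> = (LINT s|?T. \<Lambda> powr h * f (\<Lambda> powr h * X s \<omega>))" for \<Lambda> \<omega>
  let ?c = "LINT x|lborel. f x"
  have F [measurable]: "F \<Lambda> \<in> borel_measurable N" for \<Lambda>
    unfolding F_def by (rule occupation_functional_measurable(2)[where g="\<lambda>x. \<Lambda> powr h * f (\<Lambda> powr h * x)" and r=1]) auto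
  have lim: "AE \<omega> in N. ((\<lambda>\<Lambda>. F \<Lambda> \<omega>) \<longlongrightarrow> ?c * l t 0 \<omega>) at_top"
    using l[unfolded jointly_continuous_local_time_def] AE_space
  proof eventually_elim
    case (elim \<omega>)
    have [measurable]: "(\<lambda>s. X s \<omega>) \<in> borel_measurable ?T" by (rule measurable_section[OF measurable_X elim(2)])
    define lt where "lt x = l t x \<omega>" for x
    have cont: "continuous_on ({0..} \<times> UNIV) (\<lambda>(t, x). l t x \<omega>)" using elim(1) by auto
    have contl: "continuous_on UNIV lt"
      using continuous_on_compose2[OF cont, of UNIV "\<lambda>x. (t, x)"] \<open>t \<ge> 0\<close>
      by (simp add: lt_def[abs_def] continuous_on_Pair continuous_on_const continuous_on_id image_subset_iff)
    then have [measurable]: "lt \<in> borel_measurable borel" by (rule borel_measurable_continuous_onI)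
    have nn: "0 \<le> lt x" for x using elim(1) \<open>t \<ge> 0\<close> by (auto simp: lt_def)
    have occ: "distr ?T borel (\<lambda>s. X s \<omega>) = density lborel (\<lambda>x. ennreal (lt x))"
      using elim(1) \<open>t \<ge> 0\<close> by (auto simp: occupation_measure_def lt_def)
    \<comment> \<open>A bound for the local time on \<open>{-R..R}\<close> suffices: for
      \<open>\<Lambda> \<ge> 1\<close> the point \<open>y / \<Lambda> powr h\<close> stays in this
      interval whenever \<open>f y\<close> is nonzero.\<close>
    have "compact (lt ` {-R..R})"
      by (intro compact_continuous_image continuous_on_subset[OF contl]) auto
    from compact_imp_bounded[OF this]
    obtain L where "\<forall>y\<in>lt ` {-R..R}. norm y \<le> L" unfolding bounded_iff by blast
    then have L: "\<bar>lt x\<bar> \<le> L" if "x \<in> {-R..R}" for x using that by auto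
    have eq: "F \<Lambda> \<omega> = (LINT y|lborel. lt (y / \<Lambda> powr h) * f y)" if "\<Lambda> > 0" for \<Lambda>
    proof -
      have "F \<Lambda> \<omega> = (LINT x|distr ?T borel (\<lambda>s. X s \<omega>). \<Lambda> powr h * f (\<Lambda> powr h * x))"
        unfolding F_def by (subst integral_distr) auto
      also have "\<dots> = (LINT x|lborel. lt x * (\<Lambda> powr h * f (\<Lambda> powr h * x)))"
        unfolding occ using nn by (subst integral_density) auto
      also have "\<dots> = \<Lambda> powr h * (LINT x|lborel. lt ((0 + \<Lambda> powr h * x) / \<Lambda> powr h) * f (0 + \<Lambda> powr h * x))"
        unfolding integral_mult_right_zero[symmetric] using that
        by (intro Bochner_Integration.integral_cong refl) simp
      also have "\<dots> = (LINT y|lborel. lt (y / \<Lambda> powr h) * f y)"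
        using lborel_integral_real_affine[of "\<Lambda> powr h" "\<lambda>y. lt (y / \<Lambda> powr h) * f y" 0] that by simp
      finally show ?thesis .
    qed
    have "((\<lambda>\<Lambda>. LINT y|lborel. lt (y / \<Lambda> powr h) * f y) \<longlongrightarrow> (LINT y|lborel. lt 0 * f y)) at_top"
    proof (rule integral_dominated_convergence_at_top[where w="\<lambda>y. L * \<bar>f y\<bar>"])
      show "integrable lborel (\<lambda>y. L * \<bar>f y\<bar>)" using f by auto
      show "AE y in lborel. ((\<lambda>\<Lambda>. lt (y / \<Lambda> powr h) * f y) \<longlongrightarrow> lt 0 * f y) at_top"
      proof (intro AE_I2 tendsto_mult tendsto_const)
        fix y
        have "((\<lambda>\<Lambda>. y * \<Lambda> powr (- h)) \<longlongrightarrow> y * 0) at_top"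
          using h by (intro tendsto_mult_left tendsto_neg_powr filterlim_ident) auto
        then have "((\<lambda>\<Lambda>. y / \<Lambda> powr h) \<longlongrightarrow> 0) at_top" by (simp add: powr_minus divide_inverse)
        moreover have "isCont lt 0" using contl by (simp add: continuous_on_eq_continuous_at)
        ultimately show "((\<lambda>\<Lambda>. lt (y / \<Lambda> powr h)) \<longlongrightarrow> lt 0) at_top"
          by (rule isCont_tendsto_compose[rotated])
      qed
      show "\<forall>\<^sub>F \<Lambda> in at_top. AE y in lborel. norm (lt (y / \<Lambda> powr h) * f y) \<le> L * \<bar>f y\<bar>"
        using eventually_ge_at_top[of "1::real"]
      proof eventually_elim
        case (elim \<Lambda>)
        then have "1 \<le> \<Lambda> powr h" using h by (simp add: ge_one_powr_ge_zero)
        show ?case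
        proof (intro AE_I2)
          fix y
          show "norm (lt (y / \<Lambda> powr h) * f y) \<le> L * \<bar>f y\<bar>"
          proof (cases "\<bar>y\<bar> > R")
            case False
            have "\<bar>y / \<Lambda> powr h\<bar> \<le> \<bar>y\<bar> / 1"
              unfolding abs_divide using \<open>1 \<le> \<Lambda> powr h\<close> by (intro divide_left_mono) auto
            with False have "\<bar>y / \<Lambda> powr h\<bar> \<le> R" by linarith
            then have "- R \<le> y / \<Lambda> powr h" "y / \<Lambda> powr h \<le> R" by linarith+
            then have "y / \<Lambda> powr h \<in> {-R..R}" by (simp only: atLeastAtMost_iff)
            from L[OF this] show ?thesis by (simp add: abs_mult mult_right_mono)
          qed (simp add: supp)
        qed
      qed
    qed measurable
    then have "((\<lambda>\<Lambda>. LINT y|lborel. lt (y / \<Lambda> powr h) * f y) \<longlongrightarrow> ?c * lt 0) at_top"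
      by (simp add: mult.commute)
    moreover have "eventually (\<lambda>\<Lambda>. (LINT y|lborel. lt (y / \<Lambda> powr h) * f y) = F \<Lambda> \<omega>) at_top"
      using eventually_gt_at_top[of "0::real"] by eventually_elim (rule eq[symmetric])
    ultimately show ?case unfolding lt_def by (rule Lim_transform_eventually)
  qed
  \<comment> \<open>The local time comes with continuity in \<open>(t, x)\<close> but not with
    measurability in the sample point. The limit along the integers is a measurable version of the
    right-hand side.\<close>
  define G where "G \<omega> = lim (\<lambda>n. F (real n) \<omega>)" for \<omega>
  have G_meas [measurable]: "G \<in> borel_measurable N" unfolding G_def by (rule borel_measurable_lim_metric[OF F])
  have G: "AE \<omega> in N. ?c * l t 0 \<omega> = G \<omega>"
    using lim
  proof eventually_elim
    case (elim \<omega>)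
    from filterlim_compose[OF this filterlim_real_sequentially]
    show ?case unfolding G_def by (rule limI[symmetric])
  qed
  have eq: "distr (completion N) borel (\<lambda>\<omega>. ?c * l t 0 \<omega>) = distr N borel G"
    by (rule measurable_completion_AE_eq(2)[OF _ G]) simp
  show ?thesis unfolding eq
  proof (rule converges_in_law_at_top_sequentially)
    show "real_distribution (distr N borel G)"
      by (rule real_distribution_distr_of_prob_space[OF N.prob_space_axioms]) simp
    show "real_distribution (limit_law f t \<Lambda>)" for \<Lambda> by (rule real_distribution_limit_law) simp
    fix r :: "nat \<Rightarrow> real" and \<theta> assume r: "filterlim r at_top sequentially"
    have "(\<lambda>n. CLINT \<omega>|N. iexp (\<theta> * F (r n) \<omega>)) \<longlonglongrightarrow> (CLINT \<omega>|N. iexp (\<theta> * G \<omega>))"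
    proof (rule integral_dominated_convergence[where w="\<lambda>_. 1"])
      show "AE \<omega> in N. (\<lambda>n. iexp (\<theta> * F (r n) \<omega>)) \<longlonglongrightarrow> iexp (\<theta> * G \<omega>)"
        using lim G
      proof eventually_elim
        case (elim \<omega>)
        from filterlim_compose[OF elim(1) r] have "(\<lambda>n. F (r n) \<omega>) \<longlonglongrightarrow> G \<omega>" by (simp only: elim(2))
        then show ?case by (intro tendsto_intros)
      qed
    qed auto
    then show "(\<lambda>n. char (limit_law f t (r n)) \<theta>) \<longlonglongrightarrow> char (distr N borel G) \<theta>"
      unfolding limit_law_def F_def[symmetric] by (simp only: char_distr_eq[OF F] char_distr_eq[OF G_meas])
  qed
qed

end

section \<open>Both representations of multifractional Brownian motion\<close>

text \<open>Turns a bound quadratic in the change \<open>\<eta>\<close> of the Hurst parameter into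
  one in time, by inserting the Hoelder estimate for \<open>\<eta>\<close>. \<open>D\<close> stands
  for the squared distance of kernels in either representation.\<close>

lemma perturbation_near_t0:
  fixes D :: "real \<Rightarrow> real \<Rightarrow> real"
  assumes \<delta>: "\<delta> > 0" and "\<beta> > 0" and t0: "t0 \<ge> 0"
    and D: "\<And>\<eta> t. \<bar>\<eta>\<bar> \<le> \<delta> \<Longrightarrow> 0 \<le> t \<Longrightarrow> t \<le> t0 + 1 \<Longrightarrow> D (H t0 + \<eta>) t \<le> C * \<eta>\<^sup>2"
    and H: "holder_continuous_on \<beta> {0..} H"
  shows "\<exists>C v0. v0 > 0 \<and> (\<forall>v\<in>{0..v0}. D (H (v + t0)) (v + t0) \<le> (C * v powr \<beta>)\<^sup>2)"
proof -
  obtain K where K: "K \<ge> 0" "\<And>s u. s \<ge> 0 \<Longrightarrow> u \<ge> 0 \<Longrightarrow> \<bar>H s - H u\<bar> \<le> K * \<bar>s - u\<bar> powr \<beta>"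
    using H unfolding holder_continuous_on_def by (meson atLeast_iff)
  \<comment> \<open>The second bound forces \<open>\<bar>\<eta>\<bar> \<le> \<delta>\<close>, the
    first keeps the times below \<open>t0 + 1\<close>; the 1 in \<open>K + 1\<close> guards against
    \<open>K = 0\<close>.\<close>
  define v0 where "v0 = min 1 ((\<delta> / (K + 1)) powr (1 / \<beta>))"
  have "v0 > 0" using \<delta> K(1) by (simp add: v0_def)
  have "D (H (v + t0)) (v + t0) \<le> (sqrt \<bar>C\<bar> * K * v powr \<beta>)\<^sup>2" if v: "v \<in> {0..v0}" for v
  proof -
    define \<eta> where "\<eta> = H (v + t0) - H t0"
    have \<eta>: "\<bar>\<eta>\<bar> \<le> K * v powr \<beta>" using K(2)[of "v + t0" t0] v t0 by (simp add: \<eta>_def)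
    have "v powr \<beta> \<le> ((\<delta> / (K + 1)) powr (1 / \<beta>)) powr \<beta>"
      using v \<open>\<beta> > 0\<close> by (intro powr_mono2) (auto simp: v0_def)
    also have "\<dots> = \<delta> / (K + 1)" using \<open>\<beta> > 0\<close> \<delta> K(1) by (simp add: powr_powr)
    finally have "K * v powr \<beta> \<le> (K + 1) * (\<delta> / (K + 1))" using K(1) by (intro mult_mono) auto
    also have "\<dots> = \<delta>" using K(1) by simp
    finally have "\<bar>\<eta>\<bar> \<le> \<delta>" using \<eta> by linarith
    then have "D (H t0 + \<eta>) (v + t0) \<le> C * \<eta>\<^sup>2" using v t0 by (intro D) (auto simp: v0_def)
    also have "\<dots> \<le> \<bar>C\<bar> * (K * v powr \<beta>)\<^sup>2"
      using power2_mono_abs[OF \<eta>] by (intro mult_mono) auto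
    also have "\<dots> = (sqrt \<bar>C\<bar> * K * v powr \<beta>)\<^sup>2" by (simp add: power_mult_distrib)
    finally show ?thesis by (simp add: \<eta>_def)
  qed
  with \<open>v0 > 0\<close> show ?thesis by blast
qed

lemma multifractional_brownian_motion_marginal_measurable:
  assumes "multifractional_brownian_motion R M W H B" "t \<ge> 0"
  shows "B t \<in> borel_measurable M"
proof -
  have B: "(\<lambda>(t, \<omega>). B t \<omega>) \<in> borel_measurable (restrict_space borel {0..} \<Otimes>\<^sub>M M)"
    using assms(1) by (simp add: multifractional_brownian_motion_def)
  have "t \<in> space (restrict_space borel {0..})" using assms(2) by (simp add: space_restrict_space)
  from measurable_compose[OF measurable_Pair1'[OF this] B] show ?thesis by simp
qed

text \<open>All differences between the two representations end here. The moving average has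
  explicit kernels; for the harmonizable one they are real parts of transforms, and Bessel's
  inequality carries the closeness of the kernels over from the frequency side.\<close>

lemma self_similar_kernels_exist:
  assumes H01: "0 < H t0" "H t0 < 1" "H t0 < \<beta>" and holder: "holder_continuous_on \<beta> {0..} H"
    and B: "multifractional_brownian_motion R M W H B" and t0: "t0 \<ge> 0"
    and X: "fractional_brownian_motion R N V (H t0) X"
    and l: "jointly_continuous_local_time N X l"
  shows "\<exists>\<kappa> k. self_similar_kernels M N W B V X \<kappa> k (H t0) \<beta> t0"
proof -
  let ?h = "H t0"
  have X': "multifractional_brownian_motion R N V (\<lambda>_. ?h) X" using X by (simp add: fractional_brownian_motion_def)
  have W: "two_sided_brownian_motion M W" and V: "two_sided_brownian_motion N V"
    and mB: "(\<lambda>(t, \<omega>). B t \<omega>) \<in> borel_measurable (restrict_space borel {0..} \<Otimes>\<^sub>M M)"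
    and mX: "(\<lambda>(t, \<omega>). X t \<omega>) \<in> borel_measurable (restrict_space borel {0..} \<Otimes>\<^sub>M N)"
    using B X' by (auto simp: multifractional_brownian_motion_def)
  have "\<beta> > 0" using H01 by simp
  have l': "\<exists>l. jointly_continuous_local_time N X l" using l by blast
  show ?thesis
  proof (cases R)
    case Moving_Average
    have wB: "has_wiener_integral M W (ma_kernel (H t) t) (B t)" if "t \<ge> 0" for t
      using B that by (intro moving_average_value_imp_wiener[OF W _ that multifractional_brownian_motion_marginal_measurable[OF B that]])
        (simp add: multifractional_brownian_motion_def Moving_Average)
    have wX: "has_wiener_integral N V (ma_kernel ?h t) (X t)" if "t \<ge> 0" for t
      using X' that by (intro moving_average_value_imp_wiener[OF V _ that multifractional_brownian_motion_marginal_measurable[OF X' that]])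
        (simp add: multifractional_brownian_motion_def Moving_Average)
    have sq: "square_integrable lborel (ma_kernel ?h t)" if "t \<ge> 0" for t
      using wX[OF that] by (simp add: has_wiener_integral_def)
    obtain C \<delta> where C: "\<delta> > 0" "\<And>\<eta> t. \<bar>\<eta>\<bar> \<le> \<delta> \<Longrightarrow> 0 \<le> t \<Longrightarrow> t \<le> t0 + 1 \<Longrightarrow>
        (LINT u|lborel. (ma_kernel (?h + \<eta>) t u - ma_kernel ?h t u)\<^sup>2) \<le> C * \<eta>\<^sup>2"
      using ma_kernel_near[OF H01(1,2) sq, where T="t0 + 1"] by blast
    have near: "\<exists>C v0. v0 > 0 \<and> (\<forall>v\<in>{0..v0}.
        (LINT u|lborel. (ma_kernel (H (v + t0)) (v + t0) u - ma_kernel ?h (v + t0) u)\<^sup>2) \<le> (C * v powr \<beta>)\<^sup>2)"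
      by (rule perturbation_near_t0[where D="\<lambda>h' t. LINT u|lborel. (ma_kernel h' t u - ma_kernel ?h t u)\<^sup>2",
            OF C(1) \<open>\<beta> > 0\<close> t0 C(2) holder])
    have "self_similar_kernels M N W B V X (\<lambda>t. ma_kernel (H t) t) (ma_kernel ?h) ?h \<beta> t0"
      by (rule self_similar_kernels.intro[OF W V wB wX mB mX _ near H01 t0 l']) (simp_all add: ma_kernel_scaling)
    then show ?thesis by blast
  next
    case Harmonizable
    have "\<exists>G. has_L2_fourier_transform (harm_kernel (H t) t) G \<and> has_wiener_integral M W (\<lambda>x. Re (G x)) (B t)"
      if "t \<in> {0..}" for t
    proof -
      have "harmonizable_value M W (H t) t (B t)"
        using B that by (simp add: multifractional_brownian_motion_def Harmonizable)
      from harmonizable_value_imp_wiener[OF W this] show ?thesis by blast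
    qed
    \<comment> \<open>A transform is determined only up to null sets, so one is chosen for each
      time; the almost everywhere relations hold for any choice.\<close>
    then obtain GB where "\<forall>t\<in>{0..}. has_L2_fourier_transform (harm_kernel (H t) t) (GB t) \<and>
        has_wiener_integral M W (\<lambda>x. Re (GB t x)) (B t)"
      using bchoice[of "{0..}" "\<lambda>t G. has_L2_fourier_transform (harm_kernel (H t) t) G \<and>
        has_wiener_integral M W (\<lambda>x. Re (G x)) (B t)"] by blast
    then have GB: "\<And>t. t \<ge> 0 \<Longrightarrow> has_L2_fourier_transform (harm_kernel (H t) t) (GB t)"
      "\<And>t. t \<ge> 0 \<Longrightarrow> has_wiener_integral M W (\<lambda>x. Re (GB t x)) (B t)" by auto
    have "\<exists>G. has_L2_fourier_transform (harm_kernel ?h t) G \<and> has_wiener_integral N V (\<lambda>x. Re (G x)) (X t)"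
      if "t \<in> {0..}" for t
    proof -
      have "harmonizable_value N V ?h t (X t)"
        using X' that by (simp add: multifractional_brownian_motion_def Harmonizable)
      from harmonizable_value_imp_wiener[OF V this] show ?thesis by blast
    qed
    then obtain G where "\<forall>t\<in>{0..}. has_L2_fourier_transform (harm_kernel ?h t) (G t) \<and>
        has_wiener_integral N V (\<lambda>x. Re (G t x)) (X t)"
      using bchoice[of "{0..}" "\<lambda>t G. has_L2_fourier_transform (harm_kernel ?h t) G \<and>
        has_wiener_integral N V (\<lambda>x. Re (G x)) (X t)"] by blast
    then have G: "\<And>t. t \<ge> 0 \<Longrightarrow> has_L2_fourier_transform (harm_kernel ?h t) (G t)"
      "\<And>t. t \<ge> 0 \<Longrightarrow> has_wiener_integral N V (\<lambda>x. Re (G t x)) (X t)" by auto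
    have T: "t0 + 1 \<ge> 0" using t0 by simp
    obtain C \<delta> where C: "\<delta> > 0" "\<And>\<eta> t. \<bar>\<eta>\<bar> \<le> \<delta> \<Longrightarrow> 0 \<le> t \<Longrightarrow> t \<le> t0 + 1 \<Longrightarrow>
        (LINT \<xi>|lborel. (norm (harm_kernel (?h + \<eta>) t \<xi> - harm_kernel ?h t \<xi>))\<^sup>2) \<le> C * \<eta>\<^sup>2"
      using harm_kernel_perturb[OF H01(1,2) T] by blast
    have C2: "2 * (LINT \<xi>|lborel. (norm (harm_kernel (?h + \<eta>) t \<xi> - harm_kernel ?h t \<xi>))\<^sup>2) \<le> (2 * C) * \<eta>\<^sup>2"
      if "\<bar>\<eta>\<bar> \<le> \<delta>" "0 \<le> t" "t \<le> t0 + 1" for \<eta> t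
      using C(2)[OF that] by simp
    from perturbation_near_t0[where D="\<lambda>h' t. 2 * (LINT \<xi>|lborel. (norm (harm_kernel h' t \<xi> - harm_kernel ?h t \<xi>))\<^sup>2)",
        OF C(1) \<open>\<beta> > 0\<close> t0 C2 holder]
    obtain C' v0 where C': "v0 > 0" "\<And>v. v \<in> {0..v0} \<Longrightarrow>
        2 * (LINT \<xi>|lborel. (norm (harm_kernel (H (v + t0)) (v + t0) \<xi> - harm_kernel ?h (v + t0) \<xi>))\<^sup>2) \<le> (C' * v powr \<beta>)\<^sup>2"
      by blast
    have "(LINT u|lborel. (Re (GB (v + t0) u) - Re (G (v + t0) u))\<^sup>2) \<le> (C' * v powr \<beta>)\<^sup>2" if "v \<in> {0..v0}" for v
    proof (rule order_trans[OF harm_transform_near C'(2)[OF that]])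
      have nn: "v + t0 \<ge> 0" using that t0 by simp
      show "has_L2_fourier_transform (harm_kernel (H (v + t0)) (v + t0)) (GB (v + t0))" by (rule GB(1)[OF nn])
      show "has_L2_fourier_transform (harm_kernel ?h (v + t0)) (G (v + t0))" by (rule G(1)[OF nn])
    qed
    then have near: "\<exists>C v0. v0 > 0 \<and> (\<forall>v\<in>{0..v0}.
        (LINT u|lborel. (Re (GB (v + t0) u) - Re (G (v + t0) u))\<^sup>2) \<le> (C * v powr \<beta>)\<^sup>2)"
      using C'(1) by blast
    have scal: "AE u in lborel. Re (G (r * s + t) u) - Re (G t u) = r powr (?h - 1/2) * Re (G s ((u - t) / r))"
      if "t \<ge> 0" "r > 0" "s \<ge> 0" for t r s
      by (rule harm_transform_scaling[OF that(2) G(1) G(1)[OF that(1)] G(1)[OF that(3)]]) (use that in simp)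
    have "self_similar_kernels M N W B V X (\<lambda>t x. Re (GB t x)) (\<lambda>t x. Re (G t x)) ?h \<beta> t0"
      by (rule self_similar_kernels.intro[OF W V GB(2) G(2) mB mX scal near H01 t0 l'])
    then show ?thesis by blast
  qed
qed

theorem proposition5p2:
  fixes H :: "real \<Rightarrow> real" and \<mu> \<nu> \<beta> :: real
    and R :: mbm_representation
    and M :: "'a measure" and W B :: "real \<Rightarrow> 'a \<Rightarrow> real"
    and N :: "'b measure" and V X :: "real \<Rightarrow> 'b \<Rightarrow> real"
    and l :: "real \<Rightarrow> real \<Rightarrow> 'b \<Rightarrow> real"
    and f :: "real \<Rightarrow> real" and t0 t :: real
  assumes "{\<mu>..\<nu>} \<subseteq> {0<..<1}"
    and "\<forall>s\<ge>0. H s \<in> {\<mu>..\<nu>}"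
    and "holder_continuous_on \<beta> {0..} H"
    and "(SUP s\<in>{0..}. H s) < \<beta>"
    and "multifractional_brownian_motion R M W H B"
    and "t0 \<ge> 0"
    and "fractional_brownian_motion R N V (H t0) X"
    and "jointly_continuous_local_time N X l"
    and "integrable lebesgue f"
    and "locally_riemann_integrable f"
    and "compactly_supported f"
    and "(LINT x|lebesgue. f x) \<noteq> 0"
    and "t \<ge> 0"
  shows "\<exists>L :: real \<Rightarrow> real measure.
    (\<forall>\<Lambda>>0. converges_in_law
       (\<lambda>\<rho>. distr (completion M) borel
          (\<lambda>\<omega>. 1 / \<Lambda> powr (1 - H t0) *
             (LINT s:{0..\<Lambda> * t}|lebesgue. f ((B (\<rho> * s + t0) \<omega> - B t0 \<omega>) / \<rho> powr (H t0)))))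
       (L \<Lambda>) (at_right 0)) \<and>
    converges_in_law L
      (distr (completion N) borel (\<lambda>\<omega>. (LINT x|lebesgue. f x) * l t 0 \<omega>)) at_top"
proof -
  have "H t0 \<in> {0<..<1}" using assms(1,2,6) by blast
  \<comment> \<open>Boundedness is what makes the supremum a genuine upper bound of
    \<open>H t0\<close>.\<close>
  moreover have "bdd_above (H ` {0..})" using assms(2) by (intro bdd_aboveI[of _ \<nu>]) auto
  then have "H t0 \<le> (SUP s\<in>{0..}. H s)" using assms(6) by (intro cSUP_upper) auto
  ultimately have "0 < H t0" "H t0 < 1" "H t0 < \<beta>" using assms(4) by auto
  then obtain \<kappa> k where "self_similar_kernels M N W B V X \<kappa> k (H t0) \<beta> t0"
    using self_similar_kernels_exist[OF _ _ _ assms(3,5,6,7,8)] by blast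
  then interpret self_similar_kernels M N W B V X \<kappa> k "H t0" \<beta> t0 .
  obtain R where R: "\<And>x. \<bar>x\<bar> > R \<Longrightarrow> f x = 0"
  proof -
    have "bounded (closure {x. f x \<noteq> 0})"
      using assms(11) by (simp add: compactly_supported_def compact_imp_bounded)
    then have "bounded {x. f x \<noteq> 0}" by (rule bounded_subset[OF _ closure_subset])
    then obtain R where "\<forall>x\<in>{x. f x \<noteq> 0}. norm x \<le> R" unfolding bounded_iff by blast
    then have "f x = 0" if "\<bar>x\<bar> > R" for x using that by auto
    then show thesis by (rule that)
  qed
  have fm: "f \<in> borel_measurable lebesgue" using assms(9) by (rule borel_measurable_integrable)
  obtain f0 where [measurable]: "f0 \<in> borel_measurable borel" and f0: "AE x in lborel. f x = f0 x"
    using completion_ex_borel_measurable_real[OF fm] by auto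
  \<comment> \<open>The Borel version may be nonzero outside the support of \<open>f\<close>; the
    cutoff restores the vanishing beyond \<open>R\<close> that the outer limit relies on.\<close>
  define f' where "f' x = f0 x * indicator {-R..R} x" for x
  have [measurable]: "f' \<in> borel_measurable borel" unfolding f'_def by measurable
  have ff': "AE x in lborel. f x = f' x"
    using f0
  proof eventually_elim
    case (elim x)
    show ?case
    proof (cases "x \<in> {-R..R}")
      case False
      then have "\<bar>x\<bar> > R" by auto
      with False show ?thesis using R by (simp add: f'_def)
    qed (simp add: elim f'_def)
  qed
  have f'c: "f' \<in> borel_measurable lebesgue" by (rule measurable_completion) simp
  have "integrable lebesgue f'"
    using integrable_cong_AE[OF fm f'c AE_completion[OF ff']] assms(9) by blast
  then have f': "integrable lborel f'" by (subst (asm) integrable_completion) auto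
  have int: "(LINT x|lebesgue. f x) = (LINT x|lborel. f' x)"
    using integral_cong_AE[OF fm f'c AE_completion[OF ff']] by (simp add: integral_completion)
  \<comment> \<open>A Borel null set containing the points where \<open>f\<close> and
    \<open>f'\<close> differ; the inner limit shows that the process does not see it.\<close>
  obtain Z where Z: "Z \<in> null_sets lborel" "{x \<in> space lborel. f x \<noteq> f' x} \<subseteq> Z"
    using ff' unfolding eventually_ae_filter by auto
  have supp': "f' x = 0" if "\<bar>x\<bar> > R" for x
    using that by (auto simp: f'_def indicator_def)
  show ?thesis
    using inner_limit[OF _ assms(13) f' Z(1), of _ f] Z(2) outer_limit[OF assms(8) f' supp' assms(13)]
    unfolding int by (intro exI[of _ "limit_law f' t"] conjI allI impI) auto
qed

end
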